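(* Fix $1 \leq p \leq \infty$ with $p\neq 2$. A nontrivial function $\varphi$ is a Hilbert point in $H^p(\mathbb{T})$ if and only if $\varphi = C I$ for some constant $C \neq 0$ and some inner function $I$ on $\mathbb{T}$.
   Context: $\mathbb{T}$ is the unit circle in $\mathbb{C}$ with normalized Haar (arc length) measure $m_1$. For $f\in L^1(\mathbb{T})$ and $\alpha\in\mathbb{Z}$, $\widehat{f}(\alpha)=\int_{\mathbb{T}} f(z)\overline{z^\alpha}\,dm_1(z)$. The Hardy space $H^p(\mathbb{T})$ is the closed subspace of $L^p(\mathbb{T})$ of functions $f$ with $\widehat f(\alpha)=0$ for all $\alpha<0$, with the $L^p$ norm $\|\cdot\|_{H^p(\mathbb{T})}$. A function $I$ in $H^p(\mathbb{T})$ is called inner if $|I(z)|=1$ for almost every $z\in\mathbb{T}$. Write $\langle f,g\rangle=\int_{\mathbb{T}} f\overline{g}\,dm_1$. A nontrivial (i.e. not a.e. zero) function $\varphi$ in $H^p(\mathbb{T})$, $1\le p\le\infty$, is a Hilbert point in $H^p(\mathbb{T})$ if $\|\varphi\|_{H^p(\mathbb{T})}\le\|\varphi+f\|_{H^p(\mathbb{T})}$ for every $f\in H^p(\mathbb{T})$ such that $\langle f,\varphi\rangle=0$. When $1\le p<2$, the condition $\langle f,\varphi\rangle=0$ is declared to mean that $f$ lies in the closure in $H^p(\mathbb{T})$ of the set of analytic polynomials $g$ with $\langle g,\varphi\rangle=0$. *)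

theory Defs
  imports "HOL-Analysis.Analysis" "HOL-Probability.Essential_Supremum"
begin

definition circle_measure :: "complex measure" where
  "circle_measure =
     distr (uniform_measure lborel {0..<2 * pi}) (restrict_space borel (sphere 0 1)) cis"

text \<open>
  Elements of $L^p$ are represented by measurable functions, to be read modulo equality almost
  everywhere. The values of these functions off the unit circle are irrelevant, since the space of
  the measure is the circle. Using the Borel sigma-algebra instead of its completion is harmless,
  as every Lebesgue measurable function agrees almost everywhere with a Borel measurable one.
\<close>

definition Lp :: "ennreal \<Rightarrow> (complex \<Rightarrow> complex) set" where
  "Lp p = {f \<in> borel_measurable circle_measure.
     if p = \<infinity> then esssup circle_measure (\<lambda>z. ennreal (cmod (f z))) < \<infinity>
     else integrable circle_measure (\<lambda>z. cmod (f z) powr enn2real p)}"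

text \<open>The following real number is meaningful as a norm only on \<^term>\<open>Lp p\<close>.\<close>

definition Lp_norm :: "ennreal \<Rightarrow> (complex \<Rightarrow> complex) \<Rightarrow> real" where
  "Lp_norm p f =
     (if p = \<infinity> then enn2real (esssup circle_measure (\<lambda>z. ennreal (cmod (f z))))
      else (LINT z|circle_measure. cmod (f z) powr enn2real p) powr (1 / enn2real p))"

definition fourier_coeff :: "(complex \<Rightarrow> complex) \<Rightarrow> int \<Rightarrow> complex" where
  "fourier_coeff f \<alpha> = (LINT z|circle_measure. f z * cnj (z powi \<alpha>))"

definition Hp :: "ennreal \<Rightarrow> (complex \<Rightarrow> complex) set" where
  "Hp p = {f \<in> Lp p. \<forall>\<alpha><0. fourier_coeff f \<alpha> = 0}"

definition inner_function :: "ennreal \<Rightarrow> (complex \<Rightarrow> complex) \<Rightarrow> bool" where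
  "inner_function p I \<longleftrightarrow> I \<in> Hp p \<and> (AE z in circle_measure. cmod (I z) = 1)"

definition pairing :: "(complex \<Rightarrow> complex) \<Rightarrow> (complex \<Rightarrow> complex) \<Rightarrow> complex" where
  "pairing f g = (LINT z|circle_measure. f z * cnj (g z))"

text \<open>
  For $p < 2$ the product of two functions in $H^p$ need not be integrable, so orthogonality to
  \<open>\<phi>\<close> means membership in the $H^p$-closure of the analytic polynomials orthogonal to \<open>\<phi>\<close>.
\<close>

definition orthogonal_in_Hp :: "ennreal \<Rightarrow> (complex \<Rightarrow> complex) \<Rightarrow> (complex \<Rightarrow> complex) \<Rightarrow> bool" where
  "orthogonal_in_Hp p f \<phi> \<longleftrightarrow>
     (if p < 2
      then \<forall>\<epsilon>>0. \<exists>q :: complex poly.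
             pairing (poly q) \<phi> = 0 \<and> Lp_norm p (\<lambda>z. f z - poly q z) < \<epsilon>
      else pairing f \<phi> = 0)"

definition nontrivial :: "(complex \<Rightarrow> complex) \<Rightarrow> bool" where
  "nontrivial \<phi> \<longleftrightarrow> \<not> (AE z in circle_measure. \<phi> z = 0)"

definition hilbert_point :: "ennreal \<Rightarrow> (complex \<Rightarrow> complex) \<Rightarrow> bool" where
  "hilbert_point p \<phi> \<longleftrightarrow> \<phi> \<in> Hp p \<and> nontrivial \<phi> \<and>
     (\<forall>f\<in>Hp p. orthogonal_in_Hp p f \<phi> \<longrightarrow> Lp_norm p \<phi> \<le> Lp_norm p (\<lambda>z. \<phi> z + f z))"

end

theory Submission
  imports Defs "HOL-Probability.Probability_Measure"
begin

text \<open>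
  If \<open>\<bar>\<phi>\<bar>\<close> is a constant \<open>c\<close>, then \<open>\<langle>f, \<phi>\<rangle> = 0\<close> gives
  \<open>c\<^sup>2 = \<langle>\<phi> + f, \<phi>\<rangle> \<le> c * \<parallel>\<phi> + f\<parallel>\<close>.

  Conversely, for \<open>p < \<infinity>\<close> compare \<open>\<phi>\<close> with \<open>\<kappa>(1 + s q)\<phi>\<close>, where \<open>q\<close> is a polynomial and \<open>\<kappa>\<close> makes the
  perturbation orthogonal to \<open>\<phi>\<close>. To first order in \<open>s\<close> this says that \<open>\<bar>\<phi>\<bar>\<^sup>p\<close> and a multiple of \<open>\<bar>\<phi>\<bar>\<^sup>2\<close> have
  the same integral against every \<open>Re q\<close>, so \<open>\<bar>\<phi>\<bar>\<close> is constant wherever \<open>\<phi> \<noteq> 0\<close>, that is almost everywhere.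
  When \<open>p < 2\<close> one must first see that \<open>\<phi> \<in> L\<^sup>2\<close>: otherwise the polynomials orthogonal to \<open>\<phi>\<close> are dense,
  so the admissible perturbations include \<open>-\<phi>\<close>. When \<open>p = \<infinity>\<close> the polynomial \<open>1 + s q\<close> is replaced by an outer function.
\<close>

subsection \<open>Integration on the circle\<close>

text \<open>The exponent 2 is excluded by the last step of the finite case:
  \<open>cmod (\<phi> z) powr p = \<gamma> * (cmod (\<phi> z))^2\<close> determines the modulus only
  through a root of order p - 2. At first order a multiplier \<open>1 + s * q\<close> acts through
  \<open>Re q\<close> alone, and this suffices because real parts of polynomials annihilate no
  nonzero integrable function. The sup norm has no comparable first variation: the multiplier must
  have modulus one where \<open>\<phi>\<close> is close to its supremum, so its modulus has to be
  prescribed exactly, which is what an outer function offers.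

  Everything takes place on the circle. Analyticity is the vanishing of integrals against
  \<open>z * q\<close>, and the value at the origin is an integral. An outer function is
  \<open>exp h\<close>, where \<open>h\<close> is an L2 limit of polynomials with real constant
  coefficient. The limit exists because the integral of \<open>q^2\<close> is the square of the
  constant coefficient of \<open>q\<close>; if that coefficient is real, \<open>Im q\<close> is
  bounded by \<open>Re q\<close> in L2. Hence logarithms of moduli are taken square integrable and
  bounded above throughout.\<close>

lemma square_integrable_mult_integrable:
  fixes f g :: "'a \<Rightarrow> real"
  assumes [measurable]: "f \<in> borel_measurable M" "g \<in> borel_measurable M"
    and "integrable M (\<lambda>x. (f x)\<^sup>2)" "integrable M (\<lambda>x. (g x)\<^sup>2)"
  shows "integrable M (\<lambda>x. f x * g x)"
proof (rule Bochner_Integration.integrable_bound)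
  show "integrable M (\<lambda>x. (f x)\<^sup>2 + (g x)\<^sup>2)" using assms by simp
  have "\<bar>a * b\<bar> \<le> \<bar>a\<^sup>2 + b\<^sup>2\<bar>" for a b :: real
  proof -
    have "0 \<le> (\<bar>a\<bar> - \<bar>b\<bar>)\<^sup>2" by simp
    then have "2 * \<bar>a * b\<bar> \<le> a\<^sup>2 + b\<^sup>2" by (simp add: power2_diff abs_mult)
    moreover have "0 \<le> a\<^sup>2 + b\<^sup>2" by simp
    ultimately show ?thesis by linarith
  qed
  then show "AE x in M. norm (f x * g x) \<le> norm ((f x)\<^sup>2 + (g x)\<^sup>2)" by simp
qed simp

lemma integral_Cauchy_Schwarz:
  fixes f g :: "'a \<Rightarrow> real"
  assumes m: "f \<in> borel_measurable M" "g \<in> borel_measurable M"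
    and f: "integrable M (\<lambda>x. (f x)\<^sup>2)" and g: "integrable M (\<lambda>x. (g x)\<^sup>2)"
  shows "(LINT x|M. f x * g x)\<^sup>2 \<le> (LINT x|M. (f x)\<^sup>2) * (LINT x|M. (g x)\<^sup>2)"
proof -
  define a where "a = (LINT x|M. (f x)\<^sup>2)"
  define b where "b = (LINT x|M. (g x)\<^sup>2)"
  define c where "c = (LINT x|M. f x * g x)"
  have fg: "integrable M (\<lambda>x. f x * g x)" by (rule square_integrable_mult_integrable[OF m f g])
  have q: "0 \<le> s\<^sup>2 * a - 2 * s * t * c + t\<^sup>2 * b" for s t
  proof -
    have "0 \<le> (LINT x|M. (s * f x - t * g x)\<^sup>2)" by simp
    also have "\<dots> = (LINT x|M. s\<^sup>2 * (f x)\<^sup>2 - (2 * s * t) * (f x * g x) + t\<^sup>2 * (g x)\<^sup>2)"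
      by (rule Bochner_Integration.integral_cong) (auto simp: power2_eq_square algebra_simps)
    also have "\<dots> = s\<^sup>2 * a - 2 * s * t * c + t\<^sup>2 * b"
      using f g fg by (simp add: a_def b_def c_def)
    finally show ?thesis .
  qed
  have "b \<ge> 0" unfolding b_def by simp
  have "c\<^sup>2 \<le> a * b"
  proof (cases "b = 0")
    case True
    then have "0 \<le> a - 2 * t * c" for t using q[of 1 t] by simp
    \<comment> \<open>If \<open>c\<close> were nonzero, this \<open>t\<close> would turn the bound
      into \<open>0 <= a - (a + 1)\<close>.\<close>
    from this[of "(a + 1) / (2 * c)"] have "c = 0" by (cases "c = 0") auto
    then show ?thesis using True by simp
  next
    case False
    \<comment> \<open>The choice \<open>s = b\<close>, \<open>t = c\<close> minimises the quadratic
      form up to scaling and leaves the discriminant times \<open>b\<close>.\<close>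
    have "0 \<le> b * (a * b - c\<^sup>2)" using q[of b c] by (simp add: power2_eq_square algebra_simps)
    then show ?thesis using False \<open>b \<ge> 0\<close> by (simp add: zero_le_mult_iff)
  qed
  then show ?thesis by (simp add: a_def b_def c_def)
qed

lemma square_integrable_mult_integrable_complex:
  fixes f g :: "'a \<Rightarrow> complex"
  assumes [measurable]: "f \<in> borel_measurable M" "g \<in> borel_measurable M"
    and "integrable M (\<lambda>x. (cmod (f x))\<^sup>2)" "integrable M (\<lambda>x. (cmod (g x))\<^sup>2)"
  shows "integrable M (\<lambda>x. f x * g x)"
proof -
  have "integrable M (\<lambda>x. cmod (f x) * cmod (g x))"
    using assms by (intro square_integrable_mult_integrable) auto
  then show ?thesis
    by (rule Bochner_Integration.integrable_bound) (auto simp: norm_mult)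
qed

lemma integral_Cauchy_Schwarz_complex:
  fixes f g :: "'a \<Rightarrow> complex"
  assumes [measurable]: "f \<in> borel_measurable M" "g \<in> borel_measurable M"
    and "integrable M (\<lambda>x. (cmod (f x))\<^sup>2)" "integrable M (\<lambda>x. (cmod (g x))\<^sup>2)"
  shows "(cmod (LINT x|M. f x * g x))\<^sup>2 \<le> (LINT x|M. (cmod (f x))\<^sup>2) * (LINT x|M. (cmod (g x))\<^sup>2)"
proof -
  have "cmod (LINT x|M. f x * g x) \<le> (LINT x|M. cmod (f x * g x))"
    by (rule integral_norm_bound)
  then have "(cmod (LINT x|M. f x * g x))\<^sup>2 \<le> (LINT x|M. cmod (f x) * cmod (g x))\<^sup>2"
    by (intro power_mono) (auto simp: norm_mult)
  also have "\<dots> \<le> (LINT x|M. (cmod (f x))\<^sup>2) * (LINT x|M. (cmod (g x))\<^sup>2)"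
    using assms by (intro integral_Cauchy_Schwarz) auto
  finally show ?thesis .
qed

text \<open>Bernoulli's inequality: a convex function lies above its tangent, here at 1. At
  \<open>t = 0\<close> it reads \<open>1 - r \<le> 0\<close>.\<close>

lemma powr_ge_tangent:
  fixes t :: real
  assumes "1 \<le> r" "0 \<le> t"
  shows "1 + r * (t - 1) \<le> t powr r"
proof (cases "t = 0")
  case True
  then show ?thesis using assms by simp
next
  case False
  then have t: "t > 0" using assms by simp
  show ?thesis
    using convex_on_imp_above_tangent[OF powr_convex[OF assms(1)], of 1 t r] t
    by (force intro!: derivative_eq_intros simp: interior_open)
qed

text \<open>After division by its L^r norm \<open>c\<close>, the function \<open>g\<close> satisfies
  the tangent inequality pointwise; integrating it over a probability space compares the mean of
  \<open>g / c\<close> with 1.\<close>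

lemma (in prob_space) power_mean:
  fixes g :: "'a \<Rightarrow> real"
  assumes r: "1 \<le> r" and [measurable]: "g \<in> borel_measurable M" and pos: "\<And>x. 0 \<le> g x"
    and int: "integrable M (\<lambda>x. g x powr r)"
  shows "integrable M g" "expectation g \<le> (expectation (\<lambda>x. g x powr r)) powr (1 / r)"
proof -
  have le: "g x \<le> 1 + g x powr r" for x
  proof (cases "g x \<le> 1")
    case False
    then have "g x powr 1 \<le> g x powr r" using r by (intro powr_mono) auto
    then show ?thesis using False by simp
  qed (simp add: add_increasing2)
  show g: "integrable M g"
    by (rule Bochner_Integration.integrable_bound[of _ "\<lambda>x. 1 + g x powr r"])
       (use int le pos in \<open>auto intro!: AE_I2 simp: abs_of_nonneg add_nonneg_nonneg\<close>)
  define A where "A = expectation (\<lambda>x. g x powr r)"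
  have A0: "A \<ge> 0" unfolding A_def by simp
  show "expectation g \<le> (expectation (\<lambda>x. g x powr r)) powr (1 / r)"
  proof (cases "A = 0")
    case True
    then have "AE x in M. g x powr r = 0"
      using int unfolding A_def by (subst (asm) integral_nonneg_eq_0_iff_AE) auto
    then have "AE x in M. g x = 0" by simp
    then have "expectation g = 0" by (simp add: integral_eq_zero_AE)
    then show ?thesis by simp
  next
    case False
    then have A: "A > 0" using A0 by simp
    define c where "c = A powr (1 / r)"
    have c: "c > 0" using A by (simp add: c_def)
    have cr: "c powr r = A" using A r by (simp add: c_def powr_powr)
    have "expectation (\<lambda>x. 1 + r * (g x / c - 1)) \<le> expectation (\<lambda>x. g x powr r / A)"
    proof (rule integral_mono)
      show "1 + r * (g x / c - 1) \<le> g x powr r / A" for x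
        using powr_ge_tangent[OF r, of "g x / c"] c pos[of x] by (simp add: powr_divide cr)
    qed (use g int in auto)
    also have "\<dots> = 1" using A by (simp add: A_def)
    also have "expectation (\<lambda>x. 1 + r * (g x / c - 1)) = 1 + r * (expectation g / c - 1)"
      using g by (simp add: prob_space)
    finally have "r * (expectation g / c - 1) \<le> 0" by simp
    then have "expectation g / c \<le> 1" using r by (simp add: mult_le_0_iff)
    then show ?thesis using c by (simp add: A_def c_def)
  qed
qed

section \<open>Normalized arc length and its moments\<close>

lemma space_circle [simp]: "space circle_measure = sphere 0 1"
  by (simp add: circle_measure_def space_restrict_space)

lemma sets_circle: "sets circle_measure = sets (restrict_space borel (sphere 0 1))"
  by (simp add: circle_measure_def)

lemma measurable_circle_cong:
  "borel_measurable circle_measure = borel_measurable (restrict_space borel (sphere 0 1 :: complex set))"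
  by (rule measurable_cong_sets[OF sets_circle refl])

lemma measurable_cis_uniform:
  "cis \<in> measurable (uniform_measure lborel {0..<2*pi}) (restrict_space borel (sphere 0 1))"
proof -
  have "cis \<in> borel_measurable lborel"
    by (simp add: borel_measurable_continuous_onI continuous_intros)
  then have "cis \<in> borel_measurable (uniform_measure lborel {0..<2*pi})"
    by (simp cong: measurable_cong_sets)
  then show ?thesis by (simp add: measurable_restrict_space2_iff)
qed

lemma prob_space_uniform_circle: "prob_space (uniform_measure lborel {0..<2*pi})"
  by (rule prob_space_uniform_measure) (auto simp: ennreal_eq_0_iff not_le)

lemma prob_space_circle: "prob_space circle_measure"
  unfolding circle_measure_def
  by (rule prob_space.prob_space_distr[OF prob_space_uniform_circle measurable_cis_uniform])

global_interpretation circle: prob_space circle_measure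
  by (rule prob_space_circle)

lemma measurable_circle_continuous:
  "continuous_on (sphere 0 1) f \<Longrightarrow> f \<in> borel_measurable circle_measure"
  unfolding measurable_circle_cong by (rule borel_measurable_continuous_on_restrict)

lemma measurable_poly_circle [measurable]: "poly q \<in> borel_measurable circle_measure" for q :: "complex poly"
  by (intro measurable_circle_continuous continuous_intros)

lemma integrable_circle_bounded:
  fixes f :: "complex \<Rightarrow> 'b::{banach, second_countable_topology}"
  assumes "f \<in> borel_measurable circle_measure" "\<And>z. z \<in> sphere 0 1 \<Longrightarrow> norm (f z) \<le> B"
  shows "integrable circle_measure f"
  by (rule circle.integrable_const_bound[where B=B]) (use assms in auto)

lemma continuous_on_sphere_bound:
  fixes f :: "complex \<Rightarrow> 'b::real_normed_vector"
  assumes "continuous_on (sphere 0 1) f"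
  obtains B where "0 \<le> B" "\<And>z. z \<in> sphere 0 1 \<Longrightarrow> norm (f z) \<le> B"
proof -
  have "bounded (f ` sphere 0 1)"
    by (intro compact_imp_bounded compact_continuous_image assms) auto
  then obtain B where B: "\<forall>x\<in>f ` sphere 0 1. norm x \<le> B" using bounded_iff by blast
  have "norm (f 1) \<le> B" using B by auto
  then have "0 \<le> B" using norm_ge_zero order_trans by blast
  then show ?thesis using B that by auto
qed

lemma integrable_circle_continuous:
  fixes f :: "complex \<Rightarrow> 'b::{banach, second_countable_topology}"
  assumes "continuous_on (sphere 0 1) f"
  shows "integrable circle_measure f"
  using continuous_on_sphere_bound[OF assms] integrable_circle_bounded measurable_circle_continuous[OF assms]
  by metis

lemma integral_circle_power:
  assumes "n > 0"
  shows "(LINT z|circle_measure. z ^ n) = 0"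
proof -
  have m: "(\<lambda>z::complex. z ^ n) \<in> borel_measurable (restrict_space borel (sphere 0 1))"
    by (intro borel_measurable_continuous_on_restrict continuous_intros)
  have "(LINT z|circle_measure. z ^ n) = (LINT t|uniform_measure lborel {0..<2*pi}. cis t ^ n)"
    unfolding circle_measure_def
    by (rule integral_distr[OF measurable_cis_uniform m])
  also have "\<dots> = (LINT t|density lborel (\<lambda>t. ennreal (indicator {0..<2*pi} t / (2*pi))). cis t ^ n)"
  proof -
    have "uniform_measure lborel {0..<2*pi} = density lborel (\<lambda>t. ennreal (indicator {0..<2*pi} t / (2*pi)))"
      unfolding uniform_measure_def
      by (rule density_cong) (auto simp: indicator_def divide_ennreal simp flip: ennreal_1)
    then show ?thesis by simp
  qed
  also have "\<dots> = (LINT t|lborel. (indicator {0..<2*pi} t / (2*pi)) *\<^sub>R (cis t ^ n))"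
    by (intro integral_density) (auto intro!: borel_measurable_continuous_onI continuous_intros)
  \<comment> \<open>The half-open interval is closed up, at the cost of one null point, so that the
    fundamental theorem of calculus applies; the primitive takes equal values at both ends.\<close>
  also have "\<dots> = (1/(2*pi)) *\<^sub>R (LINT t|lborel. indicator {0..2*pi} t *\<^sub>R (cis t ^ n))"
  proof -
    have "(LINT t|lborel. (indicator {0..<2*pi} t / (2*pi)) *\<^sub>R (cis t ^ n)) =
       (LINT t|lborel. (1/(2*pi)) *\<^sub>R (indicator {0..2*pi} t *\<^sub>R (cis t ^ n)))"
    proof (rule integral_cong_AE)
      have "AE t in lborel. t \<noteq> 2*pi" by (rule AE_lborel_singleton)
      then show "AE t in lborel. (indicator {0..<2*pi} t / (2*pi)) *\<^sub>R (cis t ^ n) =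
          (1/(2*pi)) *\<^sub>R (indicator {0..2*pi} t *\<^sub>R (cis t ^ n))"
        by eventually_elim (auto simp: indicator_def)
    qed (auto intro!: borel_measurable_scaleR borel_measurable_continuous_onI[of "\<lambda>t. cis t ^ n"] continuous_intros)
    then show ?thesis by (simp only: integral_scaleR_right)
  qed
  also have "(LINT t|lborel. indicator {0..2*pi} t *\<^sub>R (cis t ^ n)) =
      cis (real n * (2*pi)) / (\<i> * n) - cis (real n * 0) / (\<i> * n)"
  proof (rule integral_FTC_Icc)
    show "((\<lambda>t. cis (n * t) / (\<i> * n)) has_vector_derivative cis t ^ n) (at t within {0..2*pi})" for t
    proof -
      have "((\<lambda>w. exp (\<i> * n * w) / (\<i> * n)) has_field_derivative exp (\<i> * n * complex_of_real t)) (at (complex_of_real t))"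
        using assms by (auto intro!: derivative_eq_intros)
      from has_vector_derivative_real_field[OF this, of "{0..2*pi}"]
      moreover have "cis t ^ n = exp (\<i> * n * complex_of_real t)"
        by (simp add: cis_conv_exp mult_ac flip: exp_of_nat_mult)
      ultimately show ?thesis by (simp only: cis_conv_exp of_real_mult of_real_of_nat_eq mult.assoc)
    qed
  qed (auto intro!: continuous_intros)
  also have "cis (n * (2*pi)) = 1"
    using cis_multiple_2pi[of n] by (simp add: mult.commute mult.left_commute)
  finally show ?thesis by simp
qed

lemma integral_circle_poly: "(LINT z|circle_measure. poly q z) = coeff q 0" for q :: "complex poly"
proof -
  have "(LINT z|circle_measure. poly q z) = (LINT z|circle_measure. (\<Sum>i\<le>degree q. coeff q i * z ^ i))"
    by (simp add: poly_altdef)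
  also have "\<dots> = (\<Sum>i\<le>degree q. coeff q i * (LINT z|circle_measure. z ^ i))"
    by (subst Bochner_Integration.integral_sum) (auto intro!: integrable_circle_continuous continuous_intros)
  also have "\<dots> = (\<Sum>i\<le>degree q. if i = 0 then coeff q 0 else 0)"
    by (rule sum.cong) (auto simp: integral_circle_power circle.prob_space[unfolded space_circle])
  finally show ?thesis by simp
qed

subsection \<open>Approximation by trigonometric polynomials\<close>

text \<open>Regularity is available for finite Borel measures on the whole plane, while
  \<open>circle_measure\<close> lives on a restricted space. The measure is therefore pushed forward
  along the inclusion, which changes no measure of a Borel subset of the circle.\<close>

lemma circle_inner_regular:
  assumes A: "A \<in> sets circle_measure" and e: "e > 0"
  obtains K where "compact K" "K \<subseteq> A" "measure circle_measure (A - K) < e"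
proof -
  define N where "N = distr circle_measure (borel :: complex measure) (\<lambda>z. z)"
  have mid: "(\<lambda>z. z) \<in> measurable circle_measure (borel :: complex measure)"
    by (intro measurable_circle_continuous continuous_intros)
  interpret N: prob_space N unfolding N_def by (rule circle.prob_space_distr[OF mid])
  have sN: "sets N = sets borel" by (simp add: N_def)
  have AS: "A \<subseteq> sphere 0 1" using sets.sets_into_space[OF A] by simp
  have Ab: "A \<in> sets borel"
    using A unfolding sets_circle by (auto simp: sets_restrict_space)
  have mN: "measure N B = measure circle_measure B" if "B \<in> sets borel" "B \<subseteq> sphere 0 1" for B
    unfolding N_def by (subst measure_distr[OF mid that(1)]) (use that in \<open>auto simp: Int_absorb2\<close>)
  have "ennreal (measure N A) = (SUP K \<in> {K. K \<subseteq> A \<and> compact K}. emeasure N K)"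
    using inner_regular[OF sN, of A] Ab by (simp add: N.emeasure_eq_measure)
  have "\<exists>K. K \<subseteq> A \<and> compact K \<and> measure N A - e < measure N K"
  proof (rule ccontr)
    assume neg: "\<not> ?thesis"
    have "(SUP K \<in> {K. K \<subseteq> A \<and> compact K}. emeasure N K) \<le> ennreal (measure N A - e)"
      using neg by (intro SUP_least) (auto simp: N.emeasure_eq_measure not_less ennreal_leI)
    then have "ennreal (measure N A) \<le> ennreal (measure N A - e)"
      using inner_regular[OF sN, of A] Ab by (simp add: N.emeasure_eq_measure)
    then have "measure N A = 0" using e by (simp add: ennreal_le_iff2 measure_le_0_iff split: if_splits)
    moreover have "measure N A - e \<ge> measure N {}" using neg by (auto simp: not_less)
    ultimately show False using e by simp
  qed
  then obtain K where K: "K \<subseteq> A" "compact K" "measure N A - e < measure N K" by blast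
  have Kb: "K \<in> sets borel" using K(2) by (simp add: borel_compact)
  have "measure N (A - K) = measure N A - measure N K"
    by (rule N.finite_measure_Diff) (use Ab Kb K sN in auto)
  then have "measure circle_measure (A - K) < e"
    using mN[OF _ order_trans[OF Diff_subset AS], of K] Ab Kb K(3) by simp
  then show ?thesis using that K by blast
qed

text \<open>The tent functions \<open>max 0 (1 - n * infdist z K)\<close> converge boundedly to the
  indicator because \<open>K\<close> is closed. The empty set is separate:
  \<open>infdist z {}\<close> is 0 by convention, so the tents would be constantly 1.\<close>

lemma indicator_compact_approx:
  assumes K: "compact K" "K \<subseteq> sphere 0 1" and e: "e > 0"
  obtains c :: "complex \<Rightarrow> real" where "continuous_on UNIV c"
    "(LINT z|circle_measure. \<bar>indicator K z - c z\<bar>) < e"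
proof (cases "K = {}")
  case True
  show ?thesis by (rule that[of "\<lambda>_. 0"]) (use True e in auto)
next
  case False
  define c :: "nat \<Rightarrow> complex \<Rightarrow> real" where "c n z = max 0 (1 - n * infdist z K)" for n z
  have cc: "continuous_on UNIV (c n)" for n
    unfolding c_def by (intro continuous_intros)
  have cm[measurable]: "c n \<in> borel_measurable circle_measure" for n
    by (rule measurable_circle_continuous) (use cc continuous_on_subset in blast)
  have Km[measurable]: "K \<in> sets circle_measure"
    unfolding sets_circle using K by (auto simp: sets_restrict_space Int_absorb1 borel_compact intro!: image_eqI[of _ _ K])
  have "(\<lambda>n. LINT z|circle_measure. \<bar>indicator K z - c n z\<bar>) \<longlonglongrightarrow> (LINT z|circle_measure. 0)"
  proof (rule integral_dominated_convergence[where w="\<lambda>_. 1"])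
    show "AE z in circle_measure. (\<lambda>n. \<bar>indicator K z - c n z\<bar>) \<longlonglongrightarrow> 0"
    proof (rule AE_I2)
      fix z
      show "(\<lambda>n. \<bar>indicator K z - c n z\<bar>) \<longlonglongrightarrow> 0"
      proof (cases "z \<in> K")
        case True then show ?thesis by (simp add: c_def)
      next
        case zK: False
        have pos: "infdist z K > 0"
          using zK K(1) False by (simp add: compact_imp_closed infdist_pos_not_in_closed)
        obtain n0 where n0: "real n0 * infdist z K > 1" using pos reals_Archimedean3 by blast
        have "c n z = 0" if "n \<ge> n0" for n
        proof -
          have "real n * infdist z K \<ge> real n0 * infdist z K" using that pos by (intro mult_right_mono) auto
          then show ?thesis using n0 by (simp add: c_def)
        qed
        then have "\<forall>\<^sub>F n in sequentially. \<bar>indicator K z - c n z\<bar> = 0"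
          using zK by (auto simp: eventually_sequentially)
        then show ?thesis by (rule tendsto_eventually)
      qed
    qed
    show "AE z in circle_measure. norm \<bar>indicator K z - c n z\<bar> \<le> 1" for n
      by (auto simp: c_def indicator_def infdist_nonneg)
  qed auto
  then have "(\<lambda>n. LINT z|circle_measure. \<bar>indicator K z - c n z\<bar>) \<longlonglongrightarrow> 0" by simp
  from order_tendstoD(2)[OF this e] obtain n where "(LINT z|circle_measure. \<bar>indicator K z - c n z\<bar>) < e"
    by (auto simp: eventually_sequentially)
  then show ?thesis using that cc by blast
qed

lemma continuous_dense_L1:
  fixes u :: "complex \<Rightarrow> real"
  assumes "integrable circle_measure u" "e > 0"
  shows "\<exists>c. continuous_on UNIV c \<and> (LINT z|circle_measure. \<bar>u z - c z\<bar>) < e"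
  using assms
proof (induction arbitrary: e rule: integrable_induct)
  case (base A k)
  have [measurable]: "A \<in> sets circle_measure" by fact
  \<comment> \<open>Two errors below \<open>d\<close> occur, one from inner regularity and one from
    the tent function, both scaled by \<open>\<bar>k\<bar>\<close>. The summand 1 covers
    \<open>k = 0\<close> and makes the final bound strict.\<close>
  define d where "d = e / (2 * (\<bar>k\<bar> + 1))"
  have d: "d > 0" using base by (simp add: d_def)
  obtain K where K: "compact K" "K \<subseteq> A" "measure circle_measure (A - K) < d"
    using circle_inner_regular[OF base(1) d] .
  have KS: "K \<subseteq> sphere 0 1" using K(2) sets.sets_into_space[OF base(1)] by auto
  obtain c where c: "continuous_on UNIV c" "(LINT z|circle_measure. \<bar>indicator K z - c z\<bar>) < d"
    using indicator_compact_approx[OF K(1) KS d] .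
  have Km[measurable]: "K \<in> sets circle_measure"
    unfolding sets_circle using K KS by (auto simp: sets_restrict_space Int_absorb1 borel_compact intro!: image_eqI[of _ _ K])
  have ci: "integrable circle_measure c"
    by (rule integrable_circle_continuous) (use c continuous_on_subset in blast)
  have iA: "integrable circle_measure (indicator A :: complex \<Rightarrow> real)" and iK: "integrable circle_measure (indicator K :: complex \<Rightarrow> real)"
    and iAK: "integrable circle_measure (indicator (A - K) :: complex \<Rightarrow> real)"
    by (auto intro!: integrable_real_indicator simp: circle.emeasure_eq_measure)
  have "(LINT z|circle_measure. \<bar>indicator A z *\<^sub>R k - k * c z\<bar>) \<le>
      (LINT z|circle_measure. \<bar>k\<bar> * (indicator (A - K) z + \<bar>indicator K z - c z\<bar>))"
  proof (rule integral_mono)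
    fix z
    have "\<bar>indicator A z *\<^sub>R k - k * c z\<bar> = \<bar>k\<bar> * \<bar>indicator A z - c z\<bar>"
      by (simp add: abs_mult[symmetric] algebra_simps)
    also have "\<dots> \<le> \<bar>k\<bar> * (indicator (A - K) z + \<bar>indicator K z - c z\<bar>)"
      using K(2) by (intro mult_left_mono) (auto simp: indicator_def)
    finally show "\<bar>indicator A z *\<^sub>R k - k * c z\<bar> \<le> \<bar>k\<bar> * (indicator (A - K) z + \<bar>indicator K z - c z\<bar>)" .
  qed (use iA iK iAK ci in auto)
  also have "\<dots> = \<bar>k\<bar> * (measure circle_measure (A - K) + (LINT z|circle_measure. \<bar>indicator K z - c z\<bar>))"
    using iK iAK ci by (simp add: Int_absorb2 sets.sets_into_space del: space_circle)
  also have "\<dots> \<le> \<bar>k\<bar> * (d + d)" using K(3) c(2) by (intro mult_left_mono) auto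
  also have "\<dots> < (\<bar>k\<bar> + 1) * (d + d)" using d by (intro mult_strict_right_mono) auto
  also have "\<dots> = e"
  proof -
    have "2 * (\<bar>k\<bar> + 1) \<noteq> 0" by simp
    then have "d * (2 * (\<bar>k\<bar> + 1)) = e" unfolding d_def by (metis nonzero_eq_divide_eq)
    then show ?thesis by (simp add: algebra_simps)
  qed
  finally show ?case using c(1) by (intro exI[of _ "\<lambda>z. k * c z"]) (auto intro!: continuous_intros)
next
  case (add f g)
  obtain c where c: "continuous_on UNIV c" "(LINT z|circle_measure. \<bar>f z - c z\<bar>) < e/2"
    using add.IH(1)[of "e/2"] add.prems by auto
  obtain d where d: "continuous_on UNIV d" "(LINT z|circle_measure. \<bar>g z - d z\<bar>) < e/2"
    using add.IH(2)[of "e/2"] add.prems by auto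
  have cd: "integrable circle_measure c" "integrable circle_measure d"
    by (rule integrable_circle_continuous, use c d continuous_on_subset in blast)+
  have "(LINT z|circle_measure. \<bar>f z + g z - (c z + d z)\<bar>) \<le>
      (LINT z|circle_measure. \<bar>f z - c z\<bar> + \<bar>g z - d z\<bar>)"
    by (rule integral_mono) (use add cd in auto)
  also have "\<dots> < e" using c d cd add by simp
  finally show ?case using c d by (intro exI[of _ "\<lambda>z. c z + d z"]) (auto intro!: continuous_intros)
next
  case (lim f s)
  have [measurable]: "f \<in> borel_measurable circle_measure" "s i \<in> borel_measurable circle_measure" for i
    using lim by auto
  \<comment> \<open>The induction rule supplies simple functions with
    \<open>\<bar>s i z\<bar> \<le> 2 * \<bar>f z\<bar>\<close>, whence the dominating function
    \<open>3 * \<bar>f z\<bar>\<close>.\<close>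
  have "(\<lambda>i. LINT z|circle_measure. \<bar>f z - s i z\<bar>) \<longlonglongrightarrow> (LINT z|circle_measure. 0)"
  proof (rule integral_dominated_convergence[where w="\<lambda>z. 3 * \<bar>f z\<bar>"])
    show "AE z in circle_measure. (\<lambda>i. \<bar>f z - s i z\<bar>) \<longlonglongrightarrow> 0"
      using lim.hyps(2) by (intro AE_I2) (auto intro!: tendsto_eq_intros)
    show "AE z in circle_measure. norm \<bar>f z - s i z\<bar> \<le> 3 * \<bar>f z\<bar>" for i
    proof (rule AE_I2)
      fix z assume "z \<in> space circle_measure"
      from lim.hyps(3)[OF this, of i] show "norm \<bar>f z - s i z\<bar> \<le> 3 * \<bar>f z\<bar>" by auto
    qed
  qed (use lim in auto)
  then have "(\<lambda>i. LINT z|circle_measure. \<bar>f z - s i z\<bar>) \<longlonglongrightarrow> 0" by simp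
  from order_tendstoD(2)[OF this, of "e/2"] lim.prems
  obtain i where i: "(LINT z|circle_measure. \<bar>f z - s i z\<bar>) < e/2" by (auto simp: eventually_sequentially)
  obtain c where c: "continuous_on UNIV c" "(LINT z|circle_measure. \<bar>s i z - c z\<bar>) < e/2"
    using lim.IH[of "e/2" i] lim.prems by auto
  have ci: "integrable circle_measure c"
    by (rule integrable_circle_continuous) (use c continuous_on_subset in blast)
  have "(LINT z|circle_measure. \<bar>f z - c z\<bar>) \<le> (LINT z|circle_measure. \<bar>f z - s i z\<bar> + \<bar>s i z - c z\<bar>)"
    by (rule integral_mono) (use lim ci in auto)
  also have "\<dots> < e" using i c ci lim by simp
  finally show ?case using c(1) by blast
qed

lemma integrable_square_add:
  fixes f g :: "'a \<Rightarrow> 'b::{real_normed_vector, second_countable_topology}"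
  assumes [measurable]: "f \<in> borel_measurable M" "g \<in> borel_measurable M"
    and i: "integrable M (\<lambda>x. (norm (f x))\<^sup>2)" "integrable M (\<lambda>x. (norm (g x))\<^sup>2)"
  shows "integrable M (\<lambda>x. (norm (f x + g x))\<^sup>2)"
    and "(LINT x|M. (norm (f x + g x))\<^sup>2) \<le> 2 * (LINT x|M. (norm (f x))\<^sup>2) + 2 * (LINT x|M. (norm (g x))\<^sup>2)"
proof -
  have le: "(norm (a + b))\<^sup>2 \<le> 2 * (norm a)\<^sup>2 + 2 * (norm b)\<^sup>2" for a b :: 'b
  proof -
    have "(norm (a + b))\<^sup>2 \<le> (norm a + norm b)\<^sup>2" by (intro power_mono norm_triangle_ineq) auto
    moreover have "0 \<le> (norm a - norm b)\<^sup>2" by simp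
    ultimately show ?thesis by (simp add: power2_sum power2_diff)
  qed
  show 1: "integrable M (\<lambda>x. (norm (f x + g x))\<^sup>2)"
  proof (rule Bochner_Integration.integrable_bound)
    show "integrable M (\<lambda>x. 2 * (norm (f x))\<^sup>2 + 2 * (norm (g x))\<^sup>2)" using i by simp
    show "AE x in M. norm ((norm (f x + g x))\<^sup>2) \<le> norm (2 * (norm (f x))\<^sup>2 + 2 * (norm (g x))\<^sup>2)"
      using le by simp
  qed measurable
  have "(LINT x|M. (norm (f x + g x))\<^sup>2) \<le> (LINT x|M. 2 * (norm (f x))\<^sup>2 + 2 * (norm (g x))\<^sup>2)"
    by (rule integral_mono) (use 1 i le in auto)
  then show "(LINT x|M. (norm (f x + g x))\<^sup>2) \<le> 2 * (LINT x|M. (norm (f x))\<^sup>2) + 2 * (LINT x|M. (norm (g x))\<^sup>2)"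
    using i by simp
qed

text \<open>Reduction to L1: \<open>u\<close> is truncated at height \<open>n\<close>, the
  truncation is approximated in L1, and the approximant is clipped at the same height. Both
  functions are then bounded by \<open>n\<close>, so the squared difference is at most
  \<open>2 * n\<close> times the difference.\<close>

lemma continuous_dense_L2:
  fixes u :: "complex \<Rightarrow> real"
  assumes [measurable]: "u \<in> borel_measurable circle_measure" and u: "integrable circle_measure (\<lambda>z. (u z)\<^sup>2)" and e: "e > 0"
  shows "\<exists>c. continuous_on UNIV c \<and> (LINT z|circle_measure. (u z - c z)\<^sup>2) < e"
proof -
  define t where "t n z = max (- real n) (min (real n) (u z))" for n z
  have [measurable]: "t n \<in> borel_measurable circle_measure" for n unfolding t_def by measurable
  have tle: "(u z - t n z)\<^sup>2 \<le> (u z)\<^sup>2" for n z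
  proof -
    have "\<bar>u z - t n z\<bar> \<le> \<bar>u z\<bar>" unfolding t_def by linarith
    then show ?thesis by (simp add: abs_le_square_iff)
  qed
  have "(\<lambda>n. LINT z|circle_measure. (u z - t n z)\<^sup>2) \<longlonglongrightarrow> (LINT z|circle_measure. 0)"
  proof (rule integral_dominated_convergence[where w="\<lambda>z. (u z)\<^sup>2"])
    show "AE z in circle_measure. (\<lambda>n. (u z - t n z)\<^sup>2) \<longlonglongrightarrow> 0"
    proof (rule AE_I2)
      fix z
      obtain n0 :: nat where n0: "\<bar>u z\<bar> \<le> n0" using real_arch_simple by blast
      have "(u z - t n z)\<^sup>2 = 0" if "n \<ge> n0" for n
        using n0 that by (simp add: t_def)
      then have "\<forall>\<^sub>F n in sequentially. (u z - t n z)\<^sup>2 = 0"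
        unfolding eventually_sequentially by blast
      then show "(\<lambda>n. (u z - t n z)\<^sup>2) \<longlonglongrightarrow> 0" by (rule tendsto_eventually)
    qed
    show "AE z in circle_measure. norm ((u z - t n z)\<^sup>2) \<le> (u z)\<^sup>2" for n
      using tle by simp
  qed (use u in auto)
  then have "(\<lambda>n. LINT z|circle_measure. (u z - t n z)\<^sup>2) \<longlonglongrightarrow> 0" by simp
  then have "\<forall>\<^sub>F n in sequentially. (LINT z|circle_measure. (u z - t n z)\<^sup>2) < e/4"
    by (rule order_tendstoD) (use e in simp)
  then obtain n where n: "(LINT z|circle_measure. (u z - t n z)\<^sup>2) < e/4"
    unfolding eventually_sequentially by blast
  have tb: "\<bar>t n z\<bar> \<le> n" for z unfolding t_def by linarith
  have ti: "integrable circle_measure (t n)"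
    by (rule integrable_circle_bounded[where B=n]) (use tb in auto)
  obtain c where c: "continuous_on UNIV c" "(LINT z|circle_measure. \<bar>t n z - c z\<bar>) < e / (4 * (2 * n + 1))"
    using continuous_dense_L1[OF ti, of "e / (4 * (2 * n + 1))"] e by auto
  define d where "d z = max (- real n) (min (real n) (c z))" for z
  have dc: "continuous_on UNIV d" unfolding d_def using c(1) by (intro continuous_intros)
  have [measurable]: "d \<in> borel_measurable circle_measure"
    by (rule measurable_circle_continuous) (use dc continuous_on_subset in blast)
  have db: "\<bar>d z\<bar> \<le> n" for z unfolding d_def by linarith
  have ci: "integrable circle_measure c"
    by (rule integrable_circle_continuous) (use c continuous_on_subset in blast)
  have 1: "\<bar>t n z - d z\<bar> \<le> 2 * real n" for z using tb[of z] db[of z] by linarith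
  \<comment> \<open>Clipping to \<open>[-n, n]\<close> contracts distances and fixes the values of
    \<open>t n\<close>.\<close>
  have 2: "\<bar>t n z - d z\<bar> \<le> \<bar>t n z - c z\<bar>" for z using tb[of z] unfolding d_def by linarith
  have le: "(t n z - d z)\<^sup>2 \<le> (2 * n) * \<bar>t n z - c z\<bar>" for z
  proof -
    have "(t n z - d z)\<^sup>2 = \<bar>t n z - d z\<bar> * \<bar>t n z - d z\<bar>" by (simp add: power2_eq_square)
    also have "\<dots> \<le> (2 * n) * \<bar>t n z - c z\<bar>" using 1 2 by (intro mult_mono) auto
    finally show ?thesis .
  qed
  have ti2: "integrable circle_measure (\<lambda>z. (t n z - d z)\<^sup>2)"
  proof (rule Bochner_Integration.integrable_bound)
    show "integrable circle_measure (\<lambda>z. (2 * n) * \<bar>t n z - c z\<bar>)" using ti ci by simp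
    show "AE z in circle_measure. norm ((t n z - d z)\<^sup>2) \<le> norm ((2 * n) * \<bar>t n z - c z\<bar>)"
      using le by simp
  qed measurable
  have "(LINT z|circle_measure. (t n z - d z)\<^sup>2) \<le> (LINT z|circle_measure. (2 * n) * \<bar>t n z - c z\<bar>)"
    by (rule integral_mono[OF ti2]) (use ti ci le in auto)
  also have "\<dots> = 2 * n * (LINT z|circle_measure. \<bar>t n z - c z\<bar>)" by simp
  also have "\<dots> \<le> (2 * n) * (e / (4 * (2 * n + 1)))" using c(2) by (intro mult_left_mono) auto
  also have "\<dots> < (2 * n + 1) * (e / (4 * (2 * n + 1)))" using e by (intro mult_strict_right_mono) auto
  also have "\<dots> = e / 4" by (simp add: field_simps)
  finally have td: "(LINT z|circle_measure. (t n z - d z)\<^sup>2) < e / 4" .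
  have ui: "integrable circle_measure (\<lambda>z. (u z - t n z)\<^sup>2)"
    by (rule Bochner_Integration.integrable_bound[OF u]) (use tle in auto)
  have "(LINT z|circle_measure. (u z - d z)\<^sup>2) \<le> 2 * (LINT z|circle_measure. (u z - t n z)\<^sup>2) + 2 * (LINT z|circle_measure. (t n z - d z)\<^sup>2)"
    using integrable_square_add(2)[of "\<lambda>z. u z - t n z" circle_measure "\<lambda>z. t n z - d z"] ui ti2 by simp
  also have "\<dots> < e" using n td by simp
  finally show ?thesis using dc by blast
qed

section \<open>Trigonometric polynomials and Stone-Weierstrass\<close>

definition trig :: "(complex \<Rightarrow> complex) \<Rightarrow> bool" where
  "trig f \<longleftrightarrow> (\<exists>a b. \<forall>z\<in>sphere 0 1. f z = poly a z + cnj (poly b z))"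

lemma trig_const: "trig (\<lambda>_. k)"
  unfolding trig_def by (rule exI[of _ "[:k:]"], rule exI[of _ 0]) simp

lemma trig_cnj:
  assumes "trig f" shows "trig (\<lambda>z. cnj (f z))"
proof -
  obtain a b where "\<forall>z\<in>sphere 0 1. f z = poly a z + cnj (poly b z)"
    using assms unfolding trig_def by blast
  then have "\<forall>z\<in>sphere 0 1. cnj (f z) = poly b z + cnj (poly a z)" by simp
  then show ?thesis unfolding trig_def by blast
qed

lemma trig_add:
  assumes "trig f" "trig g" shows "trig (\<lambda>z. f z + g z)"
proof -
  obtain a b a' b' where "\<forall>z\<in>sphere 0 1. f z = poly a z + cnj (poly b z)" "\<forall>z\<in>sphere 0 1. g z = poly a' z + cnj (poly b' z)"
    using assms unfolding trig_def by blast
  then have "\<forall>z\<in>sphere 0 1. f z + g z = poly (a + a') z + cnj (poly (b + b') z)" by simp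
  then show ?thesis unfolding trig_def by blast
qed

lemma trig_cmult:
  assumes "trig f" shows "trig (\<lambda>z. k * f z)"
proof -
  obtain a b where "\<forall>z\<in>sphere 0 1. f z = poly a z + cnj (poly b z)"
    using assms unfolding trig_def by blast
  then have "\<forall>z\<in>sphere 0 1. k * f z = poly (smult k a) z + cnj (poly (smult (cnj k) b) z)"
    by (simp add: algebra_simps)
  then show ?thesis unfolding trig_def by blast
qed

text \<open>On the circle \<open>z * cnj z = 1\<close>, so multiplication by \<open>z\<close> lowers
  the degree of the conjugate part by one; its constant term \<open>cnj k\<close> becomes a linear
  term of the analytic part. This is the step that makes trigonometric polynomials an
  algebra.\<close>

lemma trig_shift:
  assumes "trig f" shows "trig (\<lambda>z. z * f z)"
proof -
  obtain a b where ab: "\<forall>z\<in>sphere 0 1. f z = poly a z + cnj (poly b z)"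
    using assms unfolding trig_def by blast
  obtain k c where b: "b = pCons k c" by (cases b)
  have "z * f z = poly (pCons 0 (a + [:cnj k:])) z + cnj (poly c z)" if "z \<in> sphere 0 1" for z
  proof -
    have "z * cnj z = 1" using that by (simp add: complex_norm_square[symmetric])
    then have "z * (cnj z * cnj (poly c z)) = cnj (poly c z)" by (metis mult.assoc mult_1)
    moreover have "f z = poly a z + (cnj k + cnj z * cnj (poly c z))" using ab that b by simp
    ultimately show ?thesis by (simp add: algebra_simps)
  qed
  then show ?thesis unfolding trig_def by blast
qed

lemma trig_mult_poly: "trig f \<Longrightarrow> trig (\<lambda>z. poly a z * f z)"
proof (induction a)
  case 0
  show ?case using trig_const[of 0] by simp
next
  case (pCons k a)
  have "trig (\<lambda>z. k * f z + z * (poly a z * f z))"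
    by (intro trig_add trig_cmult trig_shift pCons)
  then show ?case by (simp add: algebra_simps)
qed

lemma trig_cong:
  assumes "\<And>z. z \<in> sphere 0 1 \<Longrightarrow> f z = g z" "trig g" shows "trig f"
  using assms unfolding trig_def by metis

lemma trig_mult:
  assumes "trig f" "trig g" shows "trig (\<lambda>z. f z * g z)"
proof -
  obtain a b where ab: "\<forall>z\<in>sphere 0 1. f z = poly a z + cnj (poly b z)"
    using assms unfolding trig_def by blast
  \<comment> \<open>The product with the conjugate part is the conjugate of a product with an
    analytic polynomial, which \<open>trig_mult_poly\<close> covers.\<close>
  have t: "trig (\<lambda>z. poly a z * g z + cnj (poly b z * cnj (g z)))"
    by (intro trig_add trig_mult_poly trig_cnj assms)
  have e: "f z * g z = poly a z * g z + cnj (poly b z * cnj (g z))" if "z \<in> sphere 0 1" for z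
    using ab that by (simp add: algebra_simps)
  show ?thesis by (rule trig_cong[OF e t])
qed

lemma trig_real_polynomial:
  "real_polynomial_function g \<Longrightarrow> trig (\<lambda>z. complex_of_real (g z))"
proof (induction rule: real_polynomial_function.induct)
  case (linear f)
  interpret bounded_linear f by fact
  have fz: "f z = Re z * f 1 + Im z * f \<i>" for z
  proof -
    have "z = Re z *\<^sub>R 1 + Im z *\<^sub>R \<i>" by (simp add: complex_eq_iff)
    then have "f z = f (Re z *\<^sub>R 1) + f (Im z *\<^sub>R \<i>)" by (metis add)
    then show ?thesis unfolding scale by simp
  qed
  \<comment> \<open>A real linear functional is \<open>2 * Re (w * z)\<close> with
    \<open>w = (f 1 - \<i> * f \<i>) / 2\<close>.\<close>
  have "complex_of_real (f z) = poly [:0, Complex (f 1 / 2) (- f \<i> / 2):] z +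
      cnj (poly [:0, Complex (f 1 / 2) (- f \<i> / 2):] z)" for z
    unfolding fz[of z] by (simp add: complex_eq_iff)
  then show ?case unfolding trig_def by blast
next
  case (const c)
  show ?case by (rule trig_const)
next
  case (add f g)
  then show ?case using trig_add[OF add.IH] by simp
next
  case (mult f g)
  then show ?case using trig_mult[OF mult.IH] by simp
qed

lemma Re_poly_uniformly_dense:
  fixes c :: "complex \<Rightarrow> real"
  assumes "continuous_on (sphere 0 1) c" "e > 0"
  obtains q where "Im (coeff q 0) = 0" "\<And>z. z \<in> sphere 0 1 \<Longrightarrow> \<bar>c z - Re (poly q z)\<bar> < e"
proof -
  obtain g where g: "real_polynomial_function g" "\<And>z. z \<in> sphere 0 1 \<Longrightarrow> \<bar>c z - g z\<bar> < e"
    using Stone_Weierstrass_real_polynomial_function[OF _ assms] by auto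
  obtain a b where ab: "\<forall>z\<in>sphere 0 1. complex_of_real (g z) = poly a z + cnj (poly b z)"
    using trig_real_polynomial[OF g(1)] unfolding trig_def by blast
  \<comment> \<open>Conjugating \<open>b\<close> does not change real parts, so \<open>a + b\<close>
    serves. Subtracting an imaginary constant is equally harmless and makes the constant coefficient
    real, as \<open>poly_L2_le_Re\<close> requires.\<close>
  define q where "q = a + b - [:\<i> * Im (coeff (a + b) 0):]"
  have "Re (poly q z) = g z" if "z \<in> sphere 0 1" for z
  proof -
    have "complex_of_real (g z) = poly a z + cnj (poly b z)" using ab that by blast
    then have "g z = Re (poly a z + cnj (poly b z))" by (metis Re_complex_of_real)
    then show ?thesis by (simp add: q_def)
  qed
  then show ?thesis using g(2) by (intro that[of q]) (auto simp: q_def)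
qed

text \<open>Fatou's lemma, applied to the nonnegative integrals so that integrability of the limit
  comes out together with the bound.\<close>

lemma integral_limit_bound:
  fixes g :: "nat \<Rightarrow> 'a \<Rightarrow> real"
  assumes m[measurable]: "\<And>k. g k \<in> borel_measurable M" "f \<in> borel_measurable M"
    and nn: "\<And>k x. 0 \<le> g k x" "\<And>x. 0 \<le> f x"
    and lim: "AE x in M. (\<lambda>k. g k x) \<longlonglongrightarrow> f x"
    and i: "\<And>k. integrable M (g k)" and b: "\<And>k. (LINT x|M. g k x) \<le> b k" "b \<longlonglongrightarrow> B"
  shows "integrable M f" "(LINT x|M. f x) \<le> B"
proof -
  have B0: "0 \<le> B"
  proof (rule LIMSEQ_le_const[OF b(2)])
    have "0 \<le> b k" for k
      by (rule order_trans[OF Bochner_Integration.integral_nonneg b(1)[of k]]) (rule nn)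
    then show "\<exists>N. \<forall>n\<ge>N. 0 \<le> b n" by blast
  qed
  have "(\<integral>\<^sup>+x. ennreal (f x) \<partial>M) = (\<integral>\<^sup>+x. liminf (\<lambda>k. ennreal (g k x)) \<partial>M)"
  proof (rule nn_integral_cong_AE)
    show "AE x in M. ennreal (f x) = liminf (\<lambda>k. ennreal (g k x))"
      using lim by eventually_elim (metis lim_imp_Liminf tendsto_ennrealI trivial_limit_sequentially)
  qed
  also have "\<dots> \<le> liminf (\<lambda>k. \<integral>\<^sup>+x. ennreal (g k x) \<partial>M)"
    by (rule nn_integral_liminf) measurable
  also have "\<dots> = liminf (\<lambda>k. ennreal (LINT x|M. g k x))"
    using i nn by (simp add: nn_integral_eq_integral)
  also have "\<dots> \<le> liminf (\<lambda>k. ennreal (b k))"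
    by (intro Liminf_mono always_eventually allI ennreal_leI b)
  also have "\<dots> = ennreal B"
    by (intro lim_imp_Liminf tendsto_ennrealI b) simp
  finally have le: "(\<integral>\<^sup>+x. ennreal (f x) \<partial>M) \<le> ennreal B" .
  then show "integrable M f"
    using nn by (intro integrableI_nonneg) (auto simp: le_less_trans)
  then show "(LINT x|M. f x) \<le> B"
    using le nn B0 by (simp add: nn_integral_eq_integral)
qed

lemma (in prob_space) integral_norm_le_L2:
  fixes f :: "'a \<Rightarrow> 'b::{banach, second_countable_topology}"
  assumes [measurable]: "f \<in> borel_measurable M" and i: "integrable M (\<lambda>x. (norm (f x))\<^sup>2)"
  shows "integrable M f" "(expectation (\<lambda>x. norm (f x)))\<^sup>2 \<le> expectation (\<lambda>x. (norm (f x))\<^sup>2)"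
proof -
  have "integrable M (\<lambda>x. norm (f x) * 1)"
    by (rule square_integrable_mult_integrable) (use i in auto)
  then show "integrable M f" by (simp add: integrable_norm_iff)
  have "(expectation (\<lambda>x. norm (f x) * 1))\<^sup>2 \<le> expectation (\<lambda>x. (norm (f x))\<^sup>2) * expectation (\<lambda>x. 1\<^sup>2)"
    by (rule integral_Cauchy_Schwarz) (use i in auto)
  then show "(expectation (\<lambda>x. norm (f x)))\<^sup>2 \<le> expectation (\<lambda>x. (norm (f x))\<^sup>2)"
    by (simp add: prob_space)
qed

text \<open>The pointwise half of the Riesz-Fischer theorem: geometric L2 increments have a finite
  sum in L1, so the telescoping series converges absolutely almost everywhere. Pointwise limits are
  what passes through \<open>exp\<close> later.\<close>

lemma (in prob_space) L2_fast_Cauchy_AE_convergent: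
  fixes f :: "nat \<Rightarrow> 'a \<Rightarrow> 'b::{banach, second_countable_topology}"
  assumes [measurable]: "\<And>k. f k \<in> borel_measurable M"
    and i: "\<And>k. integrable M (\<lambda>x. (norm (f (Suc k) x - f k x))\<^sup>2)"
    and b: "\<And>k. expectation (\<lambda>x. (norm (f (Suc k) x - f k x))\<^sup>2) \<le> (C * (1/2) ^ k)\<^sup>2" and C: "C \<ge> 0"
  shows "AE x in M. convergent (\<lambda>k. f k x)"
proof -
  have int: "integrable M (\<lambda>x. norm (f (Suc k) x - f k x))" for k
    using integral_norm_le_L2(1)[of "\<lambda>x. f (Suc k) x - f k x"] i by auto
  have le: "expectation (\<lambda>x. norm (f (Suc k) x - f k x)) \<le> C * (1/2) ^ k" for k
  proof (rule power2_le_imp_le)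
    show "(expectation (\<lambda>x. norm (f (Suc k) x - f k x)))\<^sup>2 \<le> (C * (1/2) ^ k)\<^sup>2"
      by (rule order_trans[OF integral_norm_le_L2(2) b]) (use i in auto)
  qed (use C in simp)
  have "(\<integral>\<^sup>+x. (\<Sum>k. ennreal (norm (f (Suc k) x - f k x))) \<partial>M) = (\<Sum>k. \<integral>\<^sup>+x. ennreal (norm (f (Suc k) x - f k x)) \<partial>M)"
    by (rule nn_integral_suminf) measurable
  also have "\<dots> = (\<Sum>k. ennreal (expectation (\<lambda>x. norm (f (Suc k) x - f k x))))"
    using int by (simp add: nn_integral_eq_integral)
  also have "\<dots> \<le> (\<Sum>k. ennreal (C * (1/2) ^ k))"
    by (intro suminf_le ennreal_leI le) auto
  also have "\<dots> = ennreal (\<Sum>k. C * (1/2) ^ k)"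
    by (rule suminf_ennreal2) (use C in \<open>auto intro!: summable_mult summable_geometric\<close>)
  finally have "(\<integral>\<^sup>+x. (\<Sum>k. ennreal (norm (f (Suc k) x - f k x))) \<partial>M) \<noteq> \<infinity>"
    by (auto simp: top_unique)
  then have "AE x in M. (\<Sum>k. ennreal (norm (f (Suc k) x - f k x))) \<noteq> \<infinity>"
    by (intro nn_integral_PInf_AE) auto
  then show ?thesis
  proof eventually_elim
    fix x assume "(\<Sum>k. ennreal (norm (f (Suc k) x - f k x))) \<noteq> \<infinity>"
    then have "summable (\<lambda>k. norm (f (Suc k) x - f k x))"
      by (intro summable_suminf_not_top) auto
    then have "summable (\<lambda>k. f (Suc k) x - f k x)" by (rule summable_norm_cancel)
    then have "convergent (\<lambda>n. \<Sum>k<n. f (Suc k) x - f k x)" by (simp add: summable_iff_convergent)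
    then have "convergent (\<lambda>n. f n x - f 0 x)"
      using sum_lessThan_telescope[of "\<lambda>k. f k x"] by simp
    then show "convergent (\<lambda>k. f k x)" by (simp add: convergent_diff_const_right_iff)
  qed
qed

lemma integrable_poly_square:
  "integrable circle_measure (\<lambda>z. (cmod (poly q z))\<^sup>2)" "integrable circle_measure (\<lambda>z. (Re (poly q z))\<^sup>2)"
  "integrable circle_measure (\<lambda>z. (Im (poly q z))\<^sup>2)"
  by (intro integrable_circle_continuous continuous_intros)+

text \<open>The interval \<open>I\<close> carries one-sided or two-sided bounds of \<open>u\<close>
  over to the polynomials. A continuous approximant is projected onto \<open>I\<close>: the
  projection contracts and fixes the values of \<open>u\<close>, so the L2 error does not grow. A
  uniform approximation then leaves \<open>I\<close> by less than 1.\<close>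

lemma Re_poly_dense_L2:
  fixes u :: "complex \<Rightarrow> real"
  assumes [measurable]: "u \<in> borel_measurable circle_measure" and u: "integrable circle_measure (\<lambda>z. (u z)\<^sup>2)" and e: "e > 0"
    and I: "closed I" "convex I" "\<And>z. z \<in> sphere 0 1 \<Longrightarrow> u z \<in> I"
  obtains q where "Im (coeff q 0) = 0" "(LINT z|circle_measure. (u z - Re (poly q z))\<^sup>2) < e"
    "\<And>z. z \<in> sphere 0 1 \<Longrightarrow> \<exists>y\<in>I. \<bar>y - Re (poly q z)\<bar> < 1"
proof -
  have I0: "I \<noteq> {}" using I(3)[of 1] by auto
  obtain c where c: "continuous_on UNIV c" "(LINT z|circle_measure. (u z - c z)\<^sup>2) < e/4"
    using continuous_dense_L2[OF assms(1) u, of "e/4"] e by auto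
  define d where "d z = closest_point I (c z)" for z
  have dc: "continuous_on (sphere 0 1) d"
    unfolding d_def
    by (rule continuous_on_compose2[OF continuous_on_closest_point[OF I(2,1) I0, of UNIV]])
       (use c continuous_on_subset in auto)
  have [measurable]: "c \<in> borel_measurable circle_measure" "d \<in> borel_measurable circle_measure"
    using dc continuous_on_subset[OF c(1)] by (auto intro: measurable_circle_continuous)
  have dI: "d z \<in> I" for z unfolding d_def by (rule closest_point_in_set[OF I(1) I0])
  have le: "\<bar>u z - d z\<bar> \<le> \<bar>u z - c z\<bar>" if "z \<in> sphere 0 1" for z
    using closest_point_lipschitz[OF I(2,1) I0, of "u z" "c z"] closest_point_self[OF I(3)[OF that]]
    by (simp add: d_def dist_real_def)
  \<comment> \<open>The error budget is \<open>2 * (e / 4)\<close> for the projected function and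
    \<open>2 * (e / 8)\<close> for the uniform approximation, below \<open>e\<close> in
    total.\<close>
  define r where "r = min 1 (sqrt (e / 8))"
  have r: "r > 0" "r \<le> 1" "r\<^sup>2 \<le> e / 8"
  proof -
    have "r\<^sup>2 \<le> (sqrt (e / 8))\<^sup>2" using e by (intro power_mono) (auto simp: r_def)
    then show "r\<^sup>2 \<le> e / 8" using e by simp
  qed (use e in \<open>auto simp: r_def\<close>)
  obtain q where q: "Im (coeff q 0) = 0" "\<And>z. z \<in> sphere 0 1 \<Longrightarrow> \<bar>d z - Re (poly q z)\<bar> < r"
    using Re_poly_uniformly_dense[OF dc r(1)] by blast
  have ci: "integrable circle_measure (\<lambda>z. (u z - c z)\<^sup>2)"
  proof -
    have "integrable circle_measure (\<lambda>z. (norm (u z + - c z))\<^sup>2)"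
    proof (rule integrable_square_add(1))
      show "integrable circle_measure (\<lambda>z. (norm (- c z))\<^sup>2)"
        by (intro integrable_circle_continuous continuous_intros continuous_on_subset[OF c(1)]) auto
    qed (use u in auto)
    then show ?thesis by simp
  qed
  have di: "integrable circle_measure (\<lambda>z. (u z - d z)\<^sup>2)"
    by (rule Bochner_Integration.integrable_bound[OF ci]) (auto intro!: AE_I2 simp: abs_le_square_iff[symmetric] le)
  have qi: "integrable circle_measure (\<lambda>z. (d z - Re (poly q z))\<^sup>2)"
    by (intro integrable_circle_continuous continuous_intros dc)
  have "(LINT z|circle_measure. (u z - d z)\<^sup>2) \<le> (LINT z|circle_measure. (u z - c z)\<^sup>2)"
    by (rule integral_mono[OF di ci]) (simp add: abs_le_square_iff[symmetric] le)
  moreover have "(LINT z|circle_measure. (d z - Re (poly q z))\<^sup>2) \<le> (LINT z|circle_measure. r\<^sup>2)"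
  proof (rule integral_mono[OF qi])
    fix z :: complex assume "z \<in> space circle_measure"
    then show "(d z - Re (poly q z))\<^sup>2 \<le> r\<^sup>2" using q(2)[of z] r by (simp add: abs_le_square_iff[symmetric])
  qed simp
  moreover have "(LINT z|circle_measure. r\<^sup>2) = r\<^sup>2" using circle.prob_space by simp
  moreover have "(LINT z|circle_measure. (u z - Re (poly q z))\<^sup>2) \<le>
      2 * (LINT z|circle_measure. (u z - d z)\<^sup>2) + 2 * (LINT z|circle_measure. (d z - Re (poly q z))\<^sup>2)"
    using integrable_square_add(2)[of "\<lambda>z. u z - d z" circle_measure "\<lambda>z. d z - Re (poly q z)"] di qi by simp
  ultimately have "(LINT z|circle_measure. (u z - Re (poly q z))\<^sup>2) < e" using c(2) r(3) e by linarith
  moreover have "\<exists>y\<in>I. \<bar>y - Re (poly q z)\<bar> < 1" if "z \<in> sphere 0 1" for z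
    by (rule bexI[OF _ dI[of z]]) (use q(2)[OF that] r(2) in linarith)
  ultimately show ?thesis using that q(1) by blast
qed

text \<open>The mean of \<open>q^2\<close> is the square of the constant coefficient. Its real part
  says that the L2 norms of \<open>Re q\<close> and \<open>Im q\<close> differ by a nonnegative
  quantity when that coefficient is real. This is the L2 bound for harmonic conjugation.\<close>

lemma poly_L2_le_Re:
  assumes "Im (coeff q 0) = 0"
  shows "(LINT z|circle_measure. (cmod (poly q z))\<^sup>2) \<le> 2 * (LINT z|circle_measure. (Re (poly q z))\<^sup>2)"
proof -
  have "(LINT z|circle_measure. poly (q * q) z) = (coeff q 0)\<^sup>2"
    by (simp only: integral_circle_poly coeff_mult_0 power2_eq_square)
  then have "Re ((coeff q 0)\<^sup>2) = Re (LINT z|circle_measure. poly (q * q) z)" by simp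
  also have "\<dots> = (LINT z|circle_measure. Re (poly (q * q) z))"
    by (rule integral_Re[symmetric]) (intro integrable_circle_continuous continuous_intros)
  also have "\<dots> = (LINT z|circle_measure. (Re (poly q z))\<^sup>2 - (Im (poly q z))\<^sup>2)"
    by (simp add: power2_eq_square)
  also have "\<dots> = (LINT z|circle_measure. (Re (poly q z))\<^sup>2) - (LINT z|circle_measure. (Im (poly q z))\<^sup>2)"
    by (rule Bochner_Integration.integral_diff integrable_poly_square)+
  finally have "Re ((coeff q 0)\<^sup>2) = (LINT z|circle_measure. (Re (poly q z))\<^sup>2) - (LINT z|circle_measure. (Im (poly q z))\<^sup>2)" .
  moreover have "0 \<le> Re ((coeff q 0)\<^sup>2)" using assms by (simp add: power2_eq_square)
  moreover have "(LINT z|circle_measure. (cmod (poly q z))\<^sup>2) = (LINT z|circle_measure. (Re (poly q z))\<^sup>2) + (LINT z|circle_measure. (Im (poly q z))\<^sup>2)"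
    unfolding cmod_power2 by (rule Bochner_Integration.integral_add integrable_poly_square)+
  ultimately show ?thesis by linarith
qed

subsection \<open>Outer functions\<close>

lemma integrable_mult_bounded:
  fixes F g :: "'a \<Rightarrow> complex"
  assumes F: "integrable M F" and [measurable]: "g \<in> borel_measurable M" and b: "AE z in M. cmod (g z) \<le> B"
  shows "integrable M (\<lambda>z. F z * g z)"
proof (rule Bochner_Integration.integrable_bound)
  show "integrable M (\<lambda>z. B * cmod (F z))" using F by simp
  have [measurable]: "F \<in> borel_measurable M" using F by simp
  show "(\<lambda>z. F z * g z) \<in> borel_measurable M" by measurable
  show "AE z in M. norm (F z * g z) \<le> norm (B * cmod (F z))"
    using b
  proof eventually_elim
    fix z assume "cmod (g z) \<le> B"
    then have "cmod (F z) * cmod (g z) \<le> cmod (F z) * \<bar>B\<bar>" by (intro mult_left_mono) auto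
    then show "norm (F z * g z) \<le> norm (B * cmod (F z))" by (simp add: norm_mult abs_mult mult.commute)
  qed
qed

lemma integrable_mult_continuous:
  fixes F f :: "complex \<Rightarrow> complex"
  assumes F: "integrable circle_measure F" and f: "continuous_on (sphere 0 1) f"
  shows "integrable circle_measure (\<lambda>z. F z * f z)"
proof -
  obtain C where C: "0 \<le> C" "\<And>z. z \<in> sphere 0 1 \<Longrightarrow> norm (f z) \<le> C"
    by (rule continuous_on_sphere_bound[OF f]) blast
  show ?thesis
    by (rule integrable_mult_bounded[OF F, where B=C]) (use f C in \<open>auto intro: measurable_circle_continuous\<close>)
qed

lemma integral_mult_bounded_limit:
  fixes F :: "'a \<Rightarrow> complex" and g :: "nat \<Rightarrow> 'a \<Rightarrow> complex"
  assumes F: "integrable M F" and m: "\<And>k. g k \<in> borel_measurable M" "h \<in> borel_measurable M"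
    and b: "\<And>k z. z \<in> space M \<Longrightarrow> cmod (g k z) \<le> B" and lim: "AE z in M. (\<lambda>k. g k z) \<longlonglongrightarrow> h z"
  shows "(\<lambda>k. LINT z|M. F z * g k z) \<longlonglongrightarrow> (LINT z|M. F z * h z)"
proof (rule integral_dominated_convergence[where w="\<lambda>z. B * cmod (F z)"])
  have [measurable]: "F \<in> borel_measurable M" using F by simp
  note m[measurable]
  show "(\<lambda>z. F z * h z) \<in> borel_measurable M" "\<And>k. (\<lambda>z. F z * g k z) \<in> borel_measurable M" by measurable
  show "integrable M (\<lambda>z. B * cmod (F z))" using F by simp
  show "AE z in M. (\<lambda>k. F z * g k z) \<longlonglongrightarrow> F z * h z"
    using lim by eventually_elim (intro tendsto_intros)
  show "AE z in M. norm (F z * g k z) \<le> B * cmod (F z)" for k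
    using b by (intro AE_I2) (auto simp: norm_mult mult.commute[of B] intro!: mult_left_mono)
qed

text \<open>By hypothesis \<open>F\<close> acts on polynomials as \<open>\<alpha>\<close> times
  evaluation at the origin. The partial sums of the exponential series of \<open>q\<close> are
  polynomials, bounded on the circle by \<open>exp B\<close>, so the rule survives the
  limit.\<close>

lemma integral_mult_exp_poly:
  fixes F :: "complex \<Rightarrow> complex"
  assumes F: "integrable circle_measure F" and c: "\<And>q. (LINT z|circle_measure. F z * poly q z) = \<alpha> * coeff q 0"
  shows "(LINT z|circle_measure. F z * exp (poly q z)) = \<alpha> * exp (coeff q 0)"
proof -
  define r where "r N = (\<Sum>n<N. smult (1 / fact n) (q ^ n))" for N
  obtain B where B: "0 \<le> B" "\<And>z. z \<in> sphere 0 1 \<Longrightarrow> norm (poly q z) \<le> B"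
    by (rule continuous_on_sphere_bound[of "poly q"]) (intro continuous_intros, blast)
  have pr: "poly (r N) z = (\<Sum>n<N. poly q z ^ n /\<^sub>R fact n)" for N z
    by (simp add: r_def poly_sum scaleR_conv_of_real field_simps)
  have lim: "(\<lambda>N. poly (r N) z) \<longlonglongrightarrow> exp (poly q z)" for z
    unfolding pr using exp_converges[of "poly q z"] by (simp add: sums_def)
  have c0: "coeff (q ^ n) 0 = coeff q 0 ^ n" for n by (induction n) (auto simp: coeff_mult_0)
  have cr: "coeff (r N) 0 = (\<Sum>n<N. coeff q 0 ^ n /\<^sub>R fact n)" for N
    by (simp add: r_def coeff_sum c0 scaleR_conv_of_real field_simps)
  have "(\<lambda>N. coeff (r N) 0) \<longlonglongrightarrow> exp (coeff q 0)"
    unfolding cr using exp_converges[of "coeff q 0"] by (simp add: sums_def)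
  then have 1: "(\<lambda>N. \<alpha> * coeff (r N) 0) \<longlonglongrightarrow> \<alpha> * exp (coeff q 0)" by (intro tendsto_intros)
  have "(\<lambda>N. LINT z|circle_measure. F z * poly (r N) z) \<longlonglongrightarrow> (LINT z|circle_measure. F z * exp (poly q z))"
  proof (rule integral_mult_bounded_limit[OF F, where B="exp B"])
    show "cmod (poly (r N) z) \<le> exp B" if "z \<in> space circle_measure" for N z
    proof -
      have "cmod (poly (r N) z) \<le> (\<Sum>n<N. cmod (poly q z) ^ n /\<^sub>R fact n)"
        unfolding pr by (rule sum_norm_le) (simp add: norm_power)
      also have "\<dots> \<le> exp (cmod (poly q z))"
        unfolding exp_def by (rule sum_le_suminf) (use summable_exp[of "cmod (poly q z)"] in simp_all)
      also have "\<dots> \<le> exp B" using B(2) that by simp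
      finally show ?thesis .
    qed
  qed (use lim in \<open>auto intro!: measurable_circle_continuous continuous_intros\<close>)
  then show ?thesis using LIMSEQ_unique[OF _ 1] by (simp add: c)
qed

lemma integrable_diff_Re_poly_square:
  fixes u :: "complex \<Rightarrow> real"
  assumes [measurable]: "u \<in> borel_measurable circle_measure" and "integrable circle_measure (\<lambda>z. (u z)\<^sup>2)"
  shows "integrable circle_measure (\<lambda>z. (u z - Re (poly q z))\<^sup>2)"
  using integrable_square_add(1)[of u circle_measure "\<lambda>z. - Re (poly q z)"] assms integrable_poly_square by simp

text \<open>\<open>log_outer u h\<close> says that \<open>exp h\<close> is the outer function with modulus \<open>exp u\<close>. The last clause
  holds because \<open>exp (s * h)\<close> is a boundedly convergent limit of polynomials with constant
  coefficients tending to \<open>exp (s * \<integral>u)\<close>.\<close>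

definition log_outer :: "(complex \<Rightarrow> real) \<Rightarrow> (complex \<Rightarrow> complex) \<Rightarrow> bool" where
  "log_outer u h \<longleftrightarrow> h \<in> borel_measurable circle_measure \<and>
    (AE z in circle_measure. Re (h z) = u z) \<and>
    integrable circle_measure (\<lambda>z. (cmod (h z))\<^sup>2) \<and>
    (LINT z|circle_measure. (cmod (h z))\<^sup>2) \<le> 4 * (LINT z|circle_measure. (u z)\<^sup>2) \<and>
    (\<forall>F \<alpha> s. integrable circle_measure F \<longrightarrow>
      (\<forall>q. (LINT z|circle_measure. F z * poly q z) = \<alpha> * coeff q 0) \<longrightarrow> 0 \<le> s \<longrightarrow>
      (LINT z|circle_measure. F z * exp (complex_of_real s * h z)) = \<alpha> * exp (s * (LINT z|circle_measure. u z)))"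

lemma log_outerD:
  assumes "log_outer u h"
  shows "h \<in> borel_measurable circle_measure" "AE z in circle_measure. Re (h z) = u z"
    "integrable circle_measure (\<lambda>z. (cmod (h z))\<^sup>2)"
    "(LINT z|circle_measure. (cmod (h z))\<^sup>2) \<le> 4 * (LINT z|circle_measure. (u z)\<^sup>2)"
  using assms by (simp_all add: log_outer_def)

lemma log_outer_integral:
  assumes "log_outer u h" "integrable circle_measure F"
    and "\<And>q. (LINT z|circle_measure. F z * poly q z) = \<alpha> * coeff q 0" "0 \<le> s"
  shows "(LINT z|circle_measure. F z * exp (complex_of_real s * h z)) = \<alpha> * exp (s * (LINT z|circle_measure. u z))"
  using assms unfolding log_outer_def by blast

text \<open>If the real parts of the \<open>Q k\<close> converge to \<open>u\<close> fast in L2,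
  then so do the polynomials themselves, by \<open>poly_L2_le_Re\<close>, and \<open>h\<close> is
  their limit. The bound \<open>B + 1\<close> on real parts bounds \<open>exp (s * Q k)\<close>
  because \<open>s\<close> is nonnegative; this is why \<open>u\<close> must be bounded above but
  may be unbounded below.\<close>

lemma log_outer_exists:
  fixes u :: "complex \<Rightarrow> real"
  assumes um[measurable]: "u \<in> borel_measurable circle_measure" and u: "integrable circle_measure (\<lambda>z. (u z)\<^sup>2)"
    and B: "\<And>z. z \<in> sphere 0 1 \<Longrightarrow> u z \<le> B"
  shows "\<exists>h. log_outer u h"
proof -
  \<comment> \<open>Consecutive real parts differ by at most \<open>4 * c k\<close> in squared L2
    norm, the polynomials by at most \<open>8 * c k\<close>. This lies below
    \<open>(3 * (1/2) ^ k)^2\<close>, which explains the constant 3 used below.\<close>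
  define c where "c k = ((1/2::real) ^ k)\<^sup>2" for k
  have c0: "c k > 0" for k by (simp add: c_def)
  have cle: "c k \<le> c l" if "l \<le> k" for k l unfolding c_def using that by (intro power_mono power_decreasing) auto
  have clim: "c \<longlonglongrightarrow> 0"
  proof -
    have "(\<lambda>k. ((1/2::real) ^ k)\<^sup>2) \<longlonglongrightarrow> 0\<^sup>2" by (intro tendsto_power LIMSEQ_realpow_zero) auto
    then show ?thesis by (simp only: c_def[abs_def] zero_power2)
  qed
  have "\<exists>q. Im (coeff q 0) = 0 \<and> (LINT z|circle_measure. (u z - Re (poly q z))\<^sup>2) < c k
      \<and> (\<forall>z\<in>sphere 0 1. Re (poly q z) \<le> B + 1)" for k
  proof -
    obtain q where q: "Im (coeff q 0) = 0" "(LINT z|circle_measure. (u z - Re (poly q z))\<^sup>2) < c k"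
      "\<And>z. z \<in> sphere 0 1 \<Longrightarrow> \<exists>y\<in>{..B}. \<bar>y - Re (poly q z)\<bar> < 1"
      using Re_poly_dense_L2[OF um u c0[of k], of "{..B}"] B by auto
    have "Re (poly q z) \<le> B + 1" if "z \<in> sphere 0 1" for z using q(3)[OF that] by auto
    then show ?thesis using q by blast
  qed
  then obtain Q where Q: "\<And>k. Im (coeff (Q k) 0) = 0" "\<And>k. (LINT z|circle_measure. (u z - Re (poly (Q k) z))\<^sup>2) < c k"
    "\<And>k z. z \<in> sphere 0 1 \<Longrightarrow> Re (poly (Q k) z) \<le> B + 1"
    by metis
  note di = integrable_diff_Re_poly_square[OF um u]
  have AEc: "AE z in circle_measure. convergent (\<lambda>k. poly (Q k) z)"
  proof (rule circle.L2_fast_Cauchy_AE_convergent[where C=3])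
    fix k
    show "integrable circle_measure (\<lambda>z. (norm (poly (Q (Suc k)) z - poly (Q k) z))\<^sup>2)"
      by (intro integrable_circle_continuous continuous_intros)
    have "(LINT z|circle_measure. (norm (poly (Q (Suc k)) z - poly (Q k) z))\<^sup>2) \<le>
        2 * (LINT z|circle_measure. (Re (poly (Q (Suc k)) z) - Re (poly (Q k) z))\<^sup>2)"
      using poly_L2_le_Re[of "Q (Suc k) - Q k"] Q(1) by simp
    also have "(LINT z|circle_measure. (Re (poly (Q (Suc k)) z) - Re (poly (Q k) z))\<^sup>2) \<le>
       2 * (LINT z|circle_measure. (Re (poly (Q (Suc k)) z) - u z)\<^sup>2) + 2 * (LINT z|circle_measure. (u z - Re (poly (Q k) z))\<^sup>2)"
      using integrable_square_add(2)[of "\<lambda>z. Re (poly (Q (Suc k)) z) - u z" circle_measure "\<lambda>z. u z - Re (poly (Q k) z)"] di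
      by (simp add: power2_commute)
    also have "\<dots> \<le> 2 * c k + 2 * c k"
      using Q(2)[of k] Q(2)[of "Suc k"] cle[of k "Suc k"] by (simp add: power2_commute)
    finally have "(LINT z|circle_measure. (norm (poly (Q (Suc k)) z - poly (Q k) z))\<^sup>2) \<le> 8 * c k" by simp
    moreover have "(3 * (1/2::real) ^ k)\<^sup>2 = 9 * c k" by (simp add: c_def power_mult_distrib)
    ultimately show "(LINT z|circle_measure. (norm (poly (Q (Suc k)) z - poly (Q k) z))\<^sup>2) \<le> (3 * (1/2) ^ k)\<^sup>2"
      using c0[of k] by linarith
  qed auto
  define h where "h z = lim (\<lambda>k. poly (Q k) z)" for z
  have hm[measurable]: "h \<in> borel_measurable circle_measure"
    unfolding h_def by (rule borel_measurable_lim_metric) measurable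
  have lim: "AE z in circle_measure. (\<lambda>k. poly (Q k) z) \<longlonglongrightarrow> h z"
    using AEc by eventually_elim (simp add: h_def convergent_LIMSEQ_iff)
  \<comment> \<open>The factor 4 is 2 for passing from the real part to the modulus, times 2 for
    splitting off the approximation error.\<close>
  have b: "(LINT z|circle_measure. (cmod (poly (Q k) z))\<^sup>2) \<le> 4 * (LINT z|circle_measure. (u z)\<^sup>2) + 4 * c k" for k
  proof -
    have "(LINT z|circle_measure. (Re (poly (Q k) z))\<^sup>2) \<le>
       2 * (LINT z|circle_measure. (u z)\<^sup>2) + 2 * (LINT z|circle_measure. (Re (poly (Q k) z) - u z)\<^sup>2)"
      using integrable_square_add(2)[of u circle_measure "\<lambda>z. Re (poly (Q k) z) - u z"] di u
      by (simp add: power2_commute)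
    then show ?thesis using Q(2)[of k] poly_L2_le_Re[OF Q(1), of k] by (simp add: power2_commute)
  qed
  have blim: "(\<lambda>k. 4 * (LINT z|circle_measure. (u z)\<^sup>2) + 4 * c k) \<longlonglongrightarrow> 4 * (LINT z|circle_measure. (u z)\<^sup>2)"
    using tendsto_add[OF tendsto_const tendsto_mult_right_zero[OF clim]] by simp
  have hlim: "AE z in circle_measure. (\<lambda>k. (cmod (poly (Q k) z))\<^sup>2) \<longlonglongrightarrow> (cmod (h z))\<^sup>2"
    using lim by eventually_elim (intro tendsto_intros)
  have h2: "integrable circle_measure (\<lambda>z. (cmod (h z))\<^sup>2)" "(LINT z|circle_measure. (cmod (h z))\<^sup>2) \<le> 4 * (LINT z|circle_measure. (u z)\<^sup>2)"
    by (rule integral_limit_bound[OF _ _ _ _ hlim integrable_poly_square(1) b blim]; simp)+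
  have Re_h: "AE z in circle_measure. Re (h z) = u z"
  proof -
    have rlim: "AE z in circle_measure. (\<lambda>k. (u z - Re (poly (Q k) z))\<^sup>2) \<longlonglongrightarrow> (u z - Re (h z))\<^sup>2"
      using lim by eventually_elim (intro tendsto_intros)
    have 1: "integrable circle_measure (\<lambda>z. (u z - Re (h z))\<^sup>2)" "(LINT z|circle_measure. (u z - Re (h z))\<^sup>2) \<le> 0"
      by (rule integral_limit_bound[OF _ _ _ _ rlim di less_imp_le[OF Q(2)] clim]; simp)+
    then have "(LINT z|circle_measure. (u z - Re (h z))\<^sup>2) = 0"
      by (intro antisym) auto
    then have "AE z in circle_measure. (u z - Re (h z))\<^sup>2 = 0"
      using 1(1) by (subst (asm) integral_nonneg_eq_0_iff_AE) auto
    then show ?thesis by eventually_elim simp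
  qed
  have ui: "integrable circle_measure u" by (rule circle.integral_norm_le_L2(1)) (use u in auto)
  \<comment> \<open>The constant coefficient is real, hence equal to the mean of the real part, and
    means converge along with the L2 approximation.\<close>
  have coefflim: "(\<lambda>k. coeff (Q k) 0) \<longlonglongrightarrow> of_real (LINT z|circle_measure. u z)"
  proof -
    have Ri: "integrable circle_measure (\<lambda>z. Re (poly (Q k) z))" for k
      by (intro integrable_circle_continuous continuous_intros)
    have ck: "coeff (Q k) 0 = of_real (LINT z|circle_measure. Re (poly (Q k) z))" for k
    proof -
      have "(LINT z|circle_measure. Re (poly (Q k) z)) = Re (coeff (Q k) 0)"
        by (subst integral_Re) (auto intro!: integrable_circle_continuous continuous_intros simp: integral_circle_poly)
      then show ?thesis using Q(1)[of k] by (simp add: complex_eq_iff)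
    qed
    have "\<bar>(LINT z|circle_measure. Re (poly (Q k) z)) - (LINT z|circle_measure. u z)\<bar> \<le> (1/2) ^ k" for k
    proof (rule power2_le_imp_le)
      have "\<bar>(LINT z|circle_measure. Re (poly (Q k) z)) - (LINT z|circle_measure. u z)\<bar> = \<bar>LINT z|circle_measure. u z - Re (poly (Q k) z)\<bar>"
        using ui Ri by (simp add: abs_minus_commute)
      also have "\<dots> \<le> (LINT z|circle_measure. norm (u z - Re (poly (Q k) z)))"
        using integral_norm_bound[of circle_measure "\<lambda>z. u z - Re (poly (Q k) z)"] by simp
      finally have "((LINT z|circle_measure. Re (poly (Q k) z)) - (LINT z|circle_measure. u z))\<^sup>2 \<le> (LINT z|circle_measure. norm (u z - Re (poly (Q k) z)))\<^sup>2"
        by (subst abs_le_square_iff[symmetric]) simp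
      also have "\<dots> \<le> (LINT z|circle_measure. (norm (u z - Re (poly (Q k) z)))\<^sup>2)"
        by (rule circle.integral_norm_le_L2(2)) (use di in auto)
      also have "\<dots> \<le> ((1/2) ^ k)\<^sup>2" using Q(2)[of k] by (simp add: c_def)
      finally show "\<bar>(LINT z|circle_measure. Re (poly (Q k) z)) - (LINT z|circle_measure. u z)\<bar>\<^sup>2 \<le> ((1 / 2) ^ k)\<^sup>2"
        by simp
    qed simp
    then have "\<forall>\<^sub>F k in sequentially. norm ((LINT z|circle_measure. Re (poly (Q k) z)) - (LINT z|circle_measure. u z)) \<le> (1/2) ^ k"
      by (intro always_eventually) (simp only: real_norm_def, blast)
    moreover have "(\<lambda>k. (1/2::real) ^ k) \<longlonglongrightarrow> 0" by (rule LIMSEQ_realpow_zero) auto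
    ultimately have "(\<lambda>k. (LINT z|circle_measure. Re (poly (Q k) z)) - (LINT z|circle_measure. u z)) \<longlonglongrightarrow> 0"
      by (rule Lim_null_comparison)
    then have "(\<lambda>k. (LINT z|circle_measure. Re (poly (Q k) z))) \<longlonglongrightarrow> (LINT z|circle_measure. u z)"
      by (rule LIM_zero_cancel)
    then show ?thesis unfolding ck by (intro tendsto_intros)
  qed
  show ?thesis
    unfolding log_outer_def
  proof (intro exI[of _ h] conjI hm Re_h h2 allI impI)
    fix F :: "complex \<Rightarrow> complex" and \<alpha> and s :: real
    assume F: "integrable circle_measure F" "\<forall>q. (LINT z|circle_measure. F z * poly q z) = \<alpha> * coeff q 0" and s: "0 \<le> s"
    have 1: "(LINT z|circle_measure. F z * exp (s * poly (Q k) z)) = \<alpha> * exp (s * coeff (Q k) 0)" for k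
      using integral_mult_exp_poly[OF F(1), of \<alpha> "smult s (Q k)"] F(2) by simp
    have "(\<lambda>k. LINT z|circle_measure. F z * exp (s * poly (Q k) z)) \<longlonglongrightarrow> (LINT z|circle_measure. F z * exp (s * h z))"
    proof (rule integral_mult_bounded_limit[OF F(1), where B="exp (s * (B + 1))"])
      show "AE z in circle_measure. (\<lambda>k. exp (s * poly (Q k) z)) \<longlonglongrightarrow> exp (s * h z)"
        using lim by eventually_elim (intro tendsto_intros)
      show "cmod (exp (s * poly (Q k) z)) \<le> exp (s * (B + 1))" if "z \<in> space circle_measure" for k z
        using Q(3)[of z k] that s by (auto intro: mult_left_mono)
    qed (auto intro!: measurable_circle_continuous continuous_intros)
    moreover have "(\<lambda>k. \<alpha> * exp (s * coeff (Q k) 0)) \<longlonglongrightarrow> \<alpha> * exp (complex_of_real s * complex_of_real (LINT z|circle_measure. u z))"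
      by (intro tendsto_intros coefflim)
    ultimately have "(LINT z|circle_measure. F z * exp (s * h z)) = \<alpha> * exp (complex_of_real s * complex_of_real (LINT z|circle_measure. u z))"
      unfolding 1 by (rule LIMSEQ_unique)
    then show "(LINT z|circle_measure. F z * exp (s * h z)) = \<alpha> * exp (s * (LINT z|circle_measure. u z))"
      by (simp add: exp_of_real[symmetric])
  qed
qed

subsection \<open>Analytic functions\<close>

text \<open>Approximation in L2 with values near \<open>[-B, B]\<close>, followed by a subsequence
  that converges almost everywhere. The uniform bound is kept so that dominated convergence applies
  to products with merely integrable functions.\<close>

lemma bounded_Re_poly_AE_limit:
  fixes g :: "complex \<Rightarrow> real"
  assumes gm[measurable]: "g \<in> borel_measurable circle_measure" and B: "\<And>z. z \<in> sphere 0 1 \<Longrightarrow> \<bar>g z\<bar> \<le> B"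
  obtains Q where "\<And>k z. z \<in> sphere 0 1 \<Longrightarrow> \<bar>Re (poly (Q k) z)\<bar> \<le> B + 1"
    "AE z in circle_measure. (\<lambda>k. Re (poly (Q k) z)) \<longlonglongrightarrow> g z"
proof -
  have g: "integrable circle_measure (\<lambda>z. (g z)\<^sup>2)"
  proof (rule integrable_circle_bounded[where B="B\<^sup>2"])
    fix z :: complex assume "z \<in> sphere 0 1"
    then have "\<bar>g z\<bar>\<^sup>2 \<le> B\<^sup>2" by (intro power_mono B) auto
    then show "norm ((g z)\<^sup>2) \<le> B\<^sup>2" by simp
  qed measurable
  have "\<exists>q. (LINT z|circle_measure. (g z - Re (poly q z))\<^sup>2) < inverse (real (Suc k)) \<and> (\<forall>z\<in>sphere 0 1. \<bar>Re (poly q z)\<bar> \<le> B + 1)" for k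
  proof -
    have pos: "inverse (real (Suc k)) > 0" by simp
    have gB: "g z \<in> {-B..B}" if "z \<in> sphere 0 1" for z using B[OF that] by auto
    obtain q where q: "(LINT z|circle_measure. (g z - Re (poly q z))\<^sup>2) < inverse (real (Suc k))"
      "\<And>z. z \<in> sphere 0 1 \<Longrightarrow> \<exists>y\<in>{-B..B}. \<bar>y - Re (poly q z)\<bar> < 1"
      using Re_poly_dense_L2[OF gm g pos closed_atLeastAtMost convex_real_interval(5) gB] by blast
    have "\<bar>Re (poly q z)\<bar> \<le> B + 1" if "z \<in> sphere 0 1" for z using q(2)[OF that] by auto
    then show ?thesis using q by blast
  qed
  then obtain Q where Q: "\<And>k. (LINT z|circle_measure. (g z - Re (poly (Q k) z))\<^sup>2) < inverse (real (Suc k))"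
    "\<And>k z. z \<in> sphere 0 1 \<Longrightarrow> \<bar>Re (poly (Q k) z)\<bar> \<le> B + 1"
    by metis
  have lim: "(\<lambda>k. LINT z|circle_measure. norm ((g z - Re (poly (Q k) z))\<^sup>2)) \<longlonglongrightarrow> 0"
  proof (rule Lim_null_comparison[OF _ LIMSEQ_inverse_real_of_nat])
    show "\<forall>\<^sub>F k in sequentially. norm (LINT z|circle_measure. norm ((g z - Re (poly (Q k) z))\<^sup>2)) \<le> inverse (real (Suc k))"
      using less_imp_le[OF Q(1)] by (intro always_eventually) simp
  qed
  obtain r where r: "strict_mono r" "AE z in circle_measure. (\<lambda>k. (g z - Re (poly (Q (r k)) z))\<^sup>2) \<longlonglongrightarrow> 0"
    using tendsto_L1_AE_subseq[OF integrable_diff_Re_poly_square[OF gm g] lim] by blast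
  show ?thesis
  proof (rule that[of "\<lambda>k. Q (r k)"])
    show "AE z in circle_measure. (\<lambda>k. Re (poly (Q (r k)) z)) \<longlonglongrightarrow> g z"
      using r(2)
    proof eventually_elim
      fix z assume "(\<lambda>k. (g z - Re (poly (Q (r k)) z))\<^sup>2) \<longlonglongrightarrow> 0"
      then have "(\<lambda>k. sqrt ((g z - Re (poly (Q (r k)) z))\<^sup>2)) \<longlonglongrightarrow> sqrt 0" by (intro tendsto_intros)
      then have "(\<lambda>k. g z - Re (poly (Q (r k)) z)) \<longlonglongrightarrow> 0" by (simp add: tendsto_rabs_zero_iff)
      then have "(\<lambda>k. g z - (g z - Re (poly (Q (r k)) z))) \<longlonglongrightarrow> g z - 0" by (intro tendsto_intros)
      then show "(\<lambda>k. Re (poly (Q (r k)) z)) \<longlonglongrightarrow> g z" by simp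
    qed
  qed (use Q(2) in blast)
qed

text \<open>The orthogonality extends to bounded limits of real parts of polynomials, in particular
  to \<open>sgn (F z)\<close>, and pairing with that gives the L1 norm of \<open>F\<close>.\<close>

lemma AE_zero_if_orthogonal_Re_poly:
  fixes F :: "complex \<Rightarrow> real"
  assumes F: "integrable circle_measure F" and z: "\<And>q. (LINT z|circle_measure. F z * Re (poly q z)) = 0"
  shows "AE z in circle_measure. F z = 0"
proof -
  have [measurable]: "F \<in> borel_measurable circle_measure" using F by simp
  obtain Q where Q: "\<And>k z. z \<in> sphere 0 1 \<Longrightarrow> \<bar>Re (poly (Q k) z)\<bar> \<le> 1 + 1"
    "AE z in circle_measure. (\<lambda>k. Re (poly (Q k) z)) \<longlonglongrightarrow> sgn (F z)"
  proof -
    have "(\<lambda>z. sgn (F z)) \<in> borel_measurable circle_measure" by measurable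
    moreover have "\<bar>sgn (F z)\<bar> \<le> 1" for z by (simp add: sgn_if)
    ultimately show ?thesis using bounded_Re_poly_AE_limit[of "\<lambda>z. sgn (F z)" 1] that by blast
  qed
  have "(\<lambda>k. LINT z|circle_measure. F z * Re (poly (Q k) z)) \<longlonglongrightarrow> (LINT z|circle_measure. F z * sgn (F z))"
  proof (rule integral_dominated_convergence[where w="\<lambda>z. 2 * \<bar>F z\<bar>"])
    show "AE z in circle_measure. (\<lambda>k. F z * Re (poly (Q k) z)) \<longlonglongrightarrow> F z * sgn (F z)"
      using Q(2) by eventually_elim (intro tendsto_intros)
    show "AE z in circle_measure. norm (F z * Re (poly (Q k) z)) \<le> 2 * \<bar>F z\<bar>" for k
    proof (rule AE_I2)
      fix z :: complex assume "z \<in> space circle_measure"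
      then have "\<bar>F z\<bar> * \<bar>Re (poly (Q k) z)\<bar> \<le> \<bar>F z\<bar> * 2" using Q(1)[of z k] by (intro mult_left_mono) auto
      then show "norm (F z * Re (poly (Q k) z)) \<le> 2 * \<bar>F z\<bar>" by (simp add: abs_mult)
    qed
  qed (use F in auto)
  then have "(LINT z|circle_measure. F z * sgn (F z)) = 0" unfolding z by (simp add: LIMSEQ_const_iff)
  then have "(LINT z|circle_measure. \<bar>F z\<bar>) = 0" by (simp add: abs_sgn mult.commute)
  then show ?thesis using F by (subst (asm) integral_nonneg_eq_0_iff_AE) auto
qed

text \<open>This is H^1. Testing with \<open>z * poly q z\<close> instead of single powers makes
  stability under multiplication by polynomials immediate; \<open>fourier_coeff_negative_iff\<close>
  gives the link with Fourier coefficients.\<close>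

definition analytic_L1 :: "(complex \<Rightarrow> complex) \<Rightarrow> bool" where
  "analytic_L1 F \<longleftrightarrow> integrable circle_measure F \<and> (\<forall>q. (LINT z|circle_measure. F z * (z * poly q z)) = 0)"

text \<open>With \<open>a = (p + \<i> * q) / 2\<close> and \<open>d = (p - \<i> * q) / 2\<close> the
  left side is \<open>a + cnj d\<close>. The constant of \<open>d\<close> is moved to the analytic
  part, so that the two summands become orthogonal.\<close>

lemma Re_Im_poly_decomposition:
  obtains A c where "\<And>z. Complex (Re (poly p z)) (Re (poly q z)) = poly A z + cnj (z * poly c z)"
proof -
  define a where "a = smult (1/2) p + smult (\<i>/2) q"
  define d where "d = smult (1/2) p - smult (\<i>/2) q"
  obtain k c where d: "d = pCons k c" by (cases d)
  have "Complex (Re (poly p z)) (Re (poly q z)) = poly a z + cnj (poly d z)" for z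
    by (simp add: a_def d_def complex_eq_iff)
  then have "Complex (Re (poly p z)) (Re (poly q z)) = poly (a + [:cnj k:]) z + cnj (z * poly c z)" for z
    by (simp add: d)
  then show ?thesis using that by blast
qed

text \<open>Pythagoras: the hypothesis is orthogonality of \<open>f\<close> to
  \<open>cnj (z * poly c z)\<close>. It is used to discard the part of negative frequencies without
  increasing an L2 norm.\<close>

lemma integral_orthogonal_square:
  assumes fm[measurable]: "f \<in> borel_measurable circle_measure" and f: "integrable circle_measure (\<lambda>z. (cmod (f z))\<^sup>2)"
    and o: "(LINT z|circle_measure. f z * (z * poly c z)) = 0"
  shows "(LINT z|circle_measure. (cmod (f z))\<^sup>2) \<le> (LINT z|circle_measure. (cmod (f z + cnj (z * poly c z)))\<^sup>2)"
proof -
  define g where "g z = z * poly c z" for z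
  have [measurable]: "g \<in> borel_measurable circle_measure"
    unfolding g_def by (intro measurable_circle_continuous continuous_intros)
  have g: "integrable circle_measure (\<lambda>z. (cmod (g z))\<^sup>2)"
    unfolding g_def by (intro integrable_circle_continuous continuous_intros)
  have fg: "integrable circle_measure (\<lambda>z. f z * g z)"
    by (rule square_integrable_mult_integrable_complex) (use f g in auto)
  have e: "(cmod (a + cnj b))\<^sup>2 = (cmod a)\<^sup>2 + (cmod b)\<^sup>2 + 2 * Re (a * b)" for a b
    unfolding cmod_power2 by (simp add: power2_eq_square algebra_simps)
  have "(LINT z|circle_measure. (cmod (f z + cnj (g z)))\<^sup>2) =
      (LINT z|circle_measure. (cmod (f z))\<^sup>2) + (LINT z|circle_measure. (cmod (g z))\<^sup>2) + 2 * (LINT z|circle_measure. Re (f z * g z))"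
    unfolding e using f g fg by (simp add: integrable_Re del: times_complex.sel)
  also have "(LINT z|circle_measure. Re (f z * g z)) = Re (LINT z|circle_measure. f z * g z)"
    using fg by (rule integral_Re)
  also have "\<dots> = 0" using o by (simp add: g_def)
  finally show ?thesis unfolding g_def by simp
qed

text \<open>Real and imaginary part are approximated separately, giving a trigonometric polynomial
  \<open>A + cnj (z * c)\<close> close to \<open>b\<close>. Since \<open>b - A\<close> is orthogonal
  to the conjugate part, \<open>A\<close> alone is at least as close.\<close>

lemma analytic_L2_poly_dense:
  assumes bm[measurable]: "b \<in> borel_measurable circle_measure" and b: "integrable circle_measure (\<lambda>z. (cmod (b z))\<^sup>2)"
    and a: "analytic_L1 b" and e: "e > 0"
  obtains q where "(LINT z|circle_measure. (cmod (b z - poly q z))\<^sup>2) < e"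
proof -
  have i: "integrable circle_measure (\<lambda>z. (Re (b z))\<^sup>2)" "integrable circle_measure (\<lambda>z. (Im (b z))\<^sup>2)"
    by (rule Bochner_Integration.integrable_bound[OF b]; auto simp: cmod_power2)+
  have e2: "e / 2 > 0" using e by simp
  have mRe: "(\<lambda>z. Re (b z)) \<in> borel_measurable circle_measure" and mIm: "(\<lambda>z. Im (b z)) \<in> borel_measurable circle_measure"
    by measurable
  obtain p where p: "(LINT z|circle_measure. (Re (b z) - Re (poly p z))\<^sup>2) < e/2"
    using Re_poly_dense_L2[OF _ i(1) e2 closed_UNIV convex_UNIV] by (metis UNIV_I mRe)
  obtain q where q: "(LINT z|circle_measure. (Im (b z) - Re (poly q z))\<^sup>2) < e/2"
    using Re_poly_dense_L2[OF _ i(2) e2 closed_UNIV convex_UNIV] by (metis UNIV_I mIm)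
  obtain A c where Ac: "\<And>z. Complex (Re (poly p z)) (Re (poly q z)) = poly A z + cnj (z * poly c z)"
    using Re_Im_poly_decomposition[of p q] by blast
  have bi: "integrable circle_measure b" using a by (simp add: analytic_L1_def)
  have bc: "integrable circle_measure (\<lambda>z. b z * (z * poly c z))"
    using square_integrable_mult_integrable_complex[of b circle_measure "\<lambda>z. z * poly c z"] b
      integrable_poly_square(1)[of "pCons 0 c"] measurable_poly_circle[of "pCons 0 c"] by (simp cong: measurable_cong)
  have o: "(LINT z|circle_measure. (b z - poly A z) * (z * poly (- c) z)) = 0"
  proof -
    have "(LINT z|circle_measure. (b z - poly A z) * (z * poly (- c) z)) =
       (LINT z|circle_measure. poly (pCons 0 (A * c)) z - b z * (z * poly c z))"
      by (rule Bochner_Integration.integral_cong) (auto simp: algebra_simps)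
    also have "\<dots> = (LINT z|circle_measure. poly (pCons 0 (A * c)) z) - (LINT z|circle_measure. b z * (z * poly c z))"
      by (rule Bochner_Integration.integral_diff[OF integrable_circle_continuous bc]) (intro continuous_intros)
    also have "\<dots> = 0" unfolding integral_circle_poly using a by (simp add: analytic_L1_def)
    finally show ?thesis .
  qed
  have bA: "integrable circle_measure (\<lambda>z. (cmod (b z - poly A z))\<^sup>2)"
    using integrable_square_add(1)[of b circle_measure "\<lambda>z. - poly A z"] b integrable_poly_square(1)[of A] by simp
  have "(LINT z|circle_measure. (cmod (b z - poly A z))\<^sup>2) \<le>
      (LINT z|circle_measure. (cmod (b z - poly A z + cnj (z * poly (- c) z)))\<^sup>2)"
    by (rule integral_orthogonal_square[OF _ bA o]) measurable
  also have "\<dots> = (LINT z|circle_measure. (Re (b z) - Re (poly p z))\<^sup>2 + (Im (b z) - Re (poly q z))\<^sup>2)"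
  proof (rule Bochner_Integration.integral_cong[OF refl])
    fix z
    have "b z - poly A z + cnj (z * poly (- c) z) = b z - Complex (Re (poly p z)) (Re (poly q z))"
      unfolding Ac by simp
    then show "(cmod (b z - poly A z + cnj (z * poly (- c) z)))\<^sup>2 = (Re (b z) - Re (poly p z))\<^sup>2 + (Im (b z) - Re (poly q z))\<^sup>2"
      by (simp only: cmod_power2 minus_complex.sel complex.sel)
  qed
  also have "\<dots> = (LINT z|circle_measure. (Re (b z) - Re (poly p z))\<^sup>2) + (LINT z|circle_measure. (Im (b z) - Re (poly q z))\<^sup>2)"
    by (rule Bochner_Integration.integral_add; rule integrable_diff_Re_poly_square) (use i in auto)
  also have "\<dots> < e" using p q by simp
  finally show ?thesis using that by blast
qed

text \<open>The test functions are first trigonometric polynomials, for which only the analytic part counts,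
  then bounded functions, in particular truncations of \<open>\<phi>\<close> itself.\<close>

lemma square_integrable_if_bounded_functional:
  assumes a: "analytic_L1 \<phi>" and K: "0 \<le> K"
    and b: "\<And>q. (cmod (LINT z|circle_measure. poly q z * cnj (\<phi> z)))\<^sup>2 \<le> K * (LINT z|circle_measure. (cmod (poly q z))\<^sup>2)"
  shows "integrable circle_measure (\<lambda>z. (cmod (\<phi> z))\<^sup>2)"
proof -
  have \<phi>: "integrable circle_measure \<phi>" using a by (simp add: analytic_L1_def)
  then have [measurable]: "\<phi> \<in> borel_measurable circle_measure" by simp
  have c\<phi>: "integrable circle_measure (\<lambda>z. cnj (\<phi> z))" using \<phi> by simp
  have 1: "(cmod (LINT z|circle_measure. cnj (\<phi> z) * Complex (Re (poly p z)) (Re (poly q z))))\<^sup>2 \<le>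
     K * (LINT z|circle_measure. (cmod (Complex (Re (poly p z)) (Re (poly q z))))\<^sup>2)" for p q
  proof -
    obtain A c where Ac: "\<And>z. Complex (Re (poly p z)) (Re (poly q z)) = poly A z + cnj (z * poly c z)"
      using Re_Im_poly_decomposition[of p q] by blast
    have "(LINT z|circle_measure. cnj (\<phi> z) * (poly A z + cnj (z * poly c z))) =
        (LINT z|circle_measure. poly A z * cnj (\<phi> z) + cnj (\<phi> z * (z * poly c z)))"
      by (rule Bochner_Integration.integral_cong) (auto simp: algebra_simps)
    also have "\<dots> = (LINT z|circle_measure. poly A z * cnj (\<phi> z)) + (LINT z|circle_measure. cnj (\<phi> z * (z * poly c z)))"
    proof (rule Bochner_Integration.integral_add)
      show "integrable circle_measure (\<lambda>z. poly A z * cnj (\<phi> z))"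
        using integrable_mult_continuous[OF c\<phi>, of "poly A"] by (simp add: mult.commute continuous_intros)
      show "integrable circle_measure (\<lambda>z. cnj (\<phi> z * (z * poly c z)))"
        by (intro integrable_cnj integrable_mult_continuous \<phi> continuous_intros)
    qed
    also have "(LINT z|circle_measure. cnj (\<phi> z * (z * poly c z))) = 0"
      unfolding Bochner_Integration.integral_cnj using a by (simp add: analytic_L1_def)
    finally have eq: "(LINT z|circle_measure. cnj (\<phi> z) * (poly A z + cnj (z * poly c z))) = (LINT z|circle_measure. poly A z * cnj (\<phi> z))" by simp
    have "(LINT z|circle_measure. poly A z * (z * poly c z)) = 0"
      using integral_circle_poly[of "pCons 0 (A * c)"] by (simp add: algebra_simps)
    then have "(LINT z|circle_measure. (cmod (poly A z))\<^sup>2) \<le> (LINT z|circle_measure. (cmod (poly A z + cnj (z * poly c z)))\<^sup>2)"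
      by (intro integral_orthogonal_square integrable_poly_square) measurable
    then have "K * (LINT z|circle_measure. (cmod (poly A z))\<^sup>2) \<le> K * (LINT z|circle_measure. (cmod (poly A z + cnj (z * poly c z)))\<^sup>2)"
      using K by (rule mult_left_mono)
    then show ?thesis using b[of A] unfolding Ac eq by linarith
  qed
  have 2: "(cmod (LINT z|circle_measure. cnj (\<phi> z) * g z))\<^sup>2 \<le> K * (LINT z|circle_measure. (cmod (g z))\<^sup>2)"
    if [measurable]: "g \<in> borel_measurable circle_measure" and g: "\<And>z. cmod (g z) \<le> B" for g and B :: real
  proof -
    have gb: "\<bar>Re (g z)\<bar> \<le> B" "\<bar>Im (g z)\<bar> \<le> B" for z
      using abs_Re_le_cmod[of "g z"] abs_Im_le_cmod[of "g z"] g[of z] by linarith+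
    have mRe: "(\<lambda>z. Re (g z)) \<in> borel_measurable circle_measure" and mIm: "(\<lambda>z. Im (g z)) \<in> borel_measurable circle_measure"
      by measurable
    obtain P where P: "\<And>k z. z \<in> sphere 0 1 \<Longrightarrow> \<bar>Re (poly (P k) z)\<bar> \<le> B + 1"
      "AE z in circle_measure. (\<lambda>k. Re (poly (P k) z)) \<longlonglongrightarrow> Re (g z)"
      using bounded_Re_poly_AE_limit[OF mRe gb(1)] by blast
    obtain Q where Q: "\<And>k z. z \<in> sphere 0 1 \<Longrightarrow> \<bar>Re (poly (Q k) z)\<bar> \<le> B + 1"
      "AE z in circle_measure. (\<lambda>k. Re (poly (Q k) z)) \<longlonglongrightarrow> Im (g z)"
      using bounded_Re_poly_AE_limit[OF mIm gb(2)] by blast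
    define t where "t k z = Complex (Re (poly (P k) z)) (Re (poly (Q k) z))" for k z
    have tm[measurable]: "t k \<in> borel_measurable circle_measure" for k
      unfolding t_def by (intro measurable_circle_continuous continuous_intros)
    have tb: "cmod (t k z) \<le> 2 * (B + 1)" if "z \<in> sphere 0 1" for k z
      using cmod_le[of "t k z"] P(1)[OF that, of k] Q(1)[OF that, of k] by (simp add: t_def)
    have tl: "AE z in circle_measure. (\<lambda>k. t k z) \<longlonglongrightarrow> g z"
      using P(2) Q(2)
    proof eventually_elim
      fix z assume "(\<lambda>k. Re (poly (P k) z)) \<longlonglongrightarrow> Re (g z)" "(\<lambda>k. Re (poly (Q k) z)) \<longlonglongrightarrow> Im (g z)"
      then have "(\<lambda>k. t k z) \<longlonglongrightarrow> Complex (Re (g z)) (Im (g z))" unfolding t_def by (intro tendsto_Complex)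
      then show "(\<lambda>k. t k z) \<longlonglongrightarrow> g z" by simp
    qed
    have l1: "(\<lambda>k. LINT z|circle_measure. cnj (\<phi> z) * t k z) \<longlonglongrightarrow> (LINT z|circle_measure. cnj (\<phi> z) * g z)"
      by (rule integral_mult_bounded_limit[OF c\<phi> tm _ _ tl, where B="2 * (B + 1)"]) (use tb in auto)
    have l2: "(\<lambda>k. LINT z|circle_measure. (cmod (t k z))\<^sup>2) \<longlonglongrightarrow> (LINT z|circle_measure. (cmod (g z))\<^sup>2)"
    proof (rule integral_dominated_convergence[where w="\<lambda>_. (2 * (B + 1))\<^sup>2"])
      show "AE z in circle_measure. (\<lambda>k. (cmod (t k z))\<^sup>2) \<longlonglongrightarrow> (cmod (g z))\<^sup>2"
        using tl by eventually_elim (intro tendsto_intros)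
      show "AE z in circle_measure. norm ((cmod (t k z))\<^sup>2) \<le> (2 * (B + 1))\<^sup>2" for k
        by (rule AE_I2) (use tb in \<open>auto intro!: power_mono\<close>)
    qed auto
    show ?thesis
    proof (rule LIMSEQ_le)
      show "(\<lambda>k. (cmod (LINT z|circle_measure. cnj (\<phi> z) * t k z))\<^sup>2) \<longlonglongrightarrow> (cmod (LINT z|circle_measure. cnj (\<phi> z) * g z))\<^sup>2"
        by (intro tendsto_intros l1)
      show "(\<lambda>k. K * (LINT z|circle_measure. (cmod (t k z))\<^sup>2)) \<longlonglongrightarrow> K * (LINT z|circle_measure. (cmod (g z))\<^sup>2)"
        by (intro tendsto_intros l2)
    qed (use 1 in \<open>auto simp: t_def\<close>)
  qed
  define g where "g N z = (if cmod (\<phi> z) \<le> real N then \<phi> z else 0)" for N z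
  have gm[measurable]: "g N \<in> borel_measurable circle_measure" for N unfolding g_def by measurable
  have gb: "cmod (g N z) \<le> N" for N z by (simp add: g_def)
  have gi: "integrable circle_measure (\<lambda>z. (cmod (g N z))\<^sup>2)" for N
    by (rule integrable_circle_bounded[where B="(real N)\<^sup>2"]) (use gb in \<open>auto intro!: power_mono\<close>)
  have le: "(LINT z|circle_measure. (cmod (g N z))\<^sup>2) \<le> K" for N
  proof -
    define x where "x = (LINT z|circle_measure. (cmod (g N z))\<^sup>2)"
    have "(LINT z|circle_measure. cnj (\<phi> z) * g N z) = (LINT z|circle_measure. complex_of_real ((cmod (g N z))\<^sup>2))"
      by (rule Bochner_Integration.integral_cong) (auto simp: g_def complex_norm_square mult.commute simp del: of_real_power)
    also have "\<dots> = complex_of_real x" unfolding x_def by (rule integral_complex_of_real)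
    finally have "(cmod (complex_of_real x))\<^sup>2 \<le> K * x"
      using 2[OF gm gb, of N] by (simp add: x_def)
    \<comment> \<open>Pairing \<open>\<phi>\<close> with its own truncation gives the squared norm
      \<open>x\<close> of the truncation, so the bound becomes \<open>x^2 <= K * x\<close>,
      uniformly in \<open>N\<close>.\<close>
    then have "x * x \<le> K * x" by (simp add: power2_eq_square)
    moreover have "x \<ge> 0" by (simp add: x_def)
    ultimately show ?thesis unfolding x_def[symmetric] using K by (cases "x = 0") (auto simp: mult_le_cancel_right)
  qed
  show ?thesis
  proof (rule integral_limit_bound(1)[where g="\<lambda>N z. (cmod (g N z))\<^sup>2" and b="\<lambda>_. K" and B=K])
    show "AE z in circle_measure. (\<lambda>N. (cmod (g N z))\<^sup>2) \<longlonglongrightarrow> (cmod (\<phi> z))\<^sup>2"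
    proof (rule AE_I2)
      fix z
      obtain n0 :: nat where n0: "cmod (\<phi> z) \<le> n0" using real_arch_simple by blast
      have "(cmod (g n z))\<^sup>2 = (cmod (\<phi> z))\<^sup>2" if "n \<ge> n0" for n using n0 that by (simp add: g_def)
      then have "\<forall>\<^sub>F n in sequentially. (cmod (g n z))\<^sup>2 = (cmod (\<phi> z))\<^sup>2" unfolding eventually_sequentially by blast
      then show "(\<lambda>N. (cmod (g N z))\<^sup>2) \<longlonglongrightarrow> (cmod (\<phi> z))\<^sup>2" by (rule tendsto_eventually)
    qed
  qed (use gi le in auto)
qed

lemma analytic_L1_integral_poly:
  assumes "analytic_L1 F"
  shows "(LINT z|circle_measure. F z * poly q z) = (LINT z|circle_measure. F z) * coeff q 0"
proof -
  have F: "integrable circle_measure F" using assms by (simp add: analytic_L1_def)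
  obtain k c where q: "q = pCons k c" by (cases q)
  have i: "integrable circle_measure (\<lambda>z. F z * k)" "integrable circle_measure (\<lambda>z. F z * (z * poly c z))"
    by (intro integrable_mult_continuous F continuous_intros)+
  have "(LINT z|circle_measure. F z * poly q z) = (LINT z|circle_measure. F z * k + F z * (z * poly c z))"
    by (simp add: q algebra_simps)
  also have "\<dots> = (LINT z|circle_measure. F z * k) + (LINT z|circle_measure. F z * (z * poly c z))"
    by (rule Bochner_Integration.integral_add[OF i])
  finally show ?thesis using assms by (simp add: analytic_L1_def q)
qed

lemma analytic_L1_mult_poly:
  assumes "analytic_L1 F"
  shows "analytic_L1 (\<lambda>z. F z * poly q z)"
proof -
  have F: "integrable circle_measure F" using assms by (simp add: analytic_L1_def)
  have "(LINT z|circle_measure. F z * poly q z * (z * poly r z)) = (LINT z|circle_measure. F z * (z * poly (q * r) z))" for r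
    by (rule Bochner_Integration.integral_cong) (auto simp: algebra_simps)
  moreover have "integrable circle_measure (\<lambda>z. F z * poly q z)"
    by (intro integrable_mult_continuous F continuous_intros)
  ultimately show ?thesis using assms unfolding analytic_L1_def by (auto simp del: poly_mult)
qed

lemma analytic_L1_cmult: "analytic_L1 F \<Longrightarrow> analytic_L1 (\<lambda>z. k * F z)"
  using analytic_L1_mult_poly[of F "[:k:]"] by (simp add: mult.commute)

lemma analytic_L1_diff:
  assumes "analytic_L1 F" "analytic_L1 G" shows "analytic_L1 (\<lambda>z. F z - G z)"
proof -
  have i: "integrable circle_measure F" "integrable circle_measure G" using assms by (auto simp: analytic_L1_def)
  have "(LINT z|circle_measure. (F z - G z) * (z * poly q z)) = 0" for q
  proof -
    have "(LINT z|circle_measure. (F z - G z) * (z * poly q z)) = (LINT z|circle_measure. F z * (z * poly q z) - G z * (z * poly q z))"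
      by (rule Bochner_Integration.integral_cong) (auto simp: algebra_simps)
    also have "\<dots> = (LINT z|circle_measure. F z * (z * poly q z)) - (LINT z|circle_measure. G z * (z * poly q z))"
      by (rule Bochner_Integration.integral_diff; intro integrable_mult_continuous i continuous_intros)
    finally show ?thesis using assms by (simp add: analytic_L1_def)
  qed
  then show ?thesis using i by (simp add: analytic_L1_def)
qed

text \<open>Analyticity removes the negative frequencies. If the others vanished too,
  \<open>\<phi>\<close> would annihilate all trigonometric polynomials, in particular the real parts
  of polynomials, and would be zero.\<close>

lemma analytic_L1_nonzero_moment:
  assumes a: "analytic_L1 \<phi>" and nz: "\<not> (AE z in circle_measure. \<phi> z = 0)"
  shows "\<exists>n. (LINT z|circle_measure. \<phi> z * cnj z ^ n) \<noteq> 0"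
proof (rule ccontr)
  assume "\<not> ?thesis"
  then have c: "(LINT z|circle_measure. \<phi> z * cnj z ^ n) = 0" for n by blast
  have \<phi>: "integrable circle_measure \<phi>" using a by (simp add: analytic_L1_def)
  have 1: "(LINT z|circle_measure. \<phi> z * poly q z) = 0" for q
    using analytic_L1_integral_poly[OF a, of q] c[of 0] by simp
  have 2: "(LINT z|circle_measure. \<phi> z * cnj (poly q z)) = 0" for q
  proof -
    have "(LINT z|circle_measure. \<phi> z * cnj (poly q z)) = (LINT z|circle_measure. (\<Sum>i\<le>degree q. cnj (coeff q i) * (\<phi> z * cnj z ^ i)))"
      by (rule Bochner_Integration.integral_cong) (auto simp: poly_altdef sum_distrib_left algebra_simps)
    also have "\<dots> = (\<Sum>i\<le>degree q. (LINT z|circle_measure. cnj (coeff q i) * (\<phi> z * cnj z ^ i)))"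
      by (rule Bochner_Integration.integral_sum) (intro integrable_mult_right integrable_mult_continuous \<phi> continuous_intros)
    also have "\<dots> = 0" using c by simp
    finally show ?thesis .
  qed
  have i: "integrable circle_measure (\<lambda>z. \<phi> z * complex_of_real (Re (poly q z)))" for q
    by (intro integrable_mult_continuous \<phi> continuous_intros)
  have 3: "(LINT z|circle_measure. \<phi> z * complex_of_real (Re (poly q z))) = 0" for q
  proof -
    have "(LINT z|circle_measure. \<phi> z * complex_of_real (Re (poly q z))) =
       (LINT z|circle_measure. (1/2) * (\<phi> z * poly q z) + (1/2) * (\<phi> z * cnj (poly q z)))"
    proof (rule Bochner_Integration.integral_cong[OF refl])
      fix z
      have e: "complex_of_real (Re w) = (1/2) * w + (1/2) * cnj w" for w
        by (simp add: complex_eq_iff)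
      show "\<phi> z * complex_of_real (Re (poly q z)) = (1/2) * (\<phi> z * poly q z) + (1/2) * (\<phi> z * cnj (poly q z))"
        unfolding e by (simp only: distrib_left mult.left_commute)
    qed
    also have "\<dots> = (LINT z|circle_measure. (1/2) * (\<phi> z * poly q z)) + (LINT z|circle_measure. (1/2) * (\<phi> z * cnj (poly q z)))"
      by (rule Bochner_Integration.integral_add; intro integrable_mult_right integrable_mult_continuous \<phi> continuous_intros)
    finally show ?thesis using 1 2 by simp
  qed
  have "AE z in circle_measure. Re (\<phi> z) = 0"
  proof (rule AE_zero_if_orthogonal_Re_poly)
    show "integrable circle_measure (\<lambda>z. Re (\<phi> z))" using \<phi> by simp
    show "(LINT z|circle_measure. Re (\<phi> z) * Re (poly q z)) = 0" for q
      using integral_Re[OF i, of q] 3[of q] by simp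
  qed
  moreover have "AE z in circle_measure. Im (\<phi> z) = 0"
  proof (rule AE_zero_if_orthogonal_Re_poly)
    show "integrable circle_measure (\<lambda>z. Im (\<phi> z))" using \<phi> by simp
    show "(LINT z|circle_measure. Im (\<phi> z) * Re (poly q z)) = 0" for q
      using integral_Im[OF i, of q] 3[of q] by simp
  qed
  ultimately have "AE z in circle_measure. \<phi> z = 0" by eventually_elim (simp add: complex_eq_iff)
  then show False using nz by blast
qed

text \<open>If \<open>\<phi>\<close> vanished on a set of positive measure, an outer function of mean value 1 that is small
  off this set would force the first nonzero Fourier coefficient of \<open>\<phi>\<close> to vanish.\<close>

lemma analytic_L1_nonzero_AE:
  assumes a: "analytic_L1 \<phi>" and nz: "\<not> (AE z in circle_measure. \<phi> z = 0)"
  shows "AE z in circle_measure. \<phi> z \<noteq> 0"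
proof (rule ccontr)
  assume neg: "\<not> ?thesis"
  have \<phi>: "integrable circle_measure \<phi>" using a by (simp add: analytic_L1_def)
  then have [measurable]: "\<phi> \<in> borel_measurable circle_measure" by simp
  define k where "k = (LEAST n. (LINT z|circle_measure. \<phi> z * cnj z ^ n) \<noteq> 0)"
  define \<alpha> where "\<alpha> = (LINT z|circle_measure. \<phi> z * cnj z ^ k)"
  have \<alpha>: "\<alpha> \<noteq> 0" unfolding \<alpha>_def k_def by (rule LeastI_ex[OF analytic_L1_nonzero_moment[OF a nz]])
  have small: "(LINT z|circle_measure. \<phi> z * cnj z ^ n) = 0" if "n < k" for n
    using not_less_Least[OF that[unfolded k_def]] by blast
  \<comment> \<open>Dividing by \<open>z ^ k\<close> moves the first nonzero coefficient to
    frequency 0. \<open>F\<close> then acts on polynomials as \<open>\<alpha>\<close> times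
    evaluation at the origin, the hypothesis of \<open>log_outer_integral\<close>.\<close>
  define F where "F z = \<phi> z * cnj z ^ k" for z
  have F: "integrable circle_measure F" unfolding F_def by (intro integrable_mult_continuous \<phi> continuous_intros)
  have Fj: "(LINT z|circle_measure. F z * z ^ j) = (if j = 0 then \<alpha> else 0)" for j
  proof (cases "j \<le> k")
    case True
    have "(LINT z|circle_measure. F z * z ^ j) = (LINT z|circle_measure. \<phi> z * cnj z ^ (k - j))"
    proof (rule Bochner_Integration.integral_cong[OF refl])
      fix z assume "z \<in> space circle_measure"
      then have "cnj z * z = 1" by (simp add: complex_norm_square[symmetric] mult.commute)
      then have "cnj z ^ j * z ^ j = 1" by (simp flip: power_mult_distrib)
      moreover have "cnj z ^ k = cnj z ^ (k - j) * cnj z ^ j" using True by (simp flip: power_add)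
      ultimately show "F z * z ^ j = \<phi> z * cnj z ^ (k - j)" by (simp add: F_def mult.assoc)
    qed
    then show ?thesis using small[of "k - j"] True by (auto simp: \<alpha>_def)
  next
    case False
    then obtain d where d: "j = k + Suc d" using less_imp_Suc_add[of k j] by auto
    have "(LINT z|circle_measure. F z * z ^ j) = (LINT z|circle_measure. \<phi> z * (z * poly (monom 1 d) z))"
    proof (rule Bochner_Integration.integral_cong[OF refl])
      fix z assume "z \<in> space circle_measure"
      then have "cnj z * z = 1" by (simp add: complex_norm_square[symmetric] mult.commute)
      then have "cnj z ^ k * z ^ k = 1" by (simp flip: power_mult_distrib)
      then have "cnj z ^ k * z ^ j = z * z ^ d" unfolding d power_add by (simp flip: mult.assoc)
      then show "F z * z ^ j = \<phi> z * (z * poly (monom 1 d) z)" by (simp add: F_def poly_monom mult.assoc)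
    qed
    then show ?thesis using a False by (simp add: analytic_L1_def)
  qed
  have Fq: "(LINT z|circle_measure. F z * poly q z) = \<alpha> * coeff q 0" for q
  proof -
    have "(LINT z|circle_measure. F z * poly q z) = (LINT z|circle_measure. (\<Sum>i\<le>degree q. coeff q i * (F z * z ^ i)))"
      by (rule Bochner_Integration.integral_cong) (auto simp: poly_altdef sum_distrib_left algebra_simps)
    also have "\<dots> = (\<Sum>i\<le>degree q. (LINT z|circle_measure. coeff q i * (F z * z ^ i)))"
      by (rule Bochner_Integration.integral_sum) (intro integrable_mult_right integrable_mult_continuous F continuous_intros)
    also have "\<dots> = (\<Sum>i\<le>degree q. if i = 0 then \<alpha> * coeff q 0 else 0)" by (rule sum.cong) (auto simp: Fj)
    finally show ?thesis by simp
  qed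
  define E where "E = {z \<in> space circle_measure. \<phi> z = 0}"
  have Em[measurable]: "E \<in> sets circle_measure" unfolding E_def by measurable
  define m where "m = measure circle_measure E"
  have m: "m > 0"
  proof -
    have "m \<noteq> 0"
    proof
      assume "m = 0"
      then have "emeasure circle_measure E = 0" by (simp add: m_def circle.emeasure_eq_measure)
      then have "AE z in circle_measure. \<phi> z \<noteq> 0" by (intro AE_I[OF _ _ Em]) (auto simp: E_def)
      then show False using neg by blast
    qed
    then show ?thesis by (simp add: m_def zero_less_measure_iff)
  qed
  \<comment> \<open>Mean zero makes the outer function take the value 1 at the origin. It is large
    only on \<open>E\<close>, where \<open>\<phi>\<close> vanishes, and \<open>s * u z = - x\<close>
    elsewhere.\<close>
  define u where "u z = indicator E z - m" for z :: complex
  have um[measurable]: "u \<in> borel_measurable circle_measure" unfolding u_def by measurable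
  have m1: "m \<le> 1" by (simp add: m_def)
  have ub: "\<bar>u z\<bar> \<le> 1" for z using m m1 by (auto simp: u_def indicator_def)
  have u2: "integrable circle_measure (\<lambda>z. (u z)\<^sup>2)"
    by (rule integrable_circle_bounded[where B=1]) (use ub in \<open>auto simp: abs_square_le_1\<close>)
  have iE: "integrable circle_measure (indicator E :: complex \<Rightarrow> real)"
    by (rule integrable_circle_bounded[where B=1]) auto
  have u0: "(LINT z|circle_measure. u z) = 0"
  proof -
    have "(LINT z|circle_measure. u z) = (LINT z|circle_measure. indicator E z) - (LINT z|circle_measure. m)"
      unfolding u_def using iE by (intro Bochner_Integration.integral_diff) auto
    also have "(LINT z|circle_measure. indicator E z) = m"
      using Em sets.sets_into_space[OF Em] by (simp add: m_def Int_absorb2 del: space_circle)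
    also have "(LINT z|circle_measure. m) = m" using circle.prob_space by simp
    finally show ?thesis by simp
  qed
  have uB: "u z \<le> 1" for z using ub[of z] by linarith
  obtain h where h: "log_outer u h" using log_outer_exists[OF um u2 uB] by blast
  note [measurable] = log_outerD(1)[OF h]
  \<comment> \<open>With \<open>s = x / m\<close> the integral identity becomes
    \<open>1 <= x * exp (- x)\<close>, which fails for every real \<open>x\<close>.\<close>
  define x where "x = (LINT z|circle_measure. cmod (\<phi> z)) / cmod \<alpha>"
  have x0: "x \<ge> 0" by (simp add: x_def)
  define s where "s = x / m"
  have s0: "s \<ge> 0" using x0 m by (simp add: s_def)
  have "(LINT z|circle_measure. F z * exp (s * h z)) = \<alpha>"
    using log_outer_integral[OF h F Fq s0] by (simp add: u0)
  then have "cmod \<alpha> \<le> (LINT z|circle_measure. cmod (F z * exp (s * h z)))"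
    using integral_norm_bound[of circle_measure "\<lambda>z. F z * exp (s * h z)"] by simp
  also have "\<dots> = (LINT z|circle_measure. cmod (\<phi> z) * exp (- x))"
  proof (rule integral_cong_AE)
    show "(\<lambda>z. cmod (F z * exp (s * h z))) \<in> borel_measurable circle_measure" using F by measurable
    show "AE z in circle_measure. cmod (F z * exp (s * h z)) = cmod (\<phi> z) * exp (- x)"
      using log_outerD(2)[OF h] AE_space
    proof eventually_elim
      case (elim z)
      have "cmod (F z) = cmod (\<phi> z)" using elim by (simp add: F_def norm_mult norm_power)
      moreover have "\<phi> z = 0 \<or> s * Re (h z) = - x"
        using elim m by (auto simp: u_def E_def s_def indicator_def)
      ultimately show ?case by (auto simp: norm_mult)
    qed
  qed measurable
  also have "\<dots> = cmod \<alpha> * x * exp (- x)" using \<alpha> by (simp add: x_def)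
  finally have "1 \<le> x * exp (- x)" using \<alpha> by (simp add: mult.assoc)
  then have "exp x \<le> x" by (simp add: exp_minus field_simps)
  then show False using exp_ge_add_one_self[of x] by linarith
qed

lemma exp_le_quadratic:
  fixes y :: real
  assumes "y \<le> 1"
  shows "exp y \<le> 1 + y + y\<^sup>2"
proof (cases "y \<ge> 0")
  case True
  then show ?thesis using exp_bound[of y] assms by simp
next
  case False
  have "1 - y \<le> exp (- y)" using exp_ge_add_one_self[of "- y"] by simp
  then have "exp y * (1 - y) \<le> exp y * exp (- y)" by (intro mult_left_mono) auto
  then have 1: "exp y * (1 - y) \<le> 1" by (simp flip: exp_add)
  have "y * y\<^sup>2 \<le> 0" using False by (intro mult_nonpos_nonneg) auto
  \<comment> \<open>The product is \<open>1 - y^3\<close>, which is at least 1 for negative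
    \<open>y\<close>.\<close>
  then have "1 \<le> (1 + y + y\<^sup>2) * (1 - y)" by (simp add: algebra_simps power2_eq_square)
  with 1 have "exp y * (1 - y) \<le> (1 + y + y\<^sup>2) * (1 - y)" by linarith
  then show ?thesis using False by (simp add: mult_le_cancel_right)
qed

subsection \<open>Variations of the norm\<close>

text \<open>Lets the step \<open>s\<close> of a variation tend to 0 in an inequality with error of
  order \<open>s\<close>, so that no derivative of the norm has to exist.\<close>

lemma le_if_le_add_small:
  fixes x y c t :: real
  assumes "t > 0" "\<And>s. 0 < s \<Longrightarrow> s < t \<Longrightarrow> x \<le> y + s * c"
  shows "x \<le> y"
proof (rule ccontr)
  assume "\<not> x \<le> y"
  define d where "d = x - y"
  have d: "d > 0" using \<open>\<not> x \<le> y\<close> by (simp add: d_def)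
  define s where "s = min (t / 2) (d / (2 * (\<bar>c\<bar> + 1)))"
  have "s \<le> t / 2" unfolding s_def by (rule min.cobounded1)
  then have s: "0 < s" "s < t" using assms(1) d by (auto simp: s_def)
  have "s * c \<le> s * (\<bar>c\<bar> + 1)" using s by (intro mult_left_mono) auto
  also have "\<dots> \<le> d / (2 * (\<bar>c\<bar> + 1)) * (\<bar>c\<bar> + 1)" by (intro mult_right_mono) (auto simp: s_def)
  also have "\<dots> = d / 2"
  proof -
    have "\<bar>c\<bar> + 1 \<noteq> 0" by linarith
    then show ?thesis by (metis divide_divide_eq_left nonzero_eq_divide_eq)
  qed
  finally have "s * c \<le> d / 2" .
  with assms(2)[OF s] have "d \<le> d / 2" unfolding d_def by linarith
  then show False using d by simp
qed

text \<open>The squared modulus is \<open>1 + 2 * s * Re w + s^2 * |w|^2\<close>, bounded by an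
  exponential. Its power of order r / 2 is again an exponential, and \<open>exp_le_quadratic\<close>
  expands it. The remainder depends only on \<open>r\<close> and \<open>Q\<close>, hence is uniform
  over the circle.\<close>

lemma norm_powr_one_plus_le:
  assumes r: "1 \<le> r" and Q: "cmod w \<le> Q" and s: "0 < s" "s \<le> 1" "s * (r * Q + r * Q\<^sup>2 / 2) \<le> 1"
  shows "cmod (1 + of_real s * w) powr r \<le> 1 + r * s * Re w + s\<^sup>2 * (r * Q\<^sup>2 / 2 + (r * Q + r * Q\<^sup>2 / 2)\<^sup>2)"
proof -
  define y where "y = r * s * Re w + r * s\<^sup>2 * Q\<^sup>2 / 2"
  define M where "M = r * Q + r * Q\<^sup>2 / 2"
  have Q0: "Q \<ge> 0" using Q norm_ge_zero order_trans by blast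
  have ReQ: "\<bar>Re w\<bar> \<le> Q" using Q abs_Re_le_cmod order_trans by blast
  have "(cmod (1 + of_real s * w))\<^sup>2 = 1 + (2 * s * Re w + s\<^sup>2 * (cmod w)\<^sup>2)"
    unfolding cmod_power2 by (simp add: power2_eq_square algebra_simps)
  also have "\<dots> \<le> 1 + (2 * s * Re w + s\<^sup>2 * Q\<^sup>2)"
    using Q by (intro add_left_mono mult_left_mono power_mono) auto
  also have "\<dots> \<le> exp (2 * s * Re w + s\<^sup>2 * Q\<^sup>2)" by (rule exp_ge_add_one_self)
  also have "\<dots> = (exp (s * Re w + s\<^sup>2 * Q\<^sup>2 / 2))\<^sup>2" by (simp add: power2_eq_square flip: exp_add)
  finally have "cmod (1 + of_real s * w) \<le> exp (s * Re w + s\<^sup>2 * Q\<^sup>2 / 2)"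
    by (rule power2_le_imp_le) simp
  then have "cmod (1 + of_real s * w) powr r \<le> exp (s * Re w + s\<^sup>2 * Q\<^sup>2 / 2) powr r"
    using r by (intro powr_mono2) auto
  also have "\<dots> = exp y" by (simp add: powr_def y_def algebra_simps)
  finally have 1: "cmod (1 + of_real s * w) powr r \<le> exp y" .
  have "\<bar>y\<bar> \<le> s * M"
  proof -
    have "\<bar>r * s * Re w\<bar> \<le> r * s * Q" using ReQ r s by (simp add: abs_mult)
    moreover have "s\<^sup>2 \<le> s" using s by (simp add: power2_eq_square)
    then have "(r * Q\<^sup>2 / 2) * s\<^sup>2 \<le> (r * Q\<^sup>2 / 2) * s" using r by (intro mult_left_mono) auto
    moreover have "0 \<le> r * s\<^sup>2 * Q\<^sup>2 / 2" using r by simp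
    ultimately show ?thesis unfolding y_def M_def by (simp add: algebra_simps abs_if split: if_splits)
  qed
  moreover from this have "y \<le> 1" using s(3) by (simp add: M_def)
  moreover have "y\<^sup>2 \<le> (s * M)\<^sup>2" using power_mono[OF \<open>\<bar>y\<bar> \<le> s * M\<close>, of 2] by simp
  ultimately have "exp y \<le> 1 + y + (s * M)\<^sup>2" using exp_le_quadratic[of y] by linarith
  then have "exp y \<le> 1 + r * s * Re w + s\<^sup>2 * (r * Q\<^sup>2 / 2 + M\<^sup>2)"
    unfolding y_def power_mult_distrib by (simp add: algebra_simps)
  then show ?thesis using 1 unfolding M_def by linarith
qed

text \<open>First order variation of the multiplicative perturbation
  \<open>\<phi> \<mapsto> \<kappa>(1 + s q)\<phi>\<close>, where \<open>\<kappa>\<close> restores the orthogonality condition.\<close>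

lemma multiplicative_variation:
  fixes \<phi> :: "complex \<Rightarrow> complex"
  assumes m[measurable]: "\<phi> \<in> borel_measurable circle_measure" and r: "1 \<le> r"
    and i2: "integrable circle_measure (\<lambda>z. (cmod (\<phi> z))\<^sup>2)" and ir: "integrable circle_measure (\<lambda>z. cmod (\<phi> z) powr r)"
    and nz: "AE z in circle_measure. \<phi> z \<noteq> 0"
    and min: "\<And>R. (LINT z|circle_measure. (cmod (\<phi> z))\<^sup>2 * poly R z) = 0 \<Longrightarrow>
      (LINT z|circle_measure. cmod (\<phi> z) powr r) \<le> (LINT z|circle_measure. cmod (\<phi> z * (1 + poly R z)) powr r)"
  obtains \<gamma> where "\<gamma> > 0" "AE z in circle_measure. cmod (\<phi> z) powr r = \<gamma> * (cmod (\<phi> z))\<^sup>2"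
proof -
  define a where "a = (LINT z|circle_measure. cmod (\<phi> z) powr r)"
  define b where "b = (LINT z|circle_measure. (cmod (\<phi> z))\<^sup>2)"
  have pos: "(LINT z|circle_measure. f z) > 0"
    if f: "integrable circle_measure f" "\<And>z. f z \<ge> 0" "\<And>z. \<phi> z \<noteq> 0 \<Longrightarrow> f z \<noteq> 0" for f :: "complex \<Rightarrow> real"
  proof -
    have "(LINT z|circle_measure. f z) \<noteq> 0"
    proof
      assume "(LINT z|circle_measure. f z) = 0"
      then have "AE z in circle_measure. f z = 0"
        using f by (subst (asm) integral_nonneg_eq_0_iff_AE) auto
      with nz have "AE z in circle_measure. False" by eventually_elim (use f in auto)
      then show False by (simp add: circle.AE_False)
    qed
    moreover have "(LINT z|circle_measure. f z) \<ge> 0" using f by simp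
    ultimately show ?thesis by linarith
  qed
  have a: "a > 0" unfolding a_def by (rule pos) (use ir in auto)
  have b: "b > 0" unfolding b_def by (rule pos) (use i2 in auto)
  have iq: "integrable circle_measure (\<lambda>z. f z * poly q z)" if "integrable circle_measure f" for f :: "complex \<Rightarrow> complex" and q
    by (intro integrable_mult_continuous that continuous_intros)
  have c2: "integrable circle_measure (\<lambda>z. complex_of_real ((cmod (\<phi> z))\<^sup>2))" and cr: "integrable circle_measure (\<lambda>z. complex_of_real (cmod (\<phi> z) powr r))"
    using i2 ir by (auto simp only: complex_of_real_integrable_eq)
  have iRe2: "integrable circle_measure (\<lambda>z. (cmod (\<phi> z))\<^sup>2 * Re (poly q z))"
    and Re2: "(LINT z|circle_measure. (cmod (\<phi> z))\<^sup>2 * Re (poly q z)) = Re (LINT z|circle_measure. (cmod (\<phi> z))\<^sup>2 * poly q z)" for q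
    using integrable_Re[OF iq[OF c2], of q] integral_Re[OF iq[OF c2], of q] by (simp_all del: of_real_power)
  have iRer: "integrable circle_measure (\<lambda>z. cmod (\<phi> z) powr r * Re (poly q z))" for q
    using integrable_Re[OF iq[OF cr], of q] by simp
  have key: "a * ((LINT z|circle_measure. (cmod (\<phi> z))\<^sup>2 * Re (poly q z)) / b) \<le> (LINT z|circle_measure. cmod (\<phi> z) powr r * Re (poly q z))" for q
  proof -
    define \<beta> where "\<beta> = (LINT z|circle_measure. (cmod (\<phi> z))\<^sup>2 * Re (poly q z)) / b"
    define G where "G = (LINT z|circle_measure. cmod (\<phi> z) powr r * Re (poly q z))"
    obtain Q where Q: "0 \<le> Q" "\<And>z. z \<in> sphere 0 1 \<Longrightarrow> norm (poly q z) \<le> Q"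
      by (rule continuous_on_sphere_bound[of "poly q"]) (intro continuous_intros, blast)
    define M where "M = r * Q + r * Q\<^sup>2 / 2"
    define C where "C = r * Q\<^sup>2 / 2 + M\<^sup>2"
    have M: "M \<ge> 0" using r Q by (simp add: M_def)
    \<comment> \<open>For \<open>s < t\<close> the expansion applies with \<open>s \<le> 1\<close>
      and \<open>s * M \<le> 1\<close>, and \<open>\<bar>s * \<beta>\<bar> < 1\<close> keeps the
      denominator \<open>D\<close> away from 0.\<close>
    define t where "t = min 1 (min (1 / (M + 1)) (1 / (\<bar>\<beta>\<bar> + 1)))"
    have t: "t > 0" using M by (simp add: t_def)
    have "r * (a * \<beta>) \<le> r * G"
    proof (rule le_if_le_add_small[OF t])
      fix s assume s: "0 < s" "s < t"
      have s1: "s \<le> 1" using s by (simp add: t_def)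
      have sM: "s * M \<le> 1"
      proof -
        have "s * M \<le> (1 / (M + 1)) * (M + 1)" using s M by (intro mult_mono) (auto simp: t_def)
        then show ?thesis using M by (simp split: if_splits)
      qed
      have sb: "\<bar>s * \<beta>\<bar> < 1"
      proof -
        have "s * (\<bar>\<beta>\<bar> + 1) < (1 / (\<bar>\<beta>\<bar> + 1)) * (\<bar>\<beta>\<bar> + 1)" using s by (intro mult_strict_right_mono) (auto simp: t_def)
        also have "\<dots> = 1" by (simp add: add_eq_0_iff)
        finally have "s * (\<bar>\<beta>\<bar> + 1) < 1" .
        then show ?thesis using s by (simp add: abs_mult algebra_simps)
      qed
      \<comment> \<open>\<open>D\<close> is the integral of \<open>|\<phi>|^2 * (1 + s * q)\<close>,
        so \<open>\<kappa> = b / D\<close> makes the perturbation orthogonal to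
        \<open>\<phi>\<close>.\<close>
      define D where "D = complex_of_real b + s * (LINT z|circle_measure. (cmod (\<phi> z))\<^sup>2 * poly q z)"
      have ReD: "Re D = b * (1 + s * \<beta>)"
        using Re2[of q] b by (simp add: D_def \<beta>_def algebra_simps del: of_real_power)
      have ReD0: "Re D > 0" unfolding ReD using b sb by (intro mult_pos_pos) linarith+
      define \<kappa> where "\<kappa> = of_real b / D"
      have D0: "D \<noteq> 0" using ReD0 by auto
      \<comment> \<open>The imaginary part of \<open>D\<close> can only decrease the modulus of
        \<open>\<kappa>\<close>; hence only \<open>Re q\<close> enters the first-order term.\<close>
      have "cmod \<kappa> \<le> 1 / (1 + s * \<beta>)"
      proof -
        have "b * (1 + s * \<beta>) \<le> cmod D" using complex_Re_le_cmod[of D] ReD by simp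
        moreover have "cmod D > 0" "1 + s * \<beta> > 0" using D0 sb by (simp, linarith)
        ultimately show ?thesis using b by (simp add: \<kappa>_def norm_divide pos_divide_le_eq pos_le_divide_eq)
      qed
      define R where "R = smult \<kappa> (1 + smult s q) - 1"
      have R1: "1 + poly R z = \<kappa> * (1 + s * poly q z)" for z by (simp add: R_def)
      have "(LINT z|circle_measure. (cmod (\<phi> z))\<^sup>2 * poly R z) =
        (LINT z|circle_measure. (\<kappa> - 1) * complex_of_real ((cmod (\<phi> z))\<^sup>2) + (\<kappa> * s) * (complex_of_real ((cmod (\<phi> z))\<^sup>2) * poly q z))"
        by (rule Bochner_Integration.integral_cong) (auto simp: R_def algebra_simps)
      also have "\<dots> = (\<kappa> - 1) * (LINT z|circle_measure. complex_of_real ((cmod (\<phi> z))\<^sup>2)) + (\<kappa> * s) * (LINT z|circle_measure. (complex_of_real ((cmod (\<phi> z))\<^sup>2) * poly q z))"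
        by (subst Bochner_Integration.integral_add[OF integrable_mult_right[OF c2] integrable_mult_right[OF iq[OF c2]]]) (simp del: of_real_power)
      also have "(LINT z|circle_measure. complex_of_real ((cmod (\<phi> z))\<^sup>2)) = b"
        unfolding b_def by (rule integral_complex_of_real)
      also have "(\<kappa> - 1) * b + (\<kappa> * s) * (LINT z|circle_measure. (complex_of_real ((cmod (\<phi> z))\<^sup>2) * poly q z)) = \<kappa> * D - b"
        by (simp add: D_def algebra_simps)
      also have "\<dots> = 0" using D0 by (simp add: \<kappa>_def)
      finally have "a \<le> (LINT z|circle_measure. cmod (\<phi> z * (1 + poly R z)) powr r)"
        unfolding a_def by (rule min)
      also have "\<dots> \<le> (LINT z|circle_measure. (1 / (1 + s * \<beta>)) powr r * (cmod (\<phi> z) powr r * (1 + s\<^sup>2 * C) + r * s * (cmod (\<phi> z) powr r * Re (poly q z))))"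
      proof (rule integral_mono')
        show "integrable circle_measure (\<lambda>z. (1 / (1 + s * \<beta>)) powr r * (cmod (\<phi> z) powr r * (1 + s\<^sup>2 * C) + r * s * (cmod (\<phi> z) powr r * Re (poly q z))))"
          using ir iRer by simp
        fix z assume z: "z \<in> space circle_measure"
        have "cmod (\<phi> z * (1 + poly R z)) powr r = cmod \<kappa> powr r * (cmod (\<phi> z) powr r * cmod (1 + s * poly q z) powr r)"
          unfolding R1 by (simp add: norm_mult powr_mult mult_ac)
        also have "\<dots> \<le> (1 / (1 + s * \<beta>)) powr r * (cmod (\<phi> z) powr r * (1 + r * s * Re (poly q z) + s\<^sup>2 * C))"
        proof (intro mult_mono powr_mono2)
          show "cmod (1 + s * poly q z) powr r \<le> 1 + r * s * Re (poly q z) + s\<^sup>2 * C"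
            unfolding C_def M_def by (rule norm_powr_one_plus_le[OF r Q(2) s(1) s1]) (use z sM in \<open>auto simp: M_def\<close>)
          then have "0 \<le> 1 + r * s * Re (poly q z) + s\<^sup>2 * C" using powr_ge_zero order_trans by blast
        qed (use r \<open>cmod \<kappa> \<le> _\<close> in auto)
        also have "\<dots> = (1 / (1 + s * \<beta>)) powr r * (cmod (\<phi> z) powr r * (1 + s\<^sup>2 * C) + r * s * (cmod (\<phi> z) powr r * Re (poly q z)))"
          by (simp add: algebra_simps)
        finally show "cmod (\<phi> z * (1 + poly R z)) powr r \<le> \<dots>" .
        then show "0 \<le> (1 / (1 + s * \<beta>)) powr r * (cmod (\<phi> z) powr r * (1 + s\<^sup>2 * C) + r * s * (cmod (\<phi> z) powr r * Re (poly q z)))"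
          using powr_ge_zero order_trans by blast
      qed
      also have "\<dots> = (1 / (1 + s * \<beta>)) powr r * (a * (1 + s\<^sup>2 * C) + r * s * G)"
        using ir iRer by (simp add: a_def G_def)
      finally have 1: "a \<le> (1 / (1 + s * \<beta>)) powr r * (a * (1 + s\<^sup>2 * C) + r * s * G)" .
      have sb1: "1 + s * \<beta> > 0" using sb by linarith
      have "(1 + s * \<beta>) powr r * a \<le> (1 + s * \<beta>) powr r * ((1 / (1 + s * \<beta>)) powr r * (a * (1 + s\<^sup>2 * C) + r * s * G))"
        using 1 by (rule mult_left_mono) simp
      also have "\<dots> = a * (1 + s\<^sup>2 * C) + r * s * G"
        using sb1 by (simp add: powr_divide)
      finally have 2: "(1 + s * \<beta>) powr r * a \<le> a * (1 + s\<^sup>2 * C) + r * s * G" .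
      have "(1 + r * (s * \<beta>)) * a \<le> (1 + s * \<beta>) powr r * a"
        using powr_ge_tangent[OF r, of "1 + s * \<beta>"] sb1 a by (intro mult_right_mono) auto
      with 2 have "s * (r * (a * \<beta>)) \<le> s * (r * G + s * (a * C))"
        by (simp add: algebra_simps power2_eq_square)
      then show "r * (a * \<beta>) \<le> r * G + s * (a * C)" using s by simp
    qed
    then have "a * \<beta> \<le> G" using r by (simp add: mult_le_cancel_left)
    then show ?thesis unfolding \<beta>_def G_def .
  qed
  define \<gamma> where "\<gamma> = a / b"
  \<comment> \<open>The inequality for \<open>q\<close> and for \<open>- q\<close> together give
    equality.\<close>
  have eq: "(LINT z|circle_measure. cmod (\<phi> z) powr r * Re (poly q z)) = \<gamma> * (LINT z|circle_measure. (cmod (\<phi> z))\<^sup>2 * Re (poly q z))" for q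
    using key[of q] key[of "- q"] by (simp add: \<gamma>_def)
  have "AE z in circle_measure. cmod (\<phi> z) powr r - \<gamma> * (cmod (\<phi> z))\<^sup>2 = 0"
  proof (rule AE_zero_if_orthogonal_Re_poly)
    show "integrable circle_measure (\<lambda>z. cmod (\<phi> z) powr r - \<gamma> * (cmod (\<phi> z))\<^sup>2)" using ir i2 by simp
    fix q
    have "(LINT z|circle_measure. (cmod (\<phi> z) powr r - \<gamma> * (cmod (\<phi> z))\<^sup>2) * Re (poly q z)) =
      (LINT z|circle_measure. cmod (\<phi> z) powr r * Re (poly q z) - \<gamma> * ((cmod (\<phi> z))\<^sup>2 * Re (poly q z)))"
      by (rule Bochner_Integration.integral_cong) (auto simp: algebra_simps)
    also have "\<dots> = 0" using iRer iRe2 eq by simp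
    finally show "(LINT z|circle_measure. (cmod (\<phi> z) powr r - \<gamma> * (cmod (\<phi> z))\<^sup>2) * Re (poly q z)) = 0" .
  qed
  then show ?thesis by (intro that[of \<gamma>]) (use a b in \<open>auto simp: \<gamma>_def\<close>)
qed

section \<open>Dense classes of analytic functions\<close>

lemma analytic_L1_mult_log_outer:
  assumes a: "analytic_L1 \<phi>" and h: "log_outer u h" and s: "0 \<le> s"
    and i: "integrable circle_measure (\<lambda>z. \<phi> z * exp (complex_of_real s * h z))"
  shows "analytic_L1 (\<lambda>z. \<phi> z * exp (complex_of_real s * h z))"
proof -
  have \<phi>: "integrable circle_measure \<phi>" using a by (simp add: analytic_L1_def)
  have "(LINT z|circle_measure. \<phi> z * exp (complex_of_real s * h z) * (z * poly q z)) = 0" for q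
  proof -
    have F: "integrable circle_measure (\<lambda>z. \<phi> z * (z * poly q z))"
      by (intro integrable_mult_continuous \<phi> continuous_intros)
    \<comment> \<open>For fixed \<open>q\<close>, the function
      \<open>\<phi> z * (z * poly q z)\<close> annihilates all polynomials. This is the case
      \<open>\<alpha> = 0\<close> of \<open>log_outer_integral\<close>, so multiplication by the
      outer function keeps its integral zero.\<close>
    have "(LINT z|circle_measure. \<phi> z * (z * poly q z) * poly p z) = 0 * coeff p 0" for p
    proof -
      have "(LINT z|circle_measure. \<phi> z * (z * poly q z) * poly p z) = (LINT z|circle_measure. \<phi> z * (z * poly (q * p) z))"
        by (rule Bochner_Integration.integral_cong) (auto simp: algebra_simps)
      also have "\<dots> = 0" using a unfolding analytic_L1_def by blast
      finally show ?thesis by simp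
    qed
    from log_outer_integral[OF h F this s]
    have "(LINT z|circle_measure. \<phi> z * (z * poly q z) * exp (complex_of_real s * h z)) = 0" by simp
    then show ?thesis by (simp add: mult_ac)
  qed
  then show ?thesis using i by (simp add: analytic_L1_def)
qed

text \<open>Through this bound an integrable \<open>\<phi>\<close> has a truncated logarithm in L2,
  as the construction of outer functions demands.\<close>

lemma ln_square_le:
  fixes x :: real
  assumes "x \<ge> 1"
  shows "(ln x)\<^sup>2 \<le> 4 * x"
proof -
  have "ln (sqrt x) \<le> sqrt x" using ln_le_minus_one[of "sqrt x"] assms by simp
  then have "ln x \<le> 2 * sqrt x" using assms by (simp add: ln_sqrt)
  then have "(ln x)\<^sup>2 \<le> (2 * sqrt x)\<^sup>2" using assms by (intro power_mono) auto
  then show ?thesis using assms by (simp add: power_mult_distrib)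
qed

lemma powr_cmod_add_le:
  assumes "1 \<le> r"
  shows "cmod (x + y) powr r \<le> 2 powr r * (cmod x powr r + cmod y powr r)"
proof -
  have "cmod (x + y) powr r \<le> (2 * max (cmod x) (cmod y)) powr r"
    using assms norm_triangle_ineq[of x y] by (intro powr_mono2) auto
  also have "\<dots> = 2 powr r * (max (cmod x) (cmod y)) powr r" by (simp add: powr_mult)
  also have "\<dots> \<le> 2 powr r * (cmod x powr r + cmod y powr r)"
    by (intro mult_left_mono) (auto simp: max_def)
  finally show ?thesis .
qed

text \<open>Multiplying by the outer function with modulus \<open>min 1 (N / |\<phi>|)\<close> truncates \<open>\<phi>\<close> within the
  class of analytic functions.\<close>

lemma analytic_bounded_dense:
  assumes a: "analytic_L1 \<phi>" and r: "1 \<le> r" and ir: "integrable circle_measure (\<lambda>z. cmod (\<phi> z) powr r)" and e: "e > 0"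
  obtains b B where "b \<in> borel_measurable circle_measure" "AE z in circle_measure. cmod (b z) \<le> B" "analytic_L1 b"
    "integrable circle_measure (\<lambda>z. cmod (\<phi> z - b z) powr r)"
    "(LINT z|circle_measure. cmod (\<phi> z - b z) powr r) < e"
proof -
  have \<phi>: "integrable circle_measure \<phi>" using a by (simp add: analytic_L1_def)
  then have \<phi>m[measurable]: "\<phi> \<in> borel_measurable circle_measure" by simp
  \<comment> \<open>The logarithm of \<open>min 1 (Suc N / |\<phi>|)\<close>. At zeros of
    \<open>\<phi>\<close> the conventional value of \<open>ln 0\<close> is at most 0, so
    \<open>u N\<close> vanishes there as well.\<close>
  define u where "u N z = - max 0 (ln (cmod (\<phi> z) / Suc N))" for N z
  have um[measurable]: "u N \<in> borel_measurable circle_measure" for N unfolding u_def by measurable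
  have u0: "u N z \<le> 0" for N z by (simp add: u_def)
  have usq: "(u N z)\<^sup>2 \<le> 4 * (cmod (\<phi> z) / Suc N)" for N z
  proof (cases "cmod (\<phi> z) / Suc N \<ge> 1")
    case True
    then have "u N z = - ln (cmod (\<phi> z) / Suc N)" by (simp add: u_def)
    then show ?thesis using ln_square_le[OF True] by simp
  next
    case False
    then have "ln (cmod (\<phi> z) / Suc N) \<le> 0"
      by (cases "\<phi> z = 0") (simp_all add: ln_le_zero_iff)
    then have "u N z = 0" by (simp add: u_def)
    then show ?thesis by simp
  qed
  have u2: "integrable circle_measure (\<lambda>z. (u N z)\<^sup>2)" for N
  proof (rule Bochner_Integration.integrable_bound)
    show "integrable circle_measure (\<lambda>z. 4 * (cmod (\<phi> z) / Suc N))" using \<phi> by simp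
    show "AE z in circle_measure. norm ((u N z)\<^sup>2) \<le> norm (4 * (cmod (\<phi> z) / Suc N))"
      using usq[of N] by (intro AE_I2) (simp add: order_trans[OF _ abs_ge_self])
  qed measurable
  have "\<exists>h. log_outer (u N) h" for N by (rule log_outer_exists[OF um u2 u0])
  then obtain h where h: "\<And>N. log_outer (u N) (h N)" by metis
  note hm[measurable] = log_outerD(1)[OF h]
  have h2: "(LINT z|circle_measure. norm ((cmod (h N z))\<^sup>2)) \<le> (16 * (LINT z|circle_measure. cmod (\<phi> z))) * inverse (real (Suc N))" for N
  proof -
    have "(LINT z|circle_measure. (u N z)\<^sup>2) \<le> (LINT z|circle_measure. 4 * (cmod (\<phi> z) / Suc N))"
      by (rule integral_mono[OF u2]) (use \<phi> usq in auto)
    also have "\<dots> = 4 * (LINT z|circle_measure. cmod (\<phi> z)) * inverse (real (Suc N))"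
      by (simp add: divide_inverse)
    finally show ?thesis using log_outerD(4)[OF h, of N] by simp
  qed
  \<comment> \<open>The exponents \<open>h N\<close> inherit the L2 decay of \<open>u N\<close>;
    along a subsequence the multipliers tend to 1 almost everywhere.\<close>
  have "(\<lambda>N. (LINT z|circle_measure. norm ((cmod (h N z))\<^sup>2))) \<longlonglongrightarrow> 0"
  proof (rule Lim_null_comparison)
    show "\<forall>\<^sub>F N in sequentially. norm (LINT z|circle_measure. norm ((cmod (h N z))\<^sup>2)) \<le> (16 * (LINT z|circle_measure. cmod (\<phi> z))) * inverse (real (Suc N))"
      using h2 by (intro always_eventually) simp
    show "(\<lambda>N. (16 * (LINT z|circle_measure. cmod (\<phi> z))) * inverse (real (Suc N))) \<longlonglongrightarrow> 0"
      by (rule tendsto_mult_right_zero[OF LIMSEQ_inverse_real_of_nat])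
  qed
  from tendsto_L1_AE_subseq[OF log_outerD(3)[OF h] this]
  obtain k where k: "strict_mono k" "AE z in circle_measure. (\<lambda>n. (cmod (h (k n) z))\<^sup>2) \<longlonglongrightarrow> 0" by blast
  \<comment> \<open>The factor \<open>complex_of_real 1\<close> is the value \<open>s = 1\<close> in
    \<open>analytic_L1_mult_log_outer\<close>, kept in the syntactic form of that lemma.\<close>
  define b where "b n z = \<phi> z * exp (complex_of_real 1 * h (k n) z)" for n z
  have bm[measurable]: "b n \<in> borel_measurable circle_measure" for n unfolding b_def by measurable
  have exp1: "AE z in circle_measure. cmod (exp (complex_of_real 1 * h (k n) z)) \<le> 1" for n
    using log_outerD(2)[OF h, of "k n"] by eventually_elim (simp add: u0)
  have ab: "analytic_L1 (b n)" for n
    unfolding b_def by (rule analytic_L1_mult_log_outer[OF a h]) (auto intro!: integrable_mult_bounded[OF \<phi> _ exp1] simp del: of_real_1)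
  have bb: "AE z in circle_measure. cmod (b n z) \<le> Suc (k n)" for n
    using log_outerD(2)[OF h, of "k n"]
  proof eventually_elim
    case (elim z)
    have "cmod (b n z) = cmod (\<phi> z) * exp (u (k n) z)" using elim by (simp add: b_def norm_mult)
    also have "\<dots> \<le> Suc (k n)"
    proof (cases "cmod (\<phi> z) / Suc (k n) \<ge> 1")
      case True
      define t where "t = cmod (\<phi> z) / Suc (k n)"
      have t: "t \<ge> 1" using True unfolding t_def .
      then have "exp (u (k n) z) = inverse t" unfolding u_def t_def[symmetric] by (simp add: exp_minus)
      moreover have "cmod (\<phi> z) = t * Suc (k n)" by (simp add: t_def)
      ultimately show ?thesis using t by simp
    next
      case False
      then have "cmod (\<phi> z) \<le> Suc (k n)" by (simp add: field_simps)
      moreover have "cmod (\<phi> z) * exp (u (k n) z) \<le> cmod (\<phi> z) * 1" using u0 by (intro mult_left_mono) auto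
      ultimately show ?thesis by simp
    qed
    finally show ?case .
  qed
  have dom: "AE z in circle_measure. norm (cmod (\<phi> z - b n z) powr r) \<le> 2 powr r * (2 * cmod (\<phi> z) powr r)" for n
    using exp1[of n]
  proof eventually_elim
    case (elim z)
    have "cmod (b n z) \<le> cmod (\<phi> z) * 1" unfolding b_def norm_mult using elim by (intro mult_left_mono) auto
    then have "cmod (- b n z) powr r \<le> cmod (\<phi> z) powr r" using r by (intro powr_mono2) auto
    then have "cmod (\<phi> z) powr r + cmod (- b n z) powr r \<le> 2 * cmod (\<phi> z) powr r" by simp
    then have "2 powr r * (cmod (\<phi> z) powr r + cmod (- b n z) powr r) \<le> 2 powr r * (2 * cmod (\<phi> z) powr r)"
      by (intro mult_left_mono) auto
    then have "cmod (\<phi> z + - b n z) powr r \<le> 2 powr r * (2 * cmod (\<phi> z) powr r)"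
      by (rule order_trans[OF powr_cmod_add_le[OF r]])
    then show ?case by simp
  qed
  have iw: "integrable circle_measure (\<lambda>z. 2 powr r * (2 * cmod (\<phi> z) powr r))" using ir by simp
  have ib: "integrable circle_measure (\<lambda>z. cmod (\<phi> z - b n z) powr r)" for n
  proof (rule Bochner_Integration.integrable_bound[OF iw])
    show "AE z in circle_measure. norm (cmod (\<phi> z - b n z) powr r) \<le> norm (2 powr r * (2 * cmod (\<phi> z) powr r))"
      using dom[of n] by eventually_elim simp
  qed measurable
  have "(\<lambda>n. LINT z|circle_measure. cmod (\<phi> z - b n z) powr r) \<longlonglongrightarrow> (LINT z|circle_measure. 0)"
  proof (rule integral_dominated_convergence[OF _ _ iw _ dom])
    show "AE z in circle_measure. (\<lambda>n. cmod (\<phi> z - b n z) powr r) \<longlonglongrightarrow> 0"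
      using k(2)
    proof eventually_elim
      case (elim z)
      then have "(\<lambda>n. sqrt ((cmod (h (k n) z))\<^sup>2)) \<longlonglongrightarrow> sqrt 0" by (intro tendsto_intros)
      then have "(\<lambda>n. h (k n) z) \<longlonglongrightarrow> 0" by (simp add: tendsto_norm_zero_iff)
      then have "(\<lambda>n. cmod (\<phi> z - \<phi> z * exp (complex_of_real 1 * h (k n) z))) \<longlonglongrightarrow> cmod (\<phi> z - \<phi> z * exp (complex_of_real 1 * 0))"
        by (intro tendsto_intros)
      then have "(\<lambda>n. cmod (\<phi> z - b n z)) \<longlonglongrightarrow> 0" by (simp add: b_def)
      then show ?case using r by (intro tendsto_zero_powrI[OF _ tendsto_const]) auto
    qed
  qed measurable
  then have "(\<lambda>n. LINT z|circle_measure. cmod (\<phi> z - b n z) powr r) \<longlonglongrightarrow> 0" by simp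
  then have "\<forall>\<^sub>F n in sequentially. (LINT z|circle_measure. cmod (\<phi> z - b n z) powr r) < e"
    by (rule order_tendstoD) (rule e)
  then obtain n where n: "(LINT z|circle_measure. cmod (\<phi> z - b n z) powr r) < e"
    unfolding eventually_sequentially by blast
  show ?thesis by (rule that[OF bm bb ab ib n])
qed

text \<open>A polynomial close to \<open>f\<close> is nearly orthogonal to \<open>\<phi>\<close>,
  since \<open>f\<close> is orthogonal. Subtracting a small multiple of one fixed polynomial
  \<open>f0\<close> that is not orthogonal to \<open>\<phi>\<close> restores orthogonality
  exactly.\<close>

lemma analytic_L2_orthogonal_poly_dense:
  assumes \<phi>m[measurable]: "\<phi> \<in> borel_measurable circle_measure" and \<phi>2: "integrable circle_measure (\<lambda>z. (cmod (\<phi> z))\<^sup>2)"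
    and a: "analytic_L1 \<phi>" and nz: "(LINT z|circle_measure. (cmod (\<phi> z))\<^sup>2) > 0"
    and fm[measurable]: "f \<in> borel_measurable circle_measure" and f2: "integrable circle_measure (\<lambda>z. (cmod (f z))\<^sup>2)"
    and af: "analytic_L1 f" and o: "(LINT z|circle_measure. f z * cnj (\<phi> z)) = 0" and e: "e > 0"
  obtains q where "(LINT z|circle_measure. poly q z * cnj (\<phi> z)) = 0" "(LINT z|circle_measure. (cmod (f z - poly q z))\<^sup>2) < e"
proof -
  define b where "b = (LINT z|circle_measure. (cmod (\<phi> z))\<^sup>2)"
  have b: "b > 0" using nz by (simp add: b_def)
  have cm[measurable]: "(\<lambda>z. cnj (\<phi> z)) \<in> borel_measurable circle_measure"
    by (intro measurable_compose[OF \<phi>m] borel_measurable_continuous_onI continuous_intros)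
  have c2: "integrable circle_measure (\<lambda>z. (cmod (cnj (\<phi> z)))\<^sup>2)" using \<phi>2 by simp
  have ip: "integrable circle_measure (\<lambda>z. g z * cnj (\<phi> z))" if "g \<in> borel_measurable circle_measure" "integrable circle_measure (\<lambda>z. (cmod (g z))\<^sup>2)" for g
    by (rule square_integrable_mult_integrable_complex[OF that(1) cm that(2) c2])
  have d2: "integrable circle_measure (\<lambda>z. (cmod (poly q z - g z))\<^sup>2)" if "g \<in> borel_measurable circle_measure" "integrable circle_measure (\<lambda>z. (cmod (g z))\<^sup>2)" for g q
    using integrable_square_add(1)[of "poly q" circle_measure "\<lambda>z. - g z"] that integrable_poly_square(1)[of q] by simp
  have CS: "(cmod ((LINT z|circle_measure. poly q z * cnj (\<phi> z)) - (LINT z|circle_measure. g z * cnj (\<phi> z))))\<^sup>2 \<le>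
     (LINT z|circle_measure. (cmod (g z - poly q z))\<^sup>2) * b"
    if g: "g \<in> borel_measurable circle_measure" "integrable circle_measure (\<lambda>z. (cmod (g z))\<^sup>2)" for g q
  proof -
    have "(LINT z|circle_measure. poly q z * cnj (\<phi> z)) - (LINT z|circle_measure. g z * cnj (\<phi> z)) =
      (LINT z|circle_measure. poly q z * cnj (\<phi> z) - g z * cnj (\<phi> z))"
      by (rule Bochner_Integration.integral_diff[symmetric]; rule ip) (use g integrable_poly_square(1) in auto)
    also have "\<dots> = (LINT z|circle_measure. (poly q z - g z) * cnj (\<phi> z))" by (simp only: left_diff_distrib)
    finally show ?thesis
      using integral_Cauchy_Schwarz_complex[of "\<lambda>z. poly q z - g z" circle_measure "\<lambda>z. cnj (\<phi> z)"] d2[OF g, of q] c2 g(1)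
      by (simp add: b_def norm_minus_commute)
  qed
  \<comment> \<open>A polynomial closer to \<open>\<phi>\<close> than the L2 norm of
    \<open>\<phi>\<close> cannot be orthogonal to \<open>\<phi>\<close>.\<close>
  obtain f0 where f0: "(LINT z|circle_measure. (cmod (\<phi> z - poly f0 z))\<^sup>2) < b"
    by (rule analytic_L2_poly_dense[OF \<phi>m \<phi>2 a b])
  define \<eta> where "\<eta> = (LINT z|circle_measure. poly f0 z * cnj (\<phi> z))"
  have \<eta>: "\<eta> \<noteq> 0"
  proof
    assume "\<eta> = 0"
    have "(LINT z|circle_measure. \<phi> z * cnj (\<phi> z)) = (LINT z|circle_measure. complex_of_real ((cmod (\<phi> z))\<^sup>2))"
      by (simp only: complex_norm_square)
    also have "\<dots> = complex_of_real b" unfolding b_def by (rule integral_complex_of_real)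
    finally have "b\<^sup>2 \<le> (LINT z|circle_measure. (cmod (\<phi> z - poly f0 z))\<^sup>2) * b"
      using CS[OF \<phi>m \<phi>2, of f0] \<open>\<eta> = 0\<close> by (simp add: \<eta>_def)
    also have "\<dots> < b * b" using f0 b by (rule mult_strict_right_mono)
    finally show False by (simp add: power2_eq_square)
  qed
  define T where "T = (LINT z|circle_measure. (cmod (poly f0 z))\<^sup>2)"
  have T: "T \<ge> 0" by (simp add: T_def)
  \<comment> \<open>The correction by \<open>f0\<close> multiplies the squared error
    \<open>x\<close> by at most \<open>2 * L\<close>.\<close>
  define L where "L = 1 + b * T / (cmod \<eta>)\<^sup>2"
  have L: "L > 0" using b T by (simp add: L_def add_pos_nonneg)
  obtain q1 where q1: "(LINT z|circle_measure. (cmod (f z - poly q1 z))\<^sup>2) < e / (2 * L)"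
    by (rule analytic_L2_poly_dense[OF fm f2 af, of "e / (2 * L)"]) (use e L in auto)
  define x where "x = (LINT z|circle_measure. (cmod (f z - poly q1 z))\<^sup>2)"
  define c where "c = (LINT z|circle_measure. poly q1 z * cnj (\<phi> z)) / \<eta>"
  have c: "(cmod c)\<^sup>2 \<le> x * b / (cmod \<eta>)\<^sup>2"
    using CS[OF fm f2, of q1] by (simp add: o c_def x_def norm_divide power_divide divide_right_mono)
  show ?thesis
  proof (rule that[of "q1 - smult c f0"])
    have "(LINT z|circle_measure. poly (q1 - smult c f0) z * cnj (\<phi> z)) =
      (LINT z|circle_measure. poly q1 z * cnj (\<phi> z) - c * (poly f0 z * cnj (\<phi> z)))"
      by (simp add: left_diff_distrib mult.assoc)
    also have "\<dots> = (LINT z|circle_measure. poly q1 z * cnj (\<phi> z)) - (LINT z|circle_measure. c * (poly f0 z * cnj (\<phi> z)))"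
      by (rule Bochner_Integration.integral_diff; (rule integrable_mult_right)?; rule ip) (use integrable_poly_square(1) in auto)
    also have "\<dots> = 0" using \<eta> by (simp add: c_def \<eta>_def[symmetric])
    finally show "(LINT z|circle_measure. poly (q1 - smult c f0) z * cnj (\<phi> z)) = 0" .
    have fq: "integrable circle_measure (\<lambda>z. (cmod (f z - poly q1 z))\<^sup>2)"
      using d2[OF fm f2, of q1] by (simp add: norm_minus_commute)
    have "(LINT z|circle_measure. (cmod (f z - poly (q1 - smult c f0) z))\<^sup>2) = (LINT z|circle_measure. (cmod ((f z - poly q1 z) + poly (smult c f0) z))\<^sup>2)"
      by (simp add: algebra_simps)
    also have "\<dots> \<le> 2 * x + 2 * (LINT z|circle_measure. (cmod (poly (smult c f0) z))\<^sup>2)"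
      unfolding x_def by (rule integrable_square_add(2)[OF _ _ fq integrable_poly_square(1)]) measurable
    also have "(LINT z|circle_measure. (cmod (poly (smult c f0) z))\<^sup>2) = (cmod c)\<^sup>2 * T"
      by (simp add: T_def norm_mult power_mult_distrib)
    also have "2 * x + 2 * ((cmod c)\<^sup>2 * T) \<le> 2 * x + 2 * (x * b / (cmod \<eta>)\<^sup>2 * T)"
      using mult_right_mono[OF c T] by simp
    also have "\<dots> = 2 * L * x" by (simp add: L_def algebra_simps)
    also have "\<dots> < e" using q1 L by (simp add: x_def[symmetric] field_simps)
    finally show "(LINT z|circle_measure. (cmod (f z - poly (q1 - smult c f0) z))\<^sup>2) < e" .
  qed
qed

text \<open>If \<open>\<bar>\<phi>\<bar>\<close> stays away from its supremum on a set \<open>A\<close>, multiply \<open>\<phi>\<close> by an outer function that has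
  modulus one off \<open>A\<close> and is slightly larger on \<open>A\<close>: the supremum does not grow, but the pairing with
  \<open>\<phi>\<close> does, so there is room for shrinking.\<close>

lemma sup_norm_decreasing_perturbation:
  assumes a: "analytic_L1 \<phi>" and M: "M > 0" and \<phi>M: "AE z in circle_measure. cmod (\<phi> z) \<le> M"
    and nz: "AE z in circle_measure. \<phi> z \<noteq> 0" and nc: "\<not> (AE z in circle_measure. cmod (\<phi> z) = M)"
  obtains f M' where "f \<in> borel_measurable circle_measure" "AE z in circle_measure. cmod (f z) \<le> 2 * M" "analytic_L1 f"
    "(LINT z|circle_measure. f z * cnj (\<phi> z)) = 0" "0 \<le> M'" "M' < M" "AE z in circle_measure. cmod (\<phi> z + f z) \<le> M'"
proof -
  have \<phi>: "integrable circle_measure \<phi>" using a by (simp add: analytic_L1_def)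
  then have \<phi>m[measurable]: "\<phi> \<in> borel_measurable circle_measure" by simp
  \<comment> \<open>Countably many thresholds let the almost everywhere quantifier commute with the
    limit. The shift by 2 keeps \<open>\<delta>\<close> positive and below 1.\<close>
  have "\<exists>n. \<not> (AE z in circle_measure. cmod (\<phi> z) \<ge> (1 - 1 / real (n + 2)) * M)"
  proof (rule ccontr)
    assume "\<not> ?thesis"
    then have "AE z in circle_measure. \<forall>n. cmod (\<phi> z) \<ge> (1 - 1 / real (n + 2)) * M"
      by (simp add: AE_all_countable)
    with \<phi>M have "AE z in circle_measure. cmod (\<phi> z) = M"
    proof eventually_elim
      case (elim z)
      have "(\<lambda>n. (1 - 1 / real (n + 2)) * M) \<longlonglongrightarrow> (1 - 0) * M"
        by (intro tendsto_intros LIMSEQ_ignore_initial_segment[OF lim_1_over_n])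
      then have "(1 - 0) * M \<le> cmod (\<phi> z)" by (rule LIMSEQ_le_const2) (use elim in blast)
      then show ?case using elim by simp
    qed
    then show False using nc by blast
  qed
  then obtain n where n: "\<not> (AE z in circle_measure. cmod (\<phi> z) \<ge> (1 - 1 / real (n + 2)) * M)" by blast
  define \<delta> where "\<delta> = 1 / real (n + 2)"
  have \<delta>: "0 < \<delta>" "\<delta> < 1" by (auto simp: \<delta>_def)
  have n\<delta>: "\<not> (AE z in circle_measure. cmod (\<phi> z) \<ge> (1 - \<delta>) * M)"
    using n unfolding \<delta>_def .
  define A where "A = {z \<in> space circle_measure. cmod (\<phi> z) < (1 - \<delta>) * M}"
  have Am[measurable]: "A \<in> sets circle_measure" unfolding A_def by measurable
  define w where "w z = (cmod (\<phi> z))\<^sup>2" for z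
  have [measurable]: "w \<in> borel_measurable circle_measure" unfolding w_def by measurable
  have wM: "AE z in circle_measure. w z \<le> M\<^sup>2"
    using \<phi>M by eventually_elim (simp add: w_def power_mono)
  have w0: "w z \<ge> 0" for z by (simp add: w_def)
  have wi: "integrable circle_measure w"
    by (rule circle.integrable_const_bound[where B="M\<^sup>2"]) (use wM w0 in auto)
  define u :: "complex \<Rightarrow> real" where "u = indicator A"
  have um[measurable]: "u \<in> borel_measurable circle_measure" unfolding u_def by measurable
  have u01: "0 \<le> u z" "u z \<le> 1" for z by (auto simp: u_def indicator_def)
  have u2: "integrable circle_measure (\<lambda>z. (u z)\<^sup>2)"
    by (rule integrable_circle_bounded[where B=1]) (use u01 in \<open>auto simp: abs_square_le_1\<close>)
  have wui: "integrable circle_measure (\<lambda>z. w z * u z)"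
    by (rule Bochner_Integration.integrable_bound[OF wi]) (use u01 w0 in \<open>auto intro!: mult_left_le\<close>)
  define \<omega> where "\<omega> = (LINT z|circle_measure. w z * u z)"
  have \<omega>: "\<omega> > 0"
  proof -
    have "\<omega> \<noteq> 0"
    proof
      assume "\<omega> = 0"
      then have "AE z in circle_measure. w z * u z = 0"
        using wui u01 w0 unfolding \<omega>_def by (subst (asm) integral_nonneg_eq_0_iff_AE) auto
      with nz have "AE z in circle_measure. u z = 0" by eventually_elim (simp add: w_def)
      with AE_space have "AE z in circle_measure. cmod (\<phi> z) \<ge> (1 - \<delta>) * M"
        by eventually_elim (auto simp: u_def A_def indicator_def split: if_splits)
      then show False using n\<delta> by blast
    qed
    moreover have "\<omega> \<ge> 0" unfolding \<omega>_def using u01 w0 by simp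
    ultimately show ?thesis by simp
  qed
  obtain h where h: "log_outer u h" using log_outer_exists[OF um u2 u01(2)] by blast
  note hm[measurable] = log_outerD(1)[OF h]
  define V where "V = (LINT z|circle_measure. (cmod (h z))\<^sup>2)"
  \<comment> \<open>The second-order loss in \<open>Re J\<close>: the cosine costs
    \<open>(s * Im h)^2 / 2\<close>, the factor \<open>exp (s * u)\<close> is at most
    \<open>exp 1\<close>, and \<open>|\<phi>|^2\<close> is at most \<open>M^2\<close>.\<close>
  define H where "H = exp 1 / 2 * M\<^sup>2 * V"
  have H: "H \<ge> 0" by (simp add: H_def V_def)
  \<comment> \<open>\<open>s \<le> \<delta>\<close> keeps the product below \<open>M\<close> on
    \<open>A\<close>, as \<open>exp \<delta> \<le> 1 / (1 - \<delta>)\<close>. The other bound makes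
    the gain \<open>s * \<omega>\<close> exceed the loss \<open>s^2 * H\<close>.\<close>
  define s where "s = min \<delta> (\<omega> / (H + 1))"
  have s: "0 < s" "s \<le> \<delta>" using \<delta> \<omega> H by (auto simp: s_def)
  have sH: "s * H < \<omega>"
  proof -
    have "s * H < s * (H + 1)" using s by simp
    also have "\<dots> \<le> \<omega> / (H + 1) * (H + 1)" using H by (intro mult_right_mono) (auto simp: s_def)
    also have "\<dots> = \<omega>" using H by simp
    finally show ?thesis .
  qed
  have s1: "s \<le> 1" using s \<delta> by simp
  define g where "g z = exp (complex_of_real s * h z)" for z
  have gm[measurable]: "g \<in> borel_measurable circle_measure" unfolding g_def by measurable
  have gmod: "AE z in circle_measure. cmod (g z) = exp (s * u z)"
    using log_outerD(2)[OF h] by eventually_elim (simp add: g_def)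
  have gb: "AE z in circle_measure. cmod (g z) \<le> exp 1"
    using gmod
  proof eventually_elim
    case (elim z)
    have "s * u z \<le> 1 * 1" using u01 s s1 by (intro mult_mono) auto
    then show ?case using elim by simp
  qed
  have \<phi>g: "AE z in circle_measure. cmod (\<phi> z * g z) \<le> M"
    using gmod \<phi>M AE_space
  proof eventually_elim
    case (elim z)
    show ?case
    proof (cases "z \<in> A")
      case True
      have "exp s \<le> exp \<delta>" using s by simp
      also have "\<dots> \<le> 1 / (1 - \<delta>)"
        using exp_ge_add_one_self[of "- \<delta>"] \<delta> by (simp add: exp_minus field_simps)
      finally have "cmod (\<phi> z) * exp s \<le> ((1 - \<delta>) * M) * (1 / (1 - \<delta>))"
        using True M \<delta> by (intro mult_mono) (auto simp: A_def)
      then show ?thesis using elim True \<delta> by (simp add: norm_mult u_def)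
    qed (use elim in \<open>simp add: norm_mult u_def\<close>)
  qed
  have \<phi>gi: "integrable circle_measure (\<lambda>z. \<phi> z * g z)" by (rule integrable_mult_bounded[OF \<phi> gm gb])
  have \<phi>ga: "analytic_L1 (\<lambda>z. \<phi> z * g z)"
    using analytic_L1_mult_log_outer[OF a h, of s] s \<phi>gi by (simp add: g_def)
  define b where "b = (LINT z|circle_measure. w z)"
  define J where "J = (LINT z|circle_measure. complex_of_real (w z) * g z)"
  have wc: "integrable circle_measure (\<lambda>z. complex_of_real (w z))" using wi by simp
  have wg: "integrable circle_measure (\<lambda>z. complex_of_real (w z) * g z)" by (rule integrable_mult_bounded[OF wc gm gb])
  have iV: "integrable circle_measure (\<lambda>z. (cmod (h z))\<^sup>2)" by (rule log_outerD(3)[OF h])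
  have b0: "b \<ge> 0" unfolding b_def using w0 by simp
  have ReJ: "b + s * \<omega> - s\<^sup>2 * H \<le> Re J"
  proof -
    have "b + s * \<omega> - s\<^sup>2 * H = (LINT z|circle_measure. w z + s * (w z * u z) - s\<^sup>2 * (exp 1 / 2 * M\<^sup>2 * (cmod (h z))\<^sup>2))"
      using wi wui iV by (simp add: b_def \<omega>_def H_def V_def)
    also have "\<dots> \<le> (LINT z|circle_measure. Re (complex_of_real (w z) * g z))"
    proof (rule integral_mono_AE)
      show "integrable circle_measure (\<lambda>z. Re (complex_of_real (w z) * g z))" using integrable_Re[OF wg] .
      show "AE z in circle_measure. w z + s * (w z * u z) - s\<^sup>2 * (exp 1 / 2 * M\<^sup>2 * (cmod (h z))\<^sup>2) \<le> Re (complex_of_real (w z) * g z)"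
        using log_outerD(2)[OF h] wM
      proof eventually_elim
        case (elim z)
        define v where "v = Im (h z)"
        have Reg: "Re (g z) = exp (s * u z) * cos (s * v)" using elim by (simp add: g_def Re_exp v_def)
        have cos: "1 - (s * v)\<^sup>2 / 2 \<le> cos (s * v)"
        proof -
          have "\<bar>sin (s * v / 2)\<bar> \<le> \<bar>s * v / 2\<bar>" by (rule abs_sin_x_le_abs_x)
          then have "(sin (s * v / 2))\<^sup>2 \<le> (s * v / 2)\<^sup>2" by (simp only: abs_le_square_iff)
          moreover have "cos (s * v) = 1 - 2 * (sin (s * v / 2))\<^sup>2" using cos_double_sin[of "s * v / 2"] by simp
          ultimately show ?thesis by (simp add: power_divide)
        qed
        have e1: "exp (s * u z) \<le> exp 1" using mult_mono[of s 1 "u z" 1] u01 s s1 by simp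
        have "exp (s * u z) * ((s * v)\<^sup>2 / 2) \<le> exp 1 * (s\<^sup>2 * (cmod (h z))\<^sup>2 / 2)"
        proof (rule mult_mono[OF e1])
          have "v\<^sup>2 \<le> (cmod (h z))\<^sup>2" by (simp add: v_def cmod_power2)
          then have "s\<^sup>2 * v\<^sup>2 \<le> s\<^sup>2 * (cmod (h z))\<^sup>2" by (rule mult_left_mono) simp
          then show "(s * v)\<^sup>2 / 2 \<le> s\<^sup>2 * (cmod (h z))\<^sup>2 / 2" by (simp add: power_mult_distrib)
        qed auto
        moreover have "1 + s * u z \<le> exp (s * u z)" by (rule exp_ge_add_one_self)
        moreover have "exp (s * u z) * (1 - (s * v)\<^sup>2 / 2) \<le> Re (g z)"
          unfolding Reg using cos by (intro mult_left_mono) auto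
        moreover have "exp (s * u z) * (1 - (s * v)\<^sup>2 / 2) = exp (s * u z) - exp (s * u z) * ((s * v)\<^sup>2 / 2)"
          by (simp only: right_diff_distrib mult_1_right)
        moreover define Y where "Y = exp 1 * (s\<^sup>2 * (cmod (h z))\<^sup>2 / 2)"
        ultimately have "1 + s * u z - Y \<le> Re (g z)" by linarith
        then have "w z * (1 + s * u z - Y) \<le> w z * Re (g z)"
          using w0 by (rule mult_left_mono)
        moreover have "w z * Y \<le> M\<^sup>2 * Y" using elim by (intro mult_right_mono) (auto simp: Y_def)
        moreover have "w z * (1 + s * u z - Y) = w z + s * (w z * u z) - w z * Y" by (simp add: algebra_simps)
        moreover have "s\<^sup>2 * (exp 1 / 2 * M\<^sup>2 * (cmod (h z))\<^sup>2) = M\<^sup>2 * Y" by (simp add: Y_def)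
        moreover have "Re (complex_of_real (w z) * g z) = w z * Re (g z)" by simp
        ultimately show ?case by linarith
      qed
    qed (use wi wui iV in simp)
    also have "\<dots> = Re J" unfolding J_def by (rule integral_Re[OF wg])
    finally show ?thesis .
  qed
  have "s * (s * H) < s * \<omega>" using sH s by (intro mult_strict_left_mono) auto
  then have "b < Re J" using ReJ by (simp add: power2_eq_square)
  then have bJ: "b < cmod J" using complex_Re_le_cmod[of J] by linarith
  then have J0: "J \<noteq> 0" using b0 by auto
  \<comment> \<open>Orthogonality forces this factor, and \<open>b < cmod J\<close> makes it shrink
    the sup norm strictly.\<close>
  define \<kappa> where "\<kappa> = complex_of_real b / J"
  have \<kappa>1: "cmod \<kappa> < 1" using bJ b0 J0 by (simp add: \<kappa>_def norm_divide)
  show ?thesis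
  proof (rule that[of "\<lambda>z. \<kappa> * (\<phi> z * g z) - \<phi> z" "cmod \<kappa> * M"])
    show "(\<lambda>z. \<kappa> * (\<phi> z * g z) - \<phi> z) \<in> borel_measurable circle_measure" by measurable
    show "AE z in circle_measure. cmod (\<kappa> * (\<phi> z * g z) - \<phi> z) \<le> 2 * M"
      using \<phi>g \<phi>M
    proof eventually_elim
      case (elim z)
      have "cmod (\<kappa> * (\<phi> z * g z)) \<le> 1 * M" unfolding norm_mult[of \<kappa>] using elim \<kappa>1 by (intro mult_mono) auto
      then show ?case using norm_triangle_ineq4[of "\<kappa> * (\<phi> z * g z)" "\<phi> z"] elim by linarith
    qed
    show "analytic_L1 (\<lambda>z. \<kappa> * (\<phi> z * g z) - \<phi> z)"
      by (intro analytic_L1_diff analytic_L1_cmult \<phi>ga a)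
    have "(LINT z|circle_measure. (\<kappa> * (\<phi> z * g z) - \<phi> z) * cnj (\<phi> z)) =
       (LINT z|circle_measure. \<kappa> * (complex_of_real (w z) * g z) - complex_of_real (w z))"
    proof (rule Bochner_Integration.integral_cong[OF refl])
      fix z
      have "complex_of_real (w z) = \<phi> z * cnj (\<phi> z)" unfolding w_def by (rule complex_norm_square)
      then show "(\<kappa> * (\<phi> z * g z) - \<phi> z) * cnj (\<phi> z) = \<kappa> * (complex_of_real (w z) * g z) - complex_of_real (w z)"
        by (simp add: algebra_simps)
    qed
    also have "\<dots> = \<kappa> * J - b" using wg wc wi by (simp add: J_def b_def)
    also have "\<dots> = 0" using J0 by (simp add: \<kappa>_def)
    finally show "(LINT z|circle_measure. (\<kappa> * (\<phi> z * g z) - \<phi> z) * cnj (\<phi> z)) = 0" .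
    show "0 \<le> cmod \<kappa> * M" "cmod \<kappa> * M < M" using \<kappa>1 M by auto
    show "AE z in circle_measure. cmod (\<phi> z + (\<kappa> * (\<phi> z * g z) - \<phi> z)) \<le> cmod \<kappa> * M"
      using \<phi>g by eventually_elim (simp add: norm_mult[of \<kappa>] mult_left_mono)
  qed
qed

text \<open>On the circle the conjugate of a negative power is a positive power. Index
  \<open>- (n + 1)\<close> corresponds to the test polynomial \<open>z * z ^ n\<close>, and
  linearity covers the rest.\<close>

lemma fourier_coeff_negative_iff:
  assumes f: "integrable circle_measure f"
  shows "(\<forall>\<alpha><0. fourier_coeff f \<alpha> = 0) \<longleftrightarrow> analytic_L1 f"
proof -
  have c: "fourier_coeff f (- int (Suc n)) = (LINT z|circle_measure. f z * (z * z ^ n))" for n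
    unfolding fourier_coeff_def
  proof (rule Bochner_Integration.integral_cong[OF refl])
    fix z assume "z \<in> space circle_measure"
    then have "z * cnj z = 1" by (simp add: complex_norm_square[symmetric])
    then have "inverse (cnj z) = z" by (metis inverse_unique mult.commute)
    then have "cnj (z powi (- int (Suc n))) = z ^ Suc n"
      unfolding power_int_minus power_int_of_nat complex_cnj_inverse complex_cnj_power by (simp only: power_inverse[symmetric])
    then show "f z * cnj (z powi (- int (Suc n))) = f z * (z * z ^ n)" by simp
  qed
  show ?thesis
  proof
    assume z: "\<forall>\<alpha><0. fourier_coeff f \<alpha> = 0"
    have "(LINT z|circle_measure. f z * (z * poly q z)) = 0" for q
    proof -
      have "(LINT z|circle_measure. f z * (z * poly q z)) = (LINT z|circle_measure. (\<Sum>i\<le>degree q. coeff q i * (f z * (z * z ^ i))))"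
        by (rule Bochner_Integration.integral_cong) (auto simp: poly_altdef sum_distrib_left algebra_simps)
      also have "\<dots> = (\<Sum>i\<le>degree q. (LINT z|circle_measure. coeff q i * (f z * (z * z ^ i))))"
        by (rule Bochner_Integration.integral_sum) (intro integrable_mult_right integrable_mult_continuous f continuous_intros)
      also have "\<dots> = 0" using z by (simp add: c[symmetric])
      finally show ?thesis .
    qed
    then show "analytic_L1 f" using f by (simp add: analytic_L1_def)
  next
    assume a: "analytic_L1 f"
    show "\<forall>\<alpha><0. fourier_coeff f \<alpha> = 0"
    proof (intro allI impI)
      fix \<alpha> :: int assume "\<alpha> < 0"
      then obtain n where n: "\<alpha> = - int (Suc n)" by (metis neg_int_cases Suc_pred)
      have "(LINT z|circle_measure. f z * (z * poly (monom 1 n) z)) = 0" using a unfolding analytic_L1_def by blast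
      then show "fourier_coeff f \<alpha> = 0" unfolding n c by (simp add: poly_monom)
    qed
  qed
qed

subsection \<open>Hilbert points\<close>

lemma Lp_ennreal:
  assumes "1 \<le> r"
  shows "f \<in> Lp (ennreal r) \<longleftrightarrow> f \<in> borel_measurable circle_measure \<and> integrable circle_measure (\<lambda>z. cmod (f z) powr r)"
    and "Lp_norm (ennreal r) f = (LINT z|circle_measure. cmod (f z) powr r) powr (1 / r)"
  using assms by (auto simp: Lp_def Lp_norm_def)

lemma Lp_infinity_bound:
  assumes "f \<in> Lp \<infinity>"
  shows "f \<in> borel_measurable circle_measure" "AE z in circle_measure. cmod (f z) \<le> Lp_norm \<infinity> f"
proof -
  show "f \<in> borel_measurable circle_measure" using assms by (simp add: Lp_def)
  have fin: "esssup circle_measure (\<lambda>z. ennreal (cmod (f z))) < \<infinity>" using assms by (simp add: Lp_def)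
  have "AE z in circle_measure. ennreal (cmod (f z)) \<le> esssup circle_measure (\<lambda>z. ennreal (cmod (f z)))"
    by (rule esssup_AE)
  then show "AE z in circle_measure. cmod (f z) \<le> Lp_norm \<infinity> f"
  proof eventually_elim
    case (elim z)
    then show ?case using fin enn2real_mono[OF elim] by (simp add: Lp_norm_def)
  qed
qed

lemma Lp_infinityI:
  assumes [measurable]: "f \<in> borel_measurable circle_measure" and b: "AE z in circle_measure. cmod (f z) \<le> B" and B: "0 \<le> B"
  shows "f \<in> Lp \<infinity>" "Lp_norm \<infinity> f \<le> B"
proof -
  have "esssup circle_measure (\<lambda>z. ennreal (cmod (f z))) \<le> ennreal B"
  proof (rule esssup_I)
    show "AE z in circle_measure. ennreal (cmod (f z)) \<le> ennreal B"
      using b by eventually_elim (rule ennreal_leI)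
  qed measurable
  then show "f \<in> Lp \<infinity>" "Lp_norm \<infinity> f \<le> B"
    using B enn2real_mono[of _ "ennreal B"] by (auto simp: Lp_def Lp_norm_def less_top[symmetric] top_unique intro: le_less_trans)
qed

lemma exponent_cases:
  fixes p :: ennreal
  assumes "1 \<le> p"
  obtains "p = \<infinity>" | r where "p = ennreal r" "1 \<le> r"
  using assms by (cases p) auto

lemma Lp_integrable:
  assumes p: "1 \<le> p" and f: "f \<in> Lp p"
  shows "integrable circle_measure f" "(LINT z|circle_measure. cmod (f z)) \<le> Lp_norm p f"
proof -
  have "integrable circle_measure f \<and> (LINT z|circle_measure. cmod (f z)) \<le> Lp_norm p f"
    using p
  proof (cases rule: exponent_cases)
    case 1
    note b = Lp_infinity_bound[OF f[unfolded 1]]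
    have i: "integrable circle_measure f"
      by (rule circle.integrable_const_bound[OF b(2,1)])
    have "(LINT z|circle_measure. cmod (f z)) \<le> (LINT z|circle_measure. Lp_norm \<infinity> f)"
      by (rule integral_mono_AE) (use i b in auto)
    then show ?thesis using i circle.prob_space by (simp add: 1)
  next
    case (2 r)
    have [measurable]: "f \<in> borel_measurable circle_measure" and fi: "integrable circle_measure (\<lambda>z. cmod (f z) powr r)"
      using f Lp_ennreal[OF 2(2)] by (auto simp: 2(1))
    have "integrable circle_measure (\<lambda>z. cmod (f z))"
      by (rule circle.power_mean(1)[OF 2(2) _ _ fi]) auto
    moreover have "(LINT z|circle_measure. cmod (f z)) \<le> Lp_norm p f"
      unfolding 2(1) Lp_ennreal(2)[OF 2(2)] by (rule circle.power_mean(2)[OF 2(2) _ _ fi]) auto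
    ultimately show ?thesis by (simp add: integrable_norm_iff)
  qed
  then show "integrable circle_measure f" "(LINT z|circle_measure. cmod (f z)) \<le> Lp_norm p f" by auto
qed

lemma Hp_iff:
  assumes "1 \<le> p"
  shows "f \<in> Hp p \<longleftrightarrow> f \<in> Lp p \<and> analytic_L1 f"
  using fourier_coeff_negative_iff[OF Lp_integrable(1)[OF assms]] by (auto simp: Hp_def)

lemma Lp_measurable: "f \<in> Lp p \<Longrightarrow> f \<in> borel_measurable circle_measure"
  by (simp add: Lp_def)

lemma Lp_add:
  assumes p: "1 \<le> p" and fg: "f \<in> Lp p" "g \<in> Lp p"
  shows "(\<lambda>z. f z + g z) \<in> Lp p"
  using p
proof (cases rule: exponent_cases)
  case 1
  note b = Lp_infinity_bound[OF fg(1)[unfolded 1]] Lp_infinity_bound[OF fg(2)[unfolded 1]]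
  note [measurable] = b(1,3)
  have "AE z in circle_measure. cmod (f z + g z) \<le> Lp_norm \<infinity> f + Lp_norm \<infinity> g"
    using b(2,4) by eventually_elim (rule norm_triangle_le, simp)
  then show ?thesis unfolding 1 by (rule Lp_infinityI(1)[rotated]) (auto simp: Lp_norm_def)
next
  case (2 r)
  have [measurable]: "f \<in> borel_measurable circle_measure" "g \<in> borel_measurable circle_measure"
    and i: "integrable circle_measure (\<lambda>z. cmod (f z) powr r)" "integrable circle_measure (\<lambda>z. cmod (g z) powr r)"
    using fg Lp_ennreal[OF 2(2)] by (auto simp: 2(1))
  have "integrable circle_measure (\<lambda>z. cmod (f z + g z) powr r)"
  proof (rule Bochner_Integration.integrable_bound)
    show "integrable circle_measure (\<lambda>z. 2 powr r * (cmod (f z) powr r + cmod (g z) powr r))" using i by simp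
    show "AE z in circle_measure. norm (cmod (f z + g z) powr r) \<le> norm (2 powr r * (cmod (f z) powr r + cmod (g z) powr r))"
    proof (rule AE_I2)
      fix z
      show "norm (cmod (f z + g z) powr r) \<le> norm (2 powr r * (cmod (f z) powr r + cmod (g z) powr r))"
        using powr_cmod_add_le[OF 2(2), of "f z" "g z"] by (simp add: abs_mult)
    qed
  qed measurable
  then show ?thesis using Lp_ennreal[OF 2(2)] by (simp add: 2(1))
qed

lemma Lp_mult_bounded:
  assumes p: "1 \<le> p" and f: "f \<in> Lp p" and gm: "g \<in> borel_measurable circle_measure"
    and g: "\<And>z. z \<in> sphere 0 1 \<Longrightarrow> cmod (g z) \<le> B"
  shows "(\<lambda>z. f z * g z) \<in> Lp p"
proof -
  note gm[measurable]
  have B: "0 \<le> B" using order_trans[OF norm_ge_zero g[of 1]] by simp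
  note [measurable] = Lp_measurable[OF f]
  show ?thesis using p
  proof (cases rule: exponent_cases)
    case 1
    note b = Lp_infinity_bound[OF f[unfolded 1]]
    have n0: "0 \<le> Lp_norm \<infinity> f" by (simp add: Lp_norm_def)
    have "AE z in circle_measure. cmod (f z * g z) \<le> Lp_norm \<infinity> f * B"
      using b(2) AE_space by eventually_elim (use g B n0 in \<open>auto simp: norm_mult intro!: mult_mono\<close>)
    then show ?thesis unfolding 1 by (rule Lp_infinityI(1)[rotated]) (use B n0 in auto)
  next
    case (2 r)
    have i: "integrable circle_measure (\<lambda>z. cmod (f z) powr r)" using f Lp_ennreal[OF 2(2)] by (auto simp: 2(1))
    have "integrable circle_measure (\<lambda>z. cmod (f z * g z) powr r)"
    proof (rule Bochner_Integration.integrable_bound)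
      show "integrable circle_measure (\<lambda>z. cmod (f z) powr r * B powr r)" using i by simp
      show "AE z in circle_measure. norm (cmod (f z * g z) powr r) \<le> norm (cmod (f z) powr r * B powr r)"
        by (rule AE_I2) (use g 2(2) in \<open>auto simp: norm_mult powr_mult intro!: mult_left_mono powr_mono2\<close>)
    qed measurable
    then show ?thesis using Lp_ennreal[OF 2(2)] by (simp add: 2(1))
  qed
qed

lemma Lp_constant_modulus:
  assumes p: "1 \<le> p" and fm: "f \<in> borel_measurable circle_measure" and c: "0 < c" and f: "AE z in circle_measure. cmod (f z) = c"
  shows "f \<in> Lp p" "Lp_norm p f \<le> c"
proof -
  note fm[measurable]
  have "f \<in> Lp p \<and> Lp_norm p f \<le> c" using p
  proof (cases rule: exponent_cases)
    case 1
    have "AE z in circle_measure. cmod (f z) \<le> c" using f by eventually_elim simp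
    then show ?thesis using Lp_infinityI[OF fm _ less_imp_le[OF c]] by (simp add: 1)
  next
    case (2 r)
    have e: "AE z in circle_measure. cmod (f z) powr r = c powr r" using f by eventually_elim simp
    have "integrable circle_measure (\<lambda>z. cmod (f z) powr r)"
      by (rule circle.integrable_const_bound[where B="c powr r"]) (use e in auto)
    moreover have "(LINT z|circle_measure. cmod (f z) powr r) = (LINT z|circle_measure. c powr r)"
      by (rule integral_cong_AE) (use e in auto)
    then have "(LINT z|circle_measure. cmod (f z) powr r) = c powr r" using circle.prob_space by simp
    ultimately show ?thesis using Lp_ennreal[OF 2(2)] 2(2) c by (simp add: 2(1) powr_powr)
  qed
  then show "f \<in> Lp p" "Lp_norm p f \<le> c" by auto
qed

lemma poly_in_Lp:
  assumes p: "1 \<le> p" shows "poly q \<in> Lp p"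
proof -
  obtain B where B: "0 \<le> B" "\<And>z. z \<in> sphere 0 1 \<Longrightarrow> norm (poly q z) \<le> B"
    by (rule continuous_on_sphere_bound[of "poly q"]) (intro continuous_intros, blast)
  have "(\<lambda>_. 1) \<in> Lp p" by (rule Lp_constant_modulus(1)[OF p, of _ 1]) auto
  from Lp_mult_bounded[OF p this measurable_poly_circle B(2)] show ?thesis by simp
qed

text \<open>The pairing with a function of constant modulus is continuous on every L^p. For
  exponents below 2 this turns membership in the closure into \<open>pairing f \<phi> = 0\<close>,
  after which one argument serves all exponents.\<close>

lemma hilbert_point_if_constant_modulus:
  assumes p: "1 \<le> p" and \<phi>H: "\<phi> \<in> Hp p" and c: "0 < c" and \<phi>c: "AE z in circle_measure. cmod (\<phi> z) = c"
  shows "hilbert_point p \<phi>"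
proof -
  have \<phi>L: "\<phi> \<in> Lp p" using \<phi>H by (simp add: Hp_iff[OF p])
  note \<phi>m[measurable] = Lp_measurable[OF \<phi>L]
  have cm[measurable]: "(\<lambda>z. cnj (\<phi> z)) \<in> borel_measurable circle_measure"
    by (intro measurable_compose[OF \<phi>m] borel_measurable_continuous_onI continuous_intros)
  have cc: "AE z in circle_measure. cmod (cnj (\<phi> z)) \<le> c" using \<phi>c by eventually_elim simp
  have le: "cmod (pairing g \<phi>) \<le> c * Lp_norm p g" if g: "g \<in> Lp p" for g
  proof -
    have gi: "integrable circle_measure g" by (rule Lp_integrable[OF p g])
    have "cmod (pairing g \<phi>) \<le> (LINT z|circle_measure. cmod (g z * cnj (\<phi> z)))"
      unfolding pairing_def by (rule integral_norm_bound)
    also have "\<dots> = (LINT z|circle_measure. c * cmod (g z))"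
    proof (rule integral_cong_AE)
      show "AE z in circle_measure. cmod (g z * cnj (\<phi> z)) = c * cmod (g z)"
        using \<phi>c by eventually_elim (simp add: norm_mult)
    qed (use gi in measurable)
    also have "\<dots> \<le> c * Lp_norm p g" using Lp_integrable(2)[OF p g] c by simp
    finally show ?thesis .
  qed
  have add: "pairing (\<lambda>z. f z + g z) \<phi> = pairing f \<phi> + pairing g \<phi>" if fg: "f \<in> Lp p" "g \<in> Lp p" for f g
  proof -
    have "integrable circle_measure (\<lambda>z. f z * cnj (\<phi> z))" "integrable circle_measure (\<lambda>z. g z * cnj (\<phi> z))"
      by (rule integrable_mult_bounded[OF Lp_integrable(1)[OF p] cm cc], rule fg)+
    then show ?thesis by (simp add: pairing_def distrib_right)
  qed
  have \<phi>\<phi>: "pairing \<phi> \<phi> = c\<^sup>2"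
  proof -
    have "pairing \<phi> \<phi> = (LINT z|circle_measure. complex_of_real (c\<^sup>2))"
      unfolding pairing_def
    proof (rule integral_cong_AE)
      show "AE z in circle_measure. \<phi> z * cnj (\<phi> z) = complex_of_real (c\<^sup>2)"
        using \<phi>c by eventually_elim (metis complex_norm_square)
    qed measurable
    then show ?thesis using circle.prob_space by simp
  qed
  have "Lp_norm p \<phi> \<le> Lp_norm p (\<lambda>z. \<phi> z + f z)" if f: "f \<in> Hp p" and o: "orthogonal_in_Hp p f \<phi>" for f
  proof -
    have fL: "f \<in> Lp p" using f by (simp add: Hp_iff[OF p])
    have "pairing f \<phi> = 0"
    proof (cases "p < 2")
      case False
      then show ?thesis using o by (simp add: orthogonal_in_Hp_def)
    next
      case True
      \<comment> \<open>The pairing of \<open>f\<close> equals that of \<open>f - q\<close> for an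
        orthogonal polynomial \<open>q\<close>, hence is at most \<open>c\<close> times an
        arbitrarily small norm.\<close>
      have "cmod (pairing f \<phi>) \<le> 0 + e" if e: "e > 0" for e
      proof -
        obtain q where q: "pairing (poly q) \<phi> = 0" "Lp_norm p (\<lambda>z. f z - poly q z) < e / c"
          using o True divide_pos_pos[OF e c] unfolding orthogonal_in_Hp_def by (simp only: if_True) blast
        have fq: "(\<lambda>z. f z + poly (- q) z) \<in> Lp p" by (rule Lp_add[OF p fL poly_in_Lp[OF p]])
        have "pairing (\<lambda>z. (f z + poly (- q) z) + poly q z) \<phi> = pairing (\<lambda>z. f z + poly (- q) z) \<phi>"
          using add[OF fq poly_in_Lp[OF p], of q] q(1) by (simp only: add_0_right)
        then have "cmod (pairing f \<phi>) \<le> c * Lp_norm p (\<lambda>z. f z - poly q z)" using le[OF fq] by (simp add: pairing_def)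
        also have "\<dots> \<le> c * (e / c)" using q c by (intro mult_left_mono) auto
        finally show ?thesis using c by simp
      qed
      then have "cmod (pairing f \<phi>) \<le> 0" by (rule field_le_epsilon)
      then show ?thesis by simp
    qed
    then have "pairing (\<lambda>z. \<phi> z + f z) \<phi> = c\<^sup>2" using add[OF \<phi>L fL] \<phi>\<phi> by simp
    then have "c\<^sup>2 \<le> c * Lp_norm p (\<lambda>z. \<phi> z + f z)" using le[OF Lp_add[OF p \<phi>L fL]] by (simp add: norm_power)
    then have "c \<le> Lp_norm p (\<lambda>z. \<phi> z + f z)" using c by (simp add: power2_eq_square)
    then show ?thesis using Lp_constant_modulus(2)[OF p \<phi>m c \<phi>c] by linarith
  qed
  moreover have "nontrivial \<phi>"
  proof -
    have "\<not> (AE z in circle_measure. \<phi> z = 0)"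
    proof
      assume "AE z in circle_measure. \<phi> z = 0"
      with \<phi>c have "AE z in circle_measure. False" by eventually_elim (use c in auto)
      then show False by (simp add: circle.AE_False)
    qed
    then show ?thesis by (simp add: nontrivial_def)
  qed
  ultimately show ?thesis using \<phi>H by (simp add: hilbert_point_def)
qed

lemma hilbert_point_infinity_constant_modulus:
  assumes h: "hilbert_point \<infinity> \<phi>"
  shows "\<exists>c>0. AE z in circle_measure. cmod (\<phi> z) = c"
proof (rule ccontr)
  assume neg: "\<not> ?thesis"
  have p: "1 \<le> (\<infinity> :: ennreal)" by simp
  have \<phi>L: "\<phi> \<in> Lp \<infinity>" and a: "analytic_L1 \<phi>" and nt: "\<not> (AE z in circle_measure. \<phi> z = 0)"
    using h Hp_iff[OF p] by (auto simp: hilbert_point_def nontrivial_def)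
  define M where "M = Lp_norm \<infinity> \<phi>"
  have \<phi>M: "AE z in circle_measure. cmod (\<phi> z) \<le> M" unfolding M_def by (rule Lp_infinity_bound(2)[OF \<phi>L])
  have "M \<noteq> 0"
  proof
    assume "M = 0"
    with \<phi>M have "AE z in circle_measure. \<phi> z = 0" by simp
    then show False using nt by blast
  qed
  then have M: "M > 0" using Lp_norm_def[of \<infinity> \<phi>] by (simp add: M_def order_less_le)
  have nc: "\<not> (AE z in circle_measure. cmod (\<phi> z) = M)" using neg M by blast
  obtain f M' where f: "f \<in> borel_measurable circle_measure" "AE z in circle_measure. cmod (f z) \<le> 2 * M" "analytic_L1 f"
    "(LINT z|circle_measure. f z * cnj (\<phi> z)) = 0" and M': "0 \<le> M'" "M' < M" "AE z in circle_measure. cmod (\<phi> z + f z) \<le> M'"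
    by (rule sup_norm_decreasing_perturbation[OF a M \<phi>M analytic_L1_nonzero_AE[OF a nt] nc])
  have "f \<in> Hp \<infinity>" unfolding Hp_iff[OF p] using Lp_infinityI(1)[OF f(1,2)] M f(3) by simp
  moreover have "orthogonal_in_Hp \<infinity> f \<phi>" using f(4) by (simp add: orthogonal_in_Hp_def pairing_def)
  ultimately have "M \<le> Lp_norm \<infinity> (\<lambda>z. \<phi> z + f z)" using h by (simp add: hilbert_point_def M_def)
  also have "\<dots> \<le> M'"
    by (rule Lp_infinityI(2)[OF _ M'(3,1)]) (use f(1) Lp_measurable[OF \<phi>L] in measurable)
  finally show False using M' by simp
qed

text \<open>The power mean inequality with exponent \<open>2 / r\<close>. It converts L2
  approximation by polynomials into L^r approximation for exponents up to 2.\<close>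

lemma powr_integral_le_L2:
  fixes g :: "complex \<Rightarrow> complex"
  assumes r: "1 \<le> r" "r \<le> 2" and gm[measurable]: "g \<in> borel_measurable circle_measure" and g: "integrable circle_measure (\<lambda>z. (cmod (g z))\<^sup>2)"
  shows "integrable circle_measure (\<lambda>z. cmod (g z) powr r)"
    "(LINT z|circle_measure. cmod (g z) powr r) \<le> (LINT z|circle_measure. (cmod (g z))\<^sup>2) powr (r / 2)"
proof -
  have e: "(cmod (g z) powr r) powr (2 / r) = (cmod (g z))\<^sup>2" for z using r by (simp add: powr_powr)
  have 1: "1 \<le> 2 / r" using r by simp
  have 2: "integrable circle_measure (\<lambda>z. (cmod (g z) powr r) powr (2 / r))" unfolding e by (rule g)
  show "integrable circle_measure (\<lambda>z. cmod (g z) powr r)" by (rule circle.power_mean(1)[OF 1 _ _ 2]) auto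
  show "(LINT z|circle_measure. cmod (g z) powr r) \<le> (LINT z|circle_measure. (cmod (g z))\<^sup>2) powr (r / 2)"
    using circle.power_mean(2)[OF 1 _ _ 2] unfolding e by simp
qed

text \<open>If the functional \<open>g \<mapsto> \<langle>g, \<phi>\<rangle>\<close> were unbounded in \<open>L\<^sup>2\<close>, its kernel would be dense in the analytic
  polynomials, so \<open>-\<phi>\<close> would be an admissible perturbation.\<close>

lemma hilbert_point_square_integrable:
  assumes h: "hilbert_point (ennreal r) \<phi>" and r: "1 \<le> r" "r < 2"
  shows "integrable circle_measure (\<lambda>z. (cmod (\<phi> z))\<^sup>2)"
proof (rule ccontr)
  assume neg: "\<not> ?thesis"
  have p: "1 \<le> ennreal r" using r by simp
  have p2: "ennreal r < 2" using r ennreal_less_iff[of r 2] by simp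
  have \<phi>L: "\<phi> \<in> Lp (ennreal r)" and a: "analytic_L1 \<phi>" and nt: "\<not> (AE z in circle_measure. \<phi> z = 0)"
    using h Hp_iff[OF p] by (auto simp: hilbert_point_def nontrivial_def)
  have \<phi>m[measurable]: "\<phi> \<in> borel_measurable circle_measure" and \<phi>r: "integrable circle_measure (\<lambda>z. cmod (\<phi> z) powr r)"
    using \<phi>L Lp_ennreal[OF r(1)] by auto
  have cm[measurable]: "(\<lambda>z. cnj (\<phi> z)) \<in> borel_measurable circle_measure"
    by (intro measurable_compose[OF \<phi>m] borel_measurable_continuous_onI continuous_intros)
  have \<phi>i: "integrable circle_measure \<phi>" using a by (simp add: analytic_L1_def)
  have pi: "integrable circle_measure (\<lambda>z. poly q z * cnj (\<phi> z))" for q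
    using integrable_mult_continuous[of "\<lambda>z. cnj (\<phi> z)" "poly q"] \<phi>i by (simp add: mult.commute continuous_intros)
  have unb: "\<exists>q. K * (LINT z|circle_measure. (cmod (poly q z))\<^sup>2) < (cmod (LINT z|circle_measure. poly q z * cnj (\<phi> z)))\<^sup>2" if "0 \<le> K" for K
  proof (rule ccontr)
    assume "\<not> ?thesis"
    then have "integrable circle_measure (\<lambda>z. (cmod (\<phi> z))\<^sup>2)"
      by (intro square_integrable_if_bounded_functional[OF a that]) (simp add: not_less)
    then show False using neg by blast
  qed
  have "orthogonal_in_Hp (ennreal r) (\<lambda>z. - \<phi> z) \<phi>"
    unfolding orthogonal_in_Hp_def if_P[OF p2]
  proof (intro allI impI)
    fix e :: real assume e: "e > 0"
    \<comment> \<open>Two errors of size \<open>t\<close> add up to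
      \<open>2 powr r * (t + t) = (e / 2) powr r\<close>.\<close>
    define t where "t = (e / 2) powr r / 2 powr r / 2"
    have t: "t > 0" using e by (simp add: t_def)
    obtain b B where b: "b \<in> borel_measurable circle_measure" "AE z in circle_measure. cmod (b z) \<le> B" "analytic_L1 b"
      "integrable circle_measure (\<lambda>z. cmod (\<phi> z - b z) powr r)" "(LINT z|circle_measure. cmod (\<phi> z - b z) powr r) < t"
      by (rule analytic_bounded_dense[OF a r(1) \<phi>r t])
    note bm[measurable] = b(1)
    have b2: "integrable circle_measure (\<lambda>z. (cmod (b z))\<^sup>2)"
    proof (rule circle.integrable_const_bound[where B="B\<^sup>2"])
      show "AE z in circle_measure. norm ((cmod (b z))\<^sup>2) \<le> B\<^sup>2" using b(2) by eventually_elim (simp add: power_mono)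
    qed measurable
    \<comment> \<open>Approximation and orthogonal correction contribute at most
      \<open>2 * d\<close> each, and \<open>4 * d\<close> is the squared L2 distance that
      corresponds to \<open>t\<close> in L^r.\<close>
    define d where "d = t powr (2 / r) / 4"
    have d: "d > 0" using t by (simp add: d_def)
    obtain q1 where q1: "(LINT z|circle_measure. (cmod (b z - poly q1 z))\<^sup>2) < d"
      by (rule analytic_L2_poly_dense[OF bm b2 b(3) d])
    define x where "x = (LINT z|circle_measure. poly q1 z * cnj (\<phi> z))"
    \<comment> \<open>Unboundedness with this constant gives a polynomial whose pairing with
      \<open>\<phi>\<close> is so large compared with its norm that the correction
      \<open>x / \<eta> * f1\<close> has squared norm at most \<open>d\<close>.\<close>
    obtain f1 where f1: "((cmod x)\<^sup>2 / d) * (LINT z|circle_measure. (cmod (poly f1 z))\<^sup>2) < (cmod (LINT z|circle_measure. poly f1 z * cnj (\<phi> z)))\<^sup>2"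
      using unb[of "(cmod x)\<^sup>2 / d"] d by auto
    define \<eta> where "\<eta> = (LINT z|circle_measure. poly f1 z * cnj (\<phi> z))"
    have \<eta>: "\<eta> \<noteq> 0"
    proof
      assume "\<eta> = 0"
      moreover have "0 \<le> ((cmod x)\<^sup>2 / d) * (LINT z|circle_measure. (cmod (poly f1 z))\<^sup>2)" using d by simp
      ultimately show False using f1 by (simp add: \<eta>_def[symmetric])
    qed
    define c where "c = x / \<eta>"
    define q where "q = q1 - smult c f1"
    have oq: "(LINT z|circle_measure. poly q z * cnj (\<phi> z)) = 0"
    proof -
      have "(LINT z|circle_measure. poly q z * cnj (\<phi> z)) = (LINT z|circle_measure. poly q1 z * cnj (\<phi> z) - c * (poly f1 z * cnj (\<phi> z)))"
        by (simp add: q_def left_diff_distrib mult.assoc)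
      also have "\<dots> = x - c * \<eta>" using pi by (simp add: x_def \<eta>_def)
      finally show ?thesis using \<eta> by (simp add: c_def)
    qed
    have q12: "integrable circle_measure (\<lambda>z. (cmod (b z - poly q1 z))\<^sup>2)"
      using integrable_square_add(1)[of b circle_measure "\<lambda>z. - poly q1 z"] b2 integrable_poly_square(1)[of q1] by simp
    have e1: "(\<lambda>z. (cmod (b z - poly q z))\<^sup>2) = (\<lambda>z. (cmod ((b z - poly q1 z) + poly (smult c f1) z))\<^sup>2)"
      by (simp add: q_def algebra_simps)
    have bq2: "integrable circle_measure (\<lambda>z. (cmod (b z - poly q z))\<^sup>2)"
      unfolding e1 by (rule integrable_square_add(1)[OF _ _ q12 integrable_poly_square(1)]) measurable
    have "(LINT z|circle_measure. (cmod (b z - poly q z))\<^sup>2) \<le> 2 * (LINT z|circle_measure. (cmod (b z - poly q1 z))\<^sup>2) + 2 * (LINT z|circle_measure. (cmod (poly (smult c f1) z))\<^sup>2)"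
      unfolding e1 by (rule integrable_square_add(2)[OF _ _ q12 integrable_poly_square(1)]) measurable
    also have "(LINT z|circle_measure. (cmod (poly (smult c f1) z))\<^sup>2) = (cmod c)\<^sup>2 * (LINT z|circle_measure. (cmod (poly f1 z))\<^sup>2)"
      by (simp add: norm_mult power_mult_distrib)
    also have "\<dots> \<le> d"
    proof -
      have "(cmod x)\<^sup>2 * (LINT z|circle_measure. (cmod (poly f1 z))\<^sup>2) \<le> d * (cmod \<eta>)\<^sup>2"
        using less_imp_le[OF f1[folded \<eta>_def]] d by (simp add: field_simps)
      then show ?thesis using \<eta> by (simp add: c_def norm_divide power_divide field_simps)
    qed
    finally have "(LINT z|circle_measure. (cmod (b z - poly q z))\<^sup>2) \<le> t powr (2 / r)" using q1 by (simp add: d_def)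
    then have "(LINT z|circle_measure. (cmod (b z - poly q z))\<^sup>2) powr (r / 2) \<le> (t powr (2 / r)) powr (r / 2)"
      using r by (intro powr_mono2) auto
    also have "\<dots> = t" using r t by (simp add: powr_powr)
    finally have bqr: "(LINT z|circle_measure. cmod (b z - poly q z) powr r) \<le> t"
      using powr_integral_le_L2(2)[of r "\<lambda>z. b z - poly q z"] r bq2 by simp
    have bqi: "integrable circle_measure (\<lambda>z. cmod (b z - poly q z) powr r)"
      using powr_integral_le_L2(1)[of r "\<lambda>z. b z - poly q z"] r bq2 by simp
    have "(LINT z|circle_measure. cmod (- \<phi> z - poly (- q) z) powr r) \<le> (LINT z|circle_measure. 2 powr r * (cmod (\<phi> z - b z) powr r + cmod (b z - poly q z) powr r))"
    proof (rule integral_mono')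
      fix z
      have "cmod (- \<phi> z - poly (- q) z) = cmod ((\<phi> z - b z) + (b z - poly q z))"
        by (simp add: norm_minus_commute)
      then show "cmod (- \<phi> z - poly (- q) z) powr r \<le> 2 powr r * (cmod (\<phi> z - b z) powr r + cmod (b z - poly q z) powr r)"
        using powr_cmod_add_le[OF r(1)] by metis
    qed (use b(4) bqi in auto)
    also have "\<dots> = 2 powr r * ((LINT z|circle_measure. cmod (\<phi> z - b z) powr r) + (LINT z|circle_measure. cmod (b z - poly q z) powr r))"
      using b(4) bqi by simp
    also have "\<dots> \<le> 2 powr r * (t + t)" using b(5) bqr by (intro mult_left_mono) auto
    also have "\<dots> = (e / 2) powr r" by (simp add: t_def)
    finally have "(LINT z|circle_measure. cmod (- \<phi> z - poly (- q) z) powr r) powr (1 / r) \<le> ((e / 2) powr r) powr (1 / r)"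
      using r by (intro powr_mono2) auto
    also have "\<dots> = e / 2" using r e by (simp add: powr_powr)
    finally have "Lp_norm (ennreal r) (\<lambda>z. - \<phi> z - poly (- q) z) < e" using e by (simp add: Lp_ennreal(2)[OF r(1)])
    moreover have "pairing (poly (- q)) \<phi> = 0" using oq by (simp add: pairing_def)
    ultimately show "\<exists>q. pairing (poly q) \<phi> = 0 \<and> Lp_norm (ennreal r) (\<lambda>z. - \<phi> z - poly q z) < e" by blast
  qed
  moreover have "(\<lambda>z. - \<phi> z) \<in> Hp (ennreal r)"
    using Lp_mult_bounded[OF p \<phi>L, of "\<lambda>_. -1" 1] analytic_L1_cmult[OF a, of "-1"] by (simp add: Hp_iff[OF p])
  ultimately have "Lp_norm (ennreal r) \<phi> \<le> Lp_norm (ennreal r) (\<lambda>z. \<phi> z + - \<phi> z)"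
    using h unfolding hilbert_point_def by blast
  \<comment> \<open>The perturbed function is zero, so minimality would force \<open>\<phi>\<close>
    itself to have norm zero.\<close>
  then have "(LINT z|circle_measure. cmod (\<phi> z)) \<le> 0"
    using Lp_integrable(2)[OF p \<phi>L] r by (simp add: Lp_ennreal(2)[OF r(1)])
  then have "(LINT z|circle_measure. cmod (\<phi> z)) = 0" by (simp add: antisym)
  then have "AE z in circle_measure. \<phi> z = 0" using \<phi>i by (subst (asm) integral_nonneg_eq_0_iff_AE) auto
  then show False using nt by blast
qed

text \<open>\<open>multiplicative_variation\<close> requires a square integrable
  \<open>\<phi>\<close>. Above exponent 2 this follows from the finiteness of the measure, below 2
  from minimality.\<close>

lemma hilbert_point_finite_constant_modulus:
  assumes h: "hilbert_point (ennreal r) \<phi>" and r: "1 \<le> r" "r \<noteq> 2"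
  shows "\<exists>c>0. AE z in circle_measure. cmod (\<phi> z) = c"
proof -
  have p: "1 \<le> ennreal r" using r by simp
  have p2: "ennreal r < 2 \<longleftrightarrow> r < 2" using r ennreal_less_iff[of r 2] by simp
  have \<phi>L: "\<phi> \<in> Lp (ennreal r)" and a: "analytic_L1 \<phi>" and nt: "\<not> (AE z in circle_measure. \<phi> z = 0)"
    using h Hp_iff[OF p] by (auto simp: hilbert_point_def nontrivial_def)
  have \<phi>m[measurable]: "\<phi> \<in> borel_measurable circle_measure" and \<phi>r: "integrable circle_measure (\<lambda>z. cmod (\<phi> z) powr r)"
    using \<phi>L Lp_ennreal[OF r(1)] by auto
  have nz: "AE z in circle_measure. \<phi> z \<noteq> 0" by (rule analytic_L1_nonzero_AE[OF a nt])
  have \<phi>2: "integrable circle_measure (\<lambda>z. (cmod (\<phi> z))\<^sup>2)"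
  proof (cases "r < 2")
    case True
    then show ?thesis by (rule hilbert_point_square_integrable[OF h r(1)])
  next
    case False
    have le: "(cmod (\<phi> z))\<^sup>2 \<le> 1 + cmod (\<phi> z) powr r" for z
    proof (cases "cmod (\<phi> z) \<le> 1")
      case True
      then have "(cmod (\<phi> z))\<^sup>2 \<le> 1" by (simp add: power_le_one)
      then show ?thesis by (simp add: add_increasing2)
    next
      case F: False
      then have "cmod (\<phi> z) powr 2 \<le> cmod (\<phi> z) powr r" using False by (intro powr_mono) auto
      then show ?thesis by simp
    qed
    show ?thesis
    proof (rule Bochner_Integration.integrable_bound)
      show "integrable circle_measure (\<lambda>z. 1 + cmod (\<phi> z) powr r)" using \<phi>r by simp
      show "AE z in circle_measure. norm ((cmod (\<phi> z))\<^sup>2) \<le> norm (1 + cmod (\<phi> z) powr r)"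
        by (rule AE_I2) (use le in \<open>simp add: abs_of_nonneg\<close>)
    qed measurable
  qed
  have min: "(LINT z|circle_measure. cmod (\<phi> z) powr r) \<le> (LINT z|circle_measure. cmod (\<phi> z * (1 + poly R z)) powr r)"
    if R: "(LINT z|circle_measure. (cmod (\<phi> z))\<^sup>2 * poly R z) = 0" for R
  proof -
    define f where "f z = \<phi> z * poly R z" for z
    obtain B where B: "0 \<le> B" "\<And>z. z \<in> sphere 0 1 \<Longrightarrow> norm (poly R z) \<le> B"
      by (rule continuous_on_sphere_bound[of "poly R"]) (intro continuous_intros, blast)
    have fL: "f \<in> Lp (ennreal r)" unfolding f_def by (rule Lp_mult_bounded[OF p \<phi>L measurable_poly_circle B(2)])
    have af: "analytic_L1 f" unfolding f_def by (rule analytic_L1_mult_poly[OF a])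
    note fm[measurable] = Lp_measurable[OF fL]
    have f\<phi>: "(LINT z|circle_measure. f z * cnj (\<phi> z)) = 0"
    proof -
      have "(LINT z|circle_measure. f z * cnj (\<phi> z)) = (LINT z|circle_measure. (cmod (\<phi> z))\<^sup>2 * poly R z)"
        by (rule Bochner_Integration.integral_cong) (simp_all only: f_def complex_norm_square mult_ac)
      then show ?thesis using R by simp
    qed
    \<comment> \<open>Below exponent 2 the vanishing pairing must be realised by polynomials. Both
      \<open>f\<close> and \<open>\<phi>\<close> are in L2, where orthogonal polynomials approximate
      \<open>f\<close>, and the L2 error dominates the L^r error.\<close>
    have "orthogonal_in_Hp (ennreal r) f \<phi>"
    proof (cases "r < 2")
      case False
      then show ?thesis using f\<phi> p2 by (simp add: orthogonal_in_Hp_def pairing_def)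
    next
      case True
      have pos: "(LINT z|circle_measure. (cmod (\<phi> z))\<^sup>2) > 0"
      proof -
        have "(LINT z|circle_measure. (cmod (\<phi> z))\<^sup>2) \<noteq> 0"
        proof
          assume "(LINT z|circle_measure. (cmod (\<phi> z))\<^sup>2) = 0"
          then have "AE z in circle_measure. (cmod (\<phi> z))\<^sup>2 = 0" using \<phi>2 by (subst (asm) integral_nonneg_eq_0_iff_AE) auto
          then show False using nt by simp
        qed
        then show ?thesis by (simp add: order_less_le)
      qed
      have f2: "integrable circle_measure (\<lambda>z. (cmod (f z))\<^sup>2)"
      proof (rule Bochner_Integration.integrable_bound)
        show "integrable circle_measure (\<lambda>z. B\<^sup>2 * (cmod (\<phi> z))\<^sup>2)" using \<phi>2 by simp
        show "AE z in circle_measure. norm ((cmod (f z))\<^sup>2) \<le> norm (B\<^sup>2 * (cmod (\<phi> z))\<^sup>2)"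
        proof (rule AE_I2)
          fix z :: complex assume "z \<in> space circle_measure"
          then have "(cmod (\<phi> z))\<^sup>2 * (cmod (poly R z))\<^sup>2 \<le> (cmod (\<phi> z))\<^sup>2 * B\<^sup>2"
            using B by (intro mult_left_mono power_mono) auto
          then show "norm ((cmod (f z))\<^sup>2) \<le> norm (B\<^sup>2 * (cmod (\<phi> z))\<^sup>2)"
            by (simp add: f_def norm_mult power_mult_distrib mult.commute)
        qed
      qed measurable
      have "\<exists>q. pairing (poly q) \<phi> = 0 \<and> Lp_norm (ennreal r) (\<lambda>z. f z - poly q z) < e" if e: "e > 0" for e
      proof -
        obtain q where q: "(LINT z|circle_measure. poly q z * cnj (\<phi> z)) = 0" "(LINT z|circle_measure. (cmod (f z - poly q z))\<^sup>2) < e\<^sup>2"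
          by (rule analytic_L2_orthogonal_poly_dense[OF \<phi>m \<phi>2 a pos fm f2 af f\<phi>, of "e\<^sup>2"]) (use e in auto)
        have fq: "integrable circle_measure (\<lambda>z. (cmod (f z - poly q z))\<^sup>2)"
          using integrable_square_add(1)[of f circle_measure "\<lambda>z. - poly q z"] f2 integrable_poly_square(1)[of q] by simp
        have "(LINT z|circle_measure. cmod (f z - poly q z) powr r) \<le> (LINT z|circle_measure. (cmod (f z - poly q z))\<^sup>2) powr (r / 2)"
          by (rule powr_integral_le_L2(2)[OF r(1)]) (use True fq in auto)
        also have "\<dots> < (e\<^sup>2) powr (r / 2)" using q(2) r by (intro powr_less_mono2) auto
        also have "\<dots> = e powr r" using e by (simp add: powr_powr flip: powr_numeral)
        finally have "(LINT z|circle_measure. cmod (f z - poly q z) powr r) powr (1 / r) < (e powr r) powr (1 / r)"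
          using r by (intro powr_less_mono2) auto
        also have "\<dots> = e" using e r by (simp add: powr_powr)
        finally show ?thesis using q(1) by (auto simp: pairing_def Lp_ennreal(2)[OF r(1)])
      qed
      then show ?thesis using True p2 by (simp add: orthogonal_in_Hp_def)
    qed
    moreover have "f \<in> Hp (ennreal r)" using fL af by (simp add: Hp_iff[OF p])
    ultimately have "Lp_norm (ennreal r) \<phi> \<le> Lp_norm (ennreal r) (\<lambda>z. \<phi> z + f z)"
      using h unfolding hilbert_point_def by blast
    then have le: "(LINT z|circle_measure. cmod (\<phi> z) powr r) powr (1 / r) \<le> (LINT z|circle_measure. cmod (\<phi> z * (1 + poly R z)) powr r) powr (1 / r)"
      by (simp add: Lp_ennreal(2)[OF r(1)] f_def distrib_left)
    have "((LINT z|circle_measure. cmod (\<phi> z) powr r) powr (1 / r)) powr r \<le> ((LINT z|circle_measure. cmod (\<phi> z * (1 + poly R z)) powr r) powr (1 / r)) powr r"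
      by (rule powr_mono2[OF _ _ le]) (use r in auto)
    moreover have "(x powr (1 / r)) powr r = x" if "x \<ge> 0" for x using r that by (simp add: powr_powr)
    moreover have "(LINT z|circle_measure. cmod (g z) powr r) \<ge> 0" for g :: "complex \<Rightarrow> complex" by simp
    ultimately show ?thesis by metis
  qed
  obtain \<gamma> where \<gamma>: "\<gamma> > 0" "AE z in circle_measure. cmod (\<phi> z) powr r = \<gamma> * (cmod (\<phi> z))\<^sup>2"
    by (rule multiplicative_variation[OF \<phi>m r(1) \<phi>2 \<phi>r nz min])
  \<comment> \<open>Division by \<open>|\<phi>|^2\<close> uses that \<open>\<phi>\<close> is nonzero
    almost everywhere; taking the root uses \<open>r \<noteq> 2\<close>.\<close>
  have "AE z in circle_measure. cmod (\<phi> z) = \<gamma> powr (1 / (r - 2))"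
    using \<gamma>(2) nz
  proof eventually_elim
    case (elim z)
    have "cmod (\<phi> z) powr (r - 2) = \<gamma>" using elim by (simp add: powr_diff)
    then have "\<gamma> powr (1 / (r - 2)) = (cmod (\<phi> z) powr (r - 2)) powr (1 / (r - 2))" by simp
    also have "\<dots> = cmod (\<phi> z)" using r elim by (simp add: powr_powr)
    finally show ?case by simp
  qed
  then show ?thesis using \<gamma>(1) by (intro exI[of _ "\<gamma> powr (1 / (r - 2))"]) auto
qed

theorem theorem1p1:
  fixes p :: ennreal and \<phi> :: "complex \<Rightarrow> complex"
  assumes "1 \<le> p" and "p \<noteq> 2"
    and "\<phi> \<in> borel_measurable circle_measure" and "nontrivial \<phi>"
  shows "hilbert_point p \<phi> \<longleftrightarrow>
    (\<exists>C I. C \<noteq> 0 \<and> inner_function p I \<and> (AE z in circle_measure. \<phi> z = C * I z))"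
proof
  note p = assms(1)
  assume h: "hilbert_point p \<phi>"
  have "\<exists>c>0. AE z in circle_measure. cmod (\<phi> z) = c"
    using p
  proof (cases rule: exponent_cases)
    case 1
    then show ?thesis using hilbert_point_infinity_constant_modulus h by simp
  next
    case (2 r)
    then have "r \<noteq> 2" using assms(2) by auto
    then show ?thesis using hilbert_point_finite_constant_modulus h 2 by simp
  qed
  then obtain c where c: "c > 0" "AE z in circle_measure. cmod (\<phi> z) = c" by blast
  define I where "I z = complex_of_real (inverse c) * \<phi> z" for z
  have Im: "I \<in> borel_measurable circle_measure" unfolding I_def using assms(3) by measurable
  have I1: "AE z in circle_measure. cmod (I z) = 1"
    using c(2) by eventually_elim (use c(1) in \<open>simp add: I_def norm_mult norm_inverse\<close>)
  have "analytic_L1 I" unfolding I_def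
    using h by (intro analytic_L1_cmult) (simp add: hilbert_point_def Hp_iff[OF p])
  then have "inner_function p I"
    using Lp_constant_modulus(1)[OF p Im _ I1] I1 by (simp add: inner_function_def Hp_iff[OF p])
  moreover have "\<phi> z = complex_of_real c * I z" for z using c(1) by (simp add: I_def)
  ultimately show "\<exists>C I. C \<noteq> 0 \<and> inner_function p I \<and> (AE z in circle_measure. \<phi> z = C * I z)"
    using c(1) by (intro exI[of _ "complex_of_real c"] exI[of _ I]) auto
next
  note p = assms(1)
  note \<phi>m[measurable] = assms(3)
  assume "\<exists>C I. C \<noteq> 0 \<and> inner_function p I \<and> (AE z in circle_measure. \<phi> z = C * I z)"
  then obtain C I where C: "C \<noteq> 0" and I: "inner_function p I" and eq: "AE z in circle_measure. \<phi> z = C * I z" by blast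
  have IL: "I \<in> Lp p" and aI: "analytic_L1 I" and I1: "AE z in circle_measure. cmod (I z) = 1"
    using I by (auto simp: inner_function_def Hp_iff[OF p])
  note Im[measurable] = Lp_measurable[OF IL]
  have \<phi>c: "AE z in circle_measure. cmod (\<phi> z) = cmod C"
    using eq I1 by eventually_elim (simp add: norm_mult)
  have \<phi>L: "\<phi> \<in> Lp p" by (rule Lp_constant_modulus(1)[OF p \<phi>m _ \<phi>c]) (use C in simp)
  \<comment> \<open>The representation holds only almost everywhere, so analyticity is carried from
    \<open>C * I\<close> to \<open>\<phi>\<close> under the integral.\<close>
  have "(LINT z|circle_measure. \<phi> z * (z * poly q z)) = 0" for q
  proof -
    have zq[measurable]: "(\<lambda>z. z * poly q z) \<in> borel_measurable circle_measure"
      by (intro measurable_circle_continuous continuous_intros)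
    have "(LINT z|circle_measure. \<phi> z * (z * poly q z)) = (LINT z|circle_measure. C * I z * (z * poly q z))"
    proof (rule integral_cong_AE)
      show "AE z in circle_measure. \<phi> z * (z * poly q z) = C * I z * (z * poly q z)"
        using eq by eventually_elim simp
    qed measurable
    also have "\<dots> = 0" using analytic_L1_cmult[OF aI, of C] by (simp add: analytic_L1_def)
    finally show ?thesis .
  qed
  then have "analytic_L1 \<phi>" using Lp_integrable(1)[OF p \<phi>L] by (simp add: analytic_L1_def)
  then have "\<phi> \<in> Hp p" using \<phi>L by (simp add: Hp_iff[OF p])
  then show "hilbert_point p \<phi>"
    by (rule hilbert_point_if_constant_modulus[OF p _ _ \<phi>c]) (use C in simp)
qed

end
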